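(* Assume that, for all $i,j\in\{1,\dots,k\}$, as $n\to\infty$: $n_n^{(i)}/n_n^{(j)}\to\nu_{ij}\in(0,\infty)$; $1/n_n^{(i)}\ll p_n^{(i)}\lesssim (n_n^{(i)})^{-1/r'}$ for some $r'\in(1,r)$; $q_n^{(ij)}\le\min\{p_n^{(i)},p_n^{(j)}\}$ for all $n$; $q_n^{(ij)}/p_n^{(i)}\to\gamma_{ij}\in[0,1]$ and $p_n^{(i)}/p_n^{(j)}\to\mu_{ij}\in(0,\infty)$; $a_n^{(i)}/g_n^{(i)}\to\alpha_i\ge 0$; the matrix $\chi=(\chi_{ij})_{1\le i,j\le k}$ is irreducible; and $\alpha_1\ge\alpha_2\ge\dots\ge\alpha_k$ with $\alpha_1>0$. Assume moreover the sub-critical condition $$\min_{x\in\mathcal D_\rho}\rho_1(x)<0 .$$ Then $$\lim_{n\to\infty}\frac{A_n^*}{g_n^{(1)}}=x_*\in(0,\infty)\quad\text{almost surely},$$ where $x_*:=\sum_{i=1}^k x_i(y_{\mathcal E})\,\bigl(\nu_{1i}(\mu_{1i})^r\bigr)^{1/(r-1)}$ and $x(y_{\mathcal E})=(x_1(y_{\mathcal E}),\dots,x_k(y_{\mathcal E}))$ is the exit point of the Cauchy problem described in the context.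
   Context: Fix integers $r\ge2$ and $k\ge1$. All limits are as $n\to\infty$; $f_1\ll f_2$ means $f_1(n)/f_2(n)\to0$; $f_1\lesssim f_2$ means that either $f_1\ll f_2$ or $f_1(n)/f_2(n)\to1$. Stochastic block model: for each $n$, a random graph on $n$ nodes partitioned into communities $G_1,\dots,G_k$ of sizes $n_n^{(1)},\dots,n_n^{(k)}\in\{1,2,\dots\}$, $\sum_i n_n^{(i)}=n$. Each pair of distinct nodes, one in $G_i$ and the other in $G_j$ (possibly $i=j$), is joined by an edge independently of the other pairs with probability $q_n^{(ij)}=q_n^{(ji)}\in[0,1)$. Put $p_n^{(i)}:=q_n^{(ii)}$. The models for different $n$ are defined on a common probability space (no assumption is made on their joint law). Bootstrap percolation: in each $G_i$, a set of $a_n^{(i)}$ nodes ($0\le a_n^{(i)}\le n_n^{(i)}$), called seeds, is chosen uniformly at random and declared active; all other nodes are initially inactive. An inactive node becomes active as soon as at least $r$ of its neighbours are active; active nodes stay active forever. The process stops when no more nodes can be activated. $A_n^*$ is the final number of active nodes (seeds included). Definitions: $g_n^{(i)}:=\left(1-\frac1r\right)\left(\frac{(r-1)!}{n_n^{(i)}(p_n^{(i)})^r}\right)^{1/(r-1)}$; $\chi_{ij}:=\lim_{n\to\infty}\frac{q_n^{(ij)}g_n^{(j)}}{p_n^{(i)}g_n^{(i)}}=\gamma_{ij}(\nu_{ij}(\mu_{ij})^r)^{1/(r-1)}$ (so $\chi_{ii}=1$). For $x\in\mathbb R^k$ and $1\le i\le k$, $$\rho_i(x):=\alpha_i-x_i+r^{-1}(1-r^{-1})^{r-1}\Bigl(\sum_{j=1}^k\chi_{ij}x_j\Bigr)^r,\qquad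 \rho:=(\rho_1,\dots,\rho_k).$$ $\mathcal D:=\{x\in[0,r/(r-1)]^k: x_i+\sum_{j\ne i}\chi_{ij}x_j\le r/(r-1)\ \forall i\}$ and $\mathcal D_\rho:=\{x\in\mathcal D:\rho_1(x)=\dots=\rho_k(x)\}$. Initial point: let $\mathcal K_0:=\{1\}$, $\mathcal K_1:=\{i\in\{2,\dots,k\}:\chi_{1i}>0\}$ and, for $h\ge2$, $\mathcal K_h:=\{i\in\{2,\dots,k\}:(\chi^h)_{1i}>0,\ (\chi^s)_{1i}=0\ \forall 1\le s\le h-1\}$ ($\chi^h$ is the $h$-th matrix power); $\overline d:=\max\{h:\mathcal K_h\ne\emptyset\}$. Let $\underline\chi:=\min\{\chi_{ij}:\chi_{ij}>0\}$, $\beta_0:=\alpha_1/2$, $\beta_h:=\frac{r^{-1}(1-r^{-1})^{r-1}}2(\underline\chi\beta_{h-1})^r$ for $1\le h\le\overline d$, and let $x_0$ be the vector whose $i$-th component is $\beta_h$ when $i\in\mathcal K_h$. Cauchy problem: consider $\rho$ as a function on the closed ball $B$ centred at $x_0$ with radius the diameter of $\mathcal D$, and let $x(y)$, $y\in[y_0,y_+)$, be the unique solution of $x'(y)=\rho(x(y))$, $x(y_0)=x_0$, where $y_0\in\mathbb R$ is arbitrary and $y_+:=\sup\{y>y_0: x(y)\in B\}$. Let $\mathcal E':=\{x\in\mathcal D:\rho(x)\ge0\text{ componentwise}\}$, $\mathcal E$ the closure of the connected component of $\mathcal E'$ containing $x_0$, $\mathcal E^\circ$ its interior, $y_{\mathcal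 E}:=\inf\{y\in(y_0,y_+):x(y)\notin\mathcal E^\circ\}$ ($:=+\infty$ if this set is empty), and $x(y_{\mathcal E}):=\lim_{y\uparrow y_{\mathcal E}}x(y)$ (the limit exists because $x(\cdot)$ is componentwise increasing in $\mathcal E$). *)

theory Defs
  imports "HOL-Probability.Probability"
begin

text \<open>
  The index set \<open>{1,\<dots>,k}\<close> of the communities is an arbitrary type \<open>'k\<close> that is finite and
  linearly ordered, so \<open>k = CARD('k) \<ge> 1\<close>; the index \<open>1\<close> is its least element.
\<close>

definition fst_idx :: "'k::{finite,linorder}" where
  "fst_idx = Min UNIV"

type_synonym 'k rvec = "(real, 'k) vec"
type_synonym 'k rmat = "('k rvec, 'k) vec"


subsection \<open>Asymptotic comparison\<close>

text \<open>
  The eventual non-vanishing of the denominator is implicit in writing the quotient; it has to be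
  made explicit because \<open>x / 0 = 0\<close>.
\<close>

definition much_less :: "(nat \<Rightarrow> real) \<Rightarrow> (nat \<Rightarrow> real) \<Rightarrow> bool" where
  "much_less f1 f2 \<longleftrightarrow>
     (\<forall>\<^sub>F n in sequentially. f2 n \<noteq> 0) \<and> (\<lambda>n. f1 n / f2 n) \<longlonglongrightarrow> 0"

definition less_sim :: "(nat \<Rightarrow> real) \<Rightarrow> (nat \<Rightarrow> real) \<Rightarrow> bool" where
  "less_sim f1 f2 \<longleftrightarrow> much_less f1 f2 \<or> (\<lambda>n. f1 n / f2 n) \<longlonglongrightarrow> 1"


subsection \<open>Bootstrap percolation on the stochastic block model\<close>

text \<open>
  The nodes of the \<open>n\<close>-th graph are \<open>0,\<dots>,n-1\<close>, and \<open>c v\<close> is the index of the community of node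
  \<open>v\<close>. An unordered pair of distinct nodes is represented by the ordered pair \<open>(u,v)\<close> with \<open>u < v\<close>.
\<close>

definition community :: "nat \<Rightarrow> (nat \<Rightarrow> 'k) \<Rightarrow> 'k \<Rightarrow> nat set" where
  "community n c i = {v. v < n \<and> c v = i}"

definition node_pairs :: "nat \<Rightarrow> (nat \<times> nat) set" where
  "node_pairs n = {(u, v). u < v \<and> v < n}"

definition sbm_pmf ::
    "nat \<Rightarrow> (nat \<Rightarrow> 'k) \<Rightarrow> ('k \<Rightarrow> 'k \<Rightarrow> real) \<Rightarrow> (nat \<times> nat) set pmf" where
  "sbm_pmf n c q =
     map_pmf Collect (Pi_pmf (node_pairs n) False (\<lambda>(u, v). bernoulli_pmf (q (c u) (c v))))"

definition seeds_pmf :: "nat \<Rightarrow> (nat \<Rightarrow> 'k::finite) \<Rightarrow> ('k \<Rightarrow> nat) \<Rightarrow> nat set pmf" where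
  "seeds_pmf n c a =
     map_pmf (\<lambda>T. \<Union>i. T i)
       (Pi_pmf UNIV {} (\<lambda>i. pmf_of_set {T. T \<subseteq> community n c i \<and> card T = a i}))"

text \<open>
  The random graph \<open>E\<close> and the random seed set \<open>S\<close>, defined on the probability space \<open>M\<close>, are
  independent, with the laws above.
\<close>

definition sbm_with_seeds ::
    "'w measure \<Rightarrow> nat \<Rightarrow> (nat \<Rightarrow> 'k::finite) \<Rightarrow> ('k \<Rightarrow> 'k \<Rightarrow> real) \<Rightarrow> ('k \<Rightarrow> nat)
      \<Rightarrow> ('w \<Rightarrow> (nat \<times> nat) set) \<Rightarrow> ('w \<Rightarrow> nat set) \<Rightarrow> bool" where
  "sbm_with_seeds M n c q a E S \<longleftrightarrow>
     (\<lambda>\<omega>. (E \<omega>, S \<omega>)) \<in> M \<rightarrow>\<^sub>M count_space UNIV \<and>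
     distr M (count_space UNIV) (\<lambda>\<omega>. (E \<omega>, S \<omega>)) =
       measure_pmf (pair_pmf (sbm_pmf n c q) (seeds_pmf n c a))"

definition active_nbrs :: "(nat \<times> nat) set \<Rightarrow> nat set \<Rightarrow> nat \<Rightarrow> nat set" where
  "active_nbrs E A v = {u \<in> A. (u, v) \<in> E \<or> (v, u) \<in> E}"

text \<open>
  All inactive nodes with at least \<open>r\<close> active neighbours are activated simultaneously; the final
  active set does not depend on the order of the activations.
\<close>

definition activate :: "nat \<Rightarrow> nat \<Rightarrow> (nat \<times> nat) set \<Rightarrow> nat set \<Rightarrow> nat set" where
  "activate r n E A = A \<union> {v. v < n \<and> r \<le> card (active_nbrs E A v)}"

definition final_active :: "nat \<Rightarrow> nat \<Rightarrow> (nat \<times> nat) set \<Rightarrow> nat set \<Rightarrow> nat set" where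
  "final_active r n E S = (\<Union>t. (activate r n E ^^ t) S)"


subsection \<open>Scaling and the matrix \<open>\<chi>\<close>\<close>

definition crit_scale ::
    "nat \<Rightarrow> (nat \<Rightarrow> 'k \<Rightarrow> nat) \<Rightarrow> (nat \<Rightarrow> 'k \<Rightarrow> 'k \<Rightarrow> real) \<Rightarrow> nat \<Rightarrow> 'k \<Rightarrow> real" where
  "crit_scale r N q n i =
     (1 - 1 / real r) *
     (fact (r - 1) / (real (N n i) * (q n i i) ^ r)) powr (1 / (real r - 1))"

definition chi_mat ::
    "nat \<Rightarrow> (nat \<Rightarrow> 'k \<Rightarrow> nat) \<Rightarrow> (nat \<Rightarrow> 'k \<Rightarrow> 'k \<Rightarrow> real) \<Rightarrow> 'k::finite rmat" where
  "chi_mat r N q =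
     (\<chi> i j. lim (\<lambda>n. (q n i j * crit_scale r N q n j) / (q n i i * crit_scale r N q n i)))"

text \<open>The power \<open>^\<close> on \<open>real ^ 'k ^ 'k\<close> is entrywise, hence a separate matrix power.\<close>

primrec mat_power :: "'k::finite rmat \<Rightarrow> nat \<Rightarrow> 'k rmat" where
  "mat_power C 0 = mat 1"
| "mat_power C (Suc h) = C ** mat_power C h"

text \<open>Irreducibility in the usual sense for matrices with nonnegative entries.\<close>

definition irreducible_mat :: "'k::finite rmat \<Rightarrow> bool" where
  "irreducible_mat C \<longleftrightarrow> (\<forall>i j. \<exists>h\<ge>1. mat_power C h $ i $ j > 0)"


subsection \<open>The vector field and its domain\<close>

definition rho :: "nat \<Rightarrow> ('k \<Rightarrow> real) \<Rightarrow> 'k::finite rmat \<Rightarrow> 'k rvec \<Rightarrow> 'k rvec" where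
  "rho r \<alpha> C x =
     (\<chi> i. \<alpha> i - x $ i +
        (1 / real r) * (1 - 1 / real r) ^ (r - 1) * (\<Sum>j\<in>UNIV. C $ i $ j * x $ j) ^ r)"

definition dom_D :: "nat \<Rightarrow> 'k::finite rmat \<Rightarrow> 'k rvec set" where
  "dom_D r C =
     {x. (\<forall>i. 0 \<le> x $ i \<and> x $ i \<le> real r / (real r - 1)) \<and>
         (\<forall>i. x $ i + (\<Sum>j\<in>UNIV - {i}. C $ i $ j * x $ j) \<le> real r / (real r - 1))}"

definition dom_D_rho :: "nat \<Rightarrow> ('k \<Rightarrow> real) \<Rightarrow> 'k::finite rmat \<Rightarrow> 'k rvec set" where
  "dom_D_rho r \<alpha> C = {x \<in> dom_D r C. \<forall>i j. rho r \<alpha> C x $ i = rho r \<alpha> C x $ j}"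

text \<open>
  The minimum of \<open>\<rho>\<^sub>1\<close> over \<open>dom_D_rho\<close> is attained and negative. (\<open>Inf\<close> would not do if the set were
  empty, as \<open>Inf {}\<close> is unspecified on the reals.)
\<close>

definition subcritical ::
    "nat \<Rightarrow> ('k \<Rightarrow> real) \<Rightarrow> 'k::{finite,linorder} rmat \<Rightarrow> bool" where
  "subcritical r \<alpha> C \<longleftrightarrow>
     (\<exists>x. is_arg_min (\<lambda>x. rho r \<alpha> C x $ fst_idx) (\<lambda>x. x \<in> dom_D_rho r \<alpha> C) x \<and>
          rho r \<alpha> C x $ fst_idx < 0)"


subsection \<open>The initial point\<close>

text \<open>For \<open>h = 1\<close> the quantifier over \<open>s\<close> is void.\<close>

definition layer :: "'k::{finite,linorder} rmat \<Rightarrow> nat \<Rightarrow> 'k set" where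
  "layer C h =
     (if h = 0 then {fst_idx}
      else {i. i \<noteq> fst_idx \<and> mat_power C h $ fst_idx $ i > 0 \<and>
               (\<forall>s\<in>{1..<h}. mat_power C s $ fst_idx $ i = 0)})"

definition chi_min :: "'k::finite rmat \<Rightarrow> real" where
  "chi_min C = Min {C $ i $ j | i j. C $ i $ j > 0}"

primrec beta_seq ::
    "nat \<Rightarrow> ('k \<Rightarrow> real) \<Rightarrow> 'k::{finite,linorder} rmat \<Rightarrow> nat \<Rightarrow> real" where
  "beta_seq r \<alpha> C 0 = \<alpha> fst_idx / 2"
| "beta_seq r \<alpha> C (Suc h) =
     ((1 / real r) * (1 - 1 / real r) ^ (r - 1)) / 2 * (chi_min C * beta_seq r \<alpha> C h) ^ r"

text \<open>
  The layers are disjoint, and for irreducible \<open>C\<close> they cover all indices; \<open>beta_seq\<close> is only used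
  at those \<open>h\<close> for which \<open>layer C h\<close> is nonempty.
\<close>

definition init_point ::
    "nat \<Rightarrow> ('k \<Rightarrow> real) \<Rightarrow> 'k::{finite,linorder} rmat \<Rightarrow> 'k rvec" where
  "init_point r \<alpha> C = (\<chi> i. beta_seq r \<alpha> C (THE h. i \<in> layer C h))"


subsection \<open>The Cauchy problem\<close>

definition ball_B ::
    "nat \<Rightarrow> ('k \<Rightarrow> real) \<Rightarrow> 'k::{finite,linorder} rmat \<Rightarrow> 'k rvec set" where
  "ball_B r \<alpha> C = cball (init_point r \<alpha> C) (diameter (dom_D r C))"

text \<open>
  \<open>x\<close> solves the Cauchy problem on \<open>[y0, T)\<close>, where \<open>T\<close> may be infinite. As the vector field is
  considered on the ball only, a solution does not leave the ball.
\<close>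

definition cauchy_on ::
    "nat \<Rightarrow> ('k \<Rightarrow> real) \<Rightarrow> 'k::{finite,linorder} rmat \<Rightarrow> real \<Rightarrow> ereal
      \<Rightarrow> (real \<Rightarrow> 'k rvec) \<Rightarrow> bool" where
  "cauchy_on r \<alpha> C y0 T x \<longleftrightarrow>
     ereal y0 < T \<and> x y0 = init_point r \<alpha> C \<and>
     (\<forall>y. y0 \<le> y \<and> ereal y < T \<longrightarrow>
        x y \<in> ball_B r \<alpha> C \<and>
        (x has_vector_derivative rho r \<alpha> C (x y)) (at y within {y. y0 \<le> y \<and> ereal y < T}))"

text \<open>\<open>y\<^sub>+\<close>: the time up to which the solution exists in the ball.\<close>

definition y_plus ::
    "nat \<Rightarrow> ('k \<Rightarrow> real) \<Rightarrow> 'k::{finite,linorder} rmat \<Rightarrow> real \<Rightarrow> ereal" where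
  "y_plus r \<alpha> C y0 = Sup {T. \<exists>x. cauchy_on r \<alpha> C y0 T x}"

text \<open>
  The solution is unique on \<open>[y0, y\<^sub>+)\<close>; its values elsewhere are immaterial.
\<close>

definition cauchy_sol ::
    "nat \<Rightarrow> ('k \<Rightarrow> real) \<Rightarrow> 'k::{finite,linorder} rmat \<Rightarrow> real \<Rightarrow> real \<Rightarrow> 'k rvec" where
  "cauchy_sol r \<alpha> C y0 = (SOME x. cauchy_on r \<alpha> C y0 (y_plus r \<alpha> C y0) x)"

definition set_E' ::
    "nat \<Rightarrow> ('k \<Rightarrow> real) \<Rightarrow> 'k::finite rmat \<Rightarrow> 'k rvec set" where
  "set_E' r \<alpha> C = {x \<in> dom_D r C. \<forall>i. 0 \<le> rho r \<alpha> C x $ i}"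

definition set_E ::
    "nat \<Rightarrow> ('k \<Rightarrow> real) \<Rightarrow> 'k::{finite,linorder} rmat \<Rightarrow> 'k rvec set" where
  "set_E r \<alpha> C = closure (connected_component_set (set_E' r \<alpha> C) (init_point r \<alpha> C))"

text \<open>In \<open>ereal\<close>, the infimum of the empty set is \<open>\<infinity>\<close>.\<close>

definition y_exit ::
    "nat \<Rightarrow> ('k \<Rightarrow> real) \<Rightarrow> 'k::{finite,linorder} rmat \<Rightarrow> real \<Rightarrow> ereal" where
  "y_exit r \<alpha> C y0 =
     Inf (ereal ` {y. y0 < y \<and> ereal y < y_plus r \<alpha> C y0 \<and>
                      cauchy_sol r \<alpha> C y0 y \<notin> interior (set_E r \<alpha> C)})"

definition x_exit ::
    "nat \<Rightarrow> ('k \<Rightarrow> real) \<Rightarrow> 'k::{finite,linorder} rmat \<Rightarrow> real \<Rightarrow> 'k rvec" where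
  "x_exit r \<alpha> C y0 =
     Lim (if y_exit r \<alpha> C y0 = \<infinity> then at_top else at_left (real_of_ereal (y_exit r \<alpha> C y0)))
       (cauchy_sol r \<alpha> C y0)"

end

theory Submission
  imports Defs
begin

text \<open>
  Condition on the seeds and reveal the edges node by node: an active node \<open>u\<close> is removed and the
  threshold of each of its neighbours is lowered by one. Every edge is then revealed at most once, so
  the marks of the remaining nodes stay independent, and induction over the removed nodes shows the
  following for deterministic community counts. If a set with \<open>t\<^sub>j\<close> nodes in community \<open>j\<close> is so small
  that, seeds included, at most \<open>t\<^sub>i\<close> nodes of each community \<open>i\<close> are expected to have \<open>r\<close> neighbours in
  it, then \<open>t\<close> bounds the final active set up to a Chernoff error; and a finite chain
  \<open>0 = T\<^sub>0, T\<^sub>1, \<dots>, T\<^sub>m\<close> in which each term is slightly below the mean number of nodes activated by the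
  previous one gives the lower bound \<open>T\<^sub>m\<close>. No union bound over sets of nodes is needed.

  On the scale \<open>g\<^sub>n\<close> the mean number of nodes activated by \<open>x\<close> is \<open>F x = \<rho> x + x\<close>. Hence the limit is the
  least fixed point \<open>L\<close> of \<open>F\<close>: it is approached from below by iterating \<open>F\<close> from \<open>0\<close>, and from above
  by the points on the segment from \<open>L\<close> to a point of \<open>\<D>\<^sub>\<rho>\<close> with \<open>\<rho> < 0\<close>, at which \<open>F w < w\<close> because \<open>F\<close> is
  convex. The Chernoff errors are summable since \<open>g\<^sub>n\<close> grows polynomially.

  The vector field \<open>\<rho>\<close> is cooperative, so \<open>\<rho>\<close> stays positive along the solution of the Cauchy problem,
  which increases to \<open>L\<close> without leaving the interior of \<open>\<E>\<close>. Thus \<open>y\<^sub>\<E> = \<infinity>\<close> and the exit point is \<open>L\<close>.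
\<close>


subsection \<open>Peeling off a node of a threshold process\<close>

text \<open>The obstacle is that the final set depends on the edges, so the number of nodes with
  \<open>r\<close> neighbours in it is not a sum of independent indicators. The remedy is a
  functional that survives the revelation of edges: each remaining node \<open>v\<close> of
  community \<open>i\<close> carries the exponential moment of the indicator that \<open>v\<close>
  has at least \<open>th v\<close> neighbours in a fixed set with \<open>t j\<close> nodes of each
  community \<open>j\<close>. Removing an active node of community \<open>j\<close> lowers
  \<open>t j\<close> by one and the thresholds of its neighbours by one; conditioning on a single
  Bernoulli variable shows that the mean of the functional does not change. For the lower bound this
  is done for all terms of the chain at once, up to an inequality in the favourable direction. The
  scale \<open>g\<close> is the one on which the mean number of activated nodes is comparable with
  the number of activating ones; there \<open>F w < w\<close>, respectively a chain staying below
  its images under \<open>F\<close>, is what makes the exponents negative multiples of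
  \<open>g\<close>.\<close>

text \<open>A node with threshold \<open>0\<close> is a seed.\<close>

definition closed_act :: "nat set \<Rightarrow> (nat \<times> nat) set \<Rightarrow> (nat \<Rightarrow> nat) \<Rightarrow> nat set \<Rightarrow> bool" where
  "closed_act W E th A \<longleftrightarrow> A \<subseteq> W \<and> (\<forall>v\<in>W. th v \<le> card (active_nbrs E A v) \<longrightarrow> v \<in> A)"

text \<open>The least closed set is taken as an intersection, not as a limit of rounds: the order of
  activations disappears, and removing a node becomes a bijection between two families of closed
  sets.\<close>

definition act_hull :: "nat set \<Rightarrow> (nat \<times> nat) set \<Rightarrow> (nat \<Rightarrow> nat) \<Rightarrow> nat set" where
  "act_hull W E th = \<Inter>{A. closed_act W E th A}"

lemma closed_act_UNIV: "closed_act W E th W"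
  by (auto simp: closed_act_def)

lemma act_hull_subset: "act_hull W E th \<subseteq> W"
  unfolding act_hull_def using closed_act_UNIV by blast

lemma card_active_nbrs_mono:
  assumes "finite B" "A \<subseteq> B"
  shows "card (active_nbrs E A v) \<le> card (active_nbrs E B v)"
  using assms by (intro card_mono) (auto simp: active_nbrs_def)

lemma act_hull_eq_empty:
  assumes "\<And>v. v \<in> W \<Longrightarrow> th v > 0"
  shows "act_hull W E th = {}"
proof -
  have "closed_act W E th {}"
    using assms by (auto simp: closed_act_def active_nbrs_def)
  then show ?thesis
    by (auto simp: act_hull_def)
qed

lemma card_active_nbrs_insert:
  assumes "finite B" "u \<notin> B"
  shows "card (active_nbrs E (insert u B) v) =
    card (active_nbrs E B v) + (if (u, v) \<in> E \<or> (v, u) \<in> E then 1 else 0)"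
proof -
  have "active_nbrs E (insert u B) v =
      (if (u, v) \<in> E \<or> (v, u) \<in> E then insert u (active_nbrs E B v) else active_nbrs E B v)"
    by (auto simp: active_nbrs_def)
  moreover have "finite (active_nbrs E B v)" "u \<notin> active_nbrs E B v"
    using assms by (auto simp: active_nbrs_def)
  ultimately show ?thesis
    by simp
qed

text \<open>A closed set contains \<open>u\<close>, whose threshold is \<open>0\<close>, and
  deleting \<open>u\<close> maps the closed sets for \<open>th\<close> bijectively to those for the
  lowered thresholds. Truncated subtraction is harmless: \<open>th v \<le> m + 1\<close> and
  \<open>th v - 1 \<le> m\<close> are equivalent even for \<open>th v = 0\<close>.\<close>

lemma act_hull_peel:
  assumes "finite W" "u \<in> W" "th u = 0"
  shows "act_hull W E th =
    insert u (act_hull (W - {u}) E (\<lambda>v. th v - (if (u, v) \<in> E \<or> (v, u) \<in> E then 1 else 0)))"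
    (is "_ = insert u (act_hull _ _ ?th')")
proof -
  have iff: "closed_act W E th (insert u B) \<longleftrightarrow> closed_act (W - {u}) E ?th' B"
    if "B \<subseteq> W - {u}" for B
  proof -
    have "finite B" "u \<notin> B"
      using that assms(1) finite_subset[of B W] by auto
    then have "(th v \<le> card (active_nbrs E (insert u B) v)) = (?th' v \<le> card (active_nbrs E B v))" for v
      by (auto simp: card_active_nbrs_insert)
    then show ?thesis
      using that assms(2) unfolding closed_act_def by auto
  qed
  have "{A. closed_act W E th A} = insert u ` {B. closed_act (W - {u}) E ?th' B}"
  proof (intro set_eqI iffI)
    fix A assume A: "A \<in> {A. closed_act W E th A}"
    then have "u \<in> A" "A \<subseteq> W"
      using assms by (auto simp: closed_act_def)
    then have "A = insert u (A - {u})" "closed_act (W - {u}) E ?th' (A - {u})"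
      using A iff[of "A - {u}"] by (auto simp: insert_absorb)
    then show "A \<in> insert u ` {B. closed_act (W - {u}) E ?th' B}"
      by blast
  next
    fix A assume "A \<in> insert u ` {B. closed_act (W - {u}) E ?th' B}"
    then obtain B where "A = insert u B" "closed_act (W - {u}) E ?th' B"
      by blast
    moreover from this have "B \<subseteq> W - {u}"
      by (simp add: closed_act_def)
    ultimately show "A \<in> {A. closed_act W E th A}"
      using iff[of B] by simp
  qed
  moreover have "{B. closed_act (W - {u}) E ?th' B} \<noteq> {}"
    using closed_act_UNIV by blast
  ultimately show ?thesis
    unfolding act_hull_def by auto
qed

lemma act_hull_cong:
  assumes "\<And>x y. x \<in> W \<Longrightarrow> y \<in> W \<Longrightarrow> (x, y) \<in> E \<longleftrightarrow> (x, y) \<in> E'"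
    and "\<And>v. v \<in> W \<Longrightarrow> th v = th' v"
  shows "act_hull W E th = act_hull W E' th'"
proof -
  have "active_nbrs E A v = active_nbrs E' A v" if "A \<subseteq> W" "v \<in> W" for A v
    using that assms(1) by (auto simp: active_nbrs_def)
  then have "closed_act W E th A = closed_act W E' th' A" for A
    unfolding closed_act_def using assms(2) by auto
  then show ?thesis
    by (simp add: act_hull_def)
qed

lemma final_active_eq_act_hull:
  assumes S: "S \<subseteq> {..<n}"
  shows "final_active r n E S = act_hull {..<n} E (\<lambda>v. if v \<in> S then 0 else r)" (is "_ = ?H")
proof
  let ?th = "\<lambda>v. if v \<in> S then 0 else r"
  define X where "X t = (activate r n E ^^ t) S" for t
  have fin_eq: "final_active r n E S = (\<Union>t. X t)"
    by (simp add: final_active_def X_def)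
  have X_Suc: "X (Suc t) = activate r n E (X t)" for t
    by (simp add: X_def)
  have Xsub: "X t \<subseteq> {..<n}" for t
    by (induction t) (use S in \<open>auto simp: X_def activate_def\<close>)
  have "X t \<subseteq> A" if A: "closed_act {..<n} E ?th A" for t A
  proof (induction t)
    case 0
    then show ?case
      using A S by (auto simp: X_def closed_act_def)
  next
    case (Suc t)
    have "finite A"
      using A finite_subset[of A "{..<n}"] by (auto simp: closed_act_def)
    then have "card (active_nbrs E (X t) v) \<le> card (active_nbrs E A v)" for v
      using Suc by (intro card_active_nbrs_mono)
    then have "v \<in> A" if "v < n" "r \<le> card (active_nbrs E (X t) v)" for v
      using that A le_trans[OF that(2)] by (auto simp: closed_act_def)
    then show ?case
      using Suc by (auto simp: X_Suc activate_def)
  qed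
  then show "final_active r n E S \<subseteq> ?H"
    unfolding fin_eq act_hull_def by blast
  have mono: "X s \<subseteq> X t" if "s \<le> t" for s t
    by (rule lift_Suc_mono_le[OF _ that]) (auto simp: X_Suc activate_def)
  \<comment> \<open>An increasing union contained in \<open>{..<n}\<close> is finite, so one round
    already contains it; that round is closed, which gives the other inclusion.\<close>
  have "\<exists>t. final_active r n E S \<subseteq> X t"
  proof -
    have chain: "\<exists>t. F \<subseteq> X t" if "finite F" "F \<subseteq> (\<Union>t. X t)" for F
      using that
    proof (induction F rule: finite_induct)
      case (insert x F)
      then obtain s t where "F \<subseteq> X s" "x \<in> X t"
        by auto
      then have "insert x F \<subseteq> X (max s t)"
        using mono[of s "max s t"] mono[of t "max s t"] by auto
      then show ?case ..
    qed simp
    have "finite (\<Union>t. X t)"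
      using Xsub by (auto intro: finite_subset[of _ "{..<n}"])
    then show ?thesis
      unfolding fin_eq by (rule chain[OF _ order_refl])
  qed
  then obtain t where t: "final_active r n E S = X t"
    unfolding fin_eq by blast
  have "X (Suc t) \<subseteq> X t"
    using t unfolding fin_eq by blast
  then have "closed_act {..<n} E ?th (X t)"
    using Xsub[of t] mono[of 0 t] by (auto simp: closed_act_def X_Suc activate_def X_def)
  then show "?H \<subseteq> final_active r n E S"
    unfolding t act_hull_def by blast
qed


subsection \<open>Tails of sums of independent Bernoulli variables\<close>

definition bern_tail :: "('a \<Rightarrow> real) \<Rightarrow> 'a set \<Rightarrow> nat \<Rightarrow> real" where
  "bern_tail p A m =
     measure_pmf.prob (Pi_pmf A False (\<lambda>a. bernoulli_pmf (p a))) {f. m \<le> card {a \<in> A. f a}}"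

lemma measure_pair_pmf:
  "measure_pmf.prob (pair_pmf A B) X =
     measure_pmf.expectation A (\<lambda>a. measure_pmf.prob B {b. (a, b) \<in> X})"
proof -
  have "ennreal (measure_pmf.prob (pair_pmf A B) X) = (\<integral>\<^sup>+z. indicator X z \<partial>pair_pmf A B)"
    by (simp add: measure_pmf.emeasure_eq_measure)
  also have "\<dots> = (\<integral>\<^sup>+a. \<integral>\<^sup>+b. indicator X (a, b) \<partial>B \<partial>A)"
    by (rule nn_integral_pair_pmf')
  also have "\<dots> = (\<integral>\<^sup>+a. ennreal (measure_pmf.prob B {b. (a, b) \<in> X}) \<partial>A)"
  proof (intro nn_integral_cong)
    fix a
    have "(\<integral>\<^sup>+b. indicator X (a, b) \<partial>B) = (\<integral>\<^sup>+b. indicator {b. (a, b) \<in> X} b \<partial>B)"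
      by (intro nn_integral_cong) (simp add: indicator_def)
    then show "(\<integral>\<^sup>+b. indicator X (a, b) \<partial>B) = ennreal (measure_pmf.prob B {b. (a, b) \<in> X})"
      by (simp add: measure_pmf.emeasure_eq_measure)
  qed
  also have "\<dots> = ennreal (measure_pmf.expectation A (\<lambda>a. measure_pmf.prob B {b. (a, b) \<in> X}))"
    by (intro nn_integral_eq_integral measure_pmf.integrable_const_bound[where B = 1]) auto
  finally show ?thesis
    by (simp add: integral_nonneg_AE)
qed

lemma bern_tail_empty: "bern_tail p {} m = (if m = 0 then 1 else 0)"
  by (simp add: bern_tail_def measure_return_pmf indicator_def)

lemma bern_tail_0 [simp]: "bern_tail p A 0 = 1"
  by (simp add: bern_tail_def)

lemma bern_tail_nonneg: "0 \<le> bern_tail p A m"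
  by (simp add: bern_tail_def)

lemma bern_tail_le_1: "bern_tail p A m \<le> 1"
  by (simp add: bern_tail_def)

lemma bern_tail_antimono: "m \<le> m' \<Longrightarrow> bern_tail p A m' \<le> bern_tail p A m"
  unfolding bern_tail_def by (intro measure_pmf.finite_measure_mono) auto

lemma bern_tail_insert:
  assumes "finite A" "x \<notin> A" "0 \<le> p x" "p x \<le> 1"
  shows "bern_tail p (insert x A) m = p x * bern_tail p A (m - 1) + (1 - p x) * bern_tail p A m"
proof -
  have card: "card {a \<in> insert x A. (f(x := y)) a} = card {a \<in> A. f a} + (if y then 1 else 0)" for f y
  proof -
    have "{a \<in> insert x A. (f(x := y)) a} = (if y then insert x {a \<in> A. f a} else {a \<in> A. f a})"
      using assms(2) by auto
    then show ?thesis
      using assms(1,2) by simp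
  qed
  have "bern_tail p (insert x A) m = measure_pmf.prob (pair_pmf (bernoulli_pmf (p x))
      (Pi_pmf A False (\<lambda>a. bernoulli_pmf (p a))))
      {(y, f). m \<le> card {a \<in> A. f a} + (if y then 1 else 0)}"
    unfolding bern_tail_def
    by (subst Pi_pmf_insert[OF assms(1,2)])
      (simp add: measure_map_pmf vimage_def case_prod_unfold card del: fun_upd_apply insert_iff)
  also have "\<dots> = p x * bern_tail p A (m - 1) + (1 - p x) * bern_tail p A m"
    using assms(3,4) by (simp add: measure_pair_pmf bern_tail_def le_diff_conv)
  finally show ?thesis .
qed

text \<open>The expected number of \<open>m\<close>-sets of successes is an elementary symmetric
  polynomial, which this power dominates. The induction needs only the first two terms of the
  binomial expansion of \<open>(s + p x) ^ m\<close>.\<close>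

lemma bern_tail_le:
  assumes "finite A" "\<And>a. a \<in> A \<Longrightarrow> 0 \<le> p a \<and> p a \<le> 1"
  shows "bern_tail p A m \<le> (\<Sum>a\<in>A. p a) ^ m / fact m"
  using assms
proof (induction A arbitrary: m rule: finite_induct)
  case empty
  then show ?case
    by (simp add: bern_tail_empty)
next
  case (insert x A)
  define s where "s = sum p A"
  have s: "0 \<le> s" and px: "0 \<le> p x" "p x \<le> 1"
    using insert by (auto simp: s_def intro: sum_nonneg)
  have IH: "bern_tail p A m \<le> s ^ m / fact m" for m
    using insert by (simp add: s_def)
  show ?case
  proof (cases m)
    case 0
    then show ?thesis
      by simp
  next
    case (Suc k)
    have pow: "s ^ Suc k + real (Suc k) * p x * s ^ k \<le> (s + p x) ^ Suc k"
    proof (induction k)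
      case (Suc k)
      have "s ^ Suc (Suc k) + real (Suc (Suc k)) * p x * s ^ Suc k \<le>
          (s ^ Suc k + real (Suc k) * p x * s ^ k) * (s + p x)"
        using s px by (simp add: algebra_simps)
      also have "\<dots> \<le> (s + p x) ^ Suc k * (s + p x)"
        using Suc s px by (intro mult_right_mono) auto
      finally show ?case
        by (simp add: mult.commute)
    qed simp
    have "bern_tail p (insert x A) m \<le> p x * bern_tail p A k + bern_tail p A m"
      using insert px bern_tail_nonneg[of p A m] by (simp add: bern_tail_insert Suc mult_left_le_one_le)
    also have "\<dots> \<le> p x * (s ^ k / fact k) + s ^ m / fact m"
      using IH px by (intro add_mono mult_left_mono) auto
    also have "\<dots> = (s ^ Suc k + real (Suc k) * p x * s ^ k) / fact m"
      by (simp add: Suc field_simps del: of_nat_Suc)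
    also have "\<dots> \<le> (s + p x) ^ m / fact m"
      using pow by (intro divide_right_mono) (auto simp: Suc)
    finally show ?thesis
      using insert by (simp add: s_def add.commute)
  qed
qed

text \<open>The increment of a power is at most its length times the derivative at the right
  endpoint, the direction required by the induction for the lower tail.\<close>

lemma power_increment_le:
  fixes x p :: real
  assumes "0 \<le> p" "0 \<le> x"
  shows "(x + p) ^ Suc k \<le> x ^ Suc k + real (Suc k) * p * (x + p) ^ k"
proof (induction k)
  case (Suc k)
  have "(x + p) ^ Suc (Suc k) \<le> (x ^ Suc k + real (Suc k) * p * (x + p) ^ k) * (x + p)"
    using mult_right_mono[OF Suc, of "x + p"] assms by (simp add: mult.commute)
  also have "\<dots> = x ^ Suc (Suc k) + p * x ^ Suc k + real (Suc k) * p * (x + p) ^ Suc k"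
    by (simp add: algebra_simps)
  also have "\<dots> \<le> x ^ Suc (Suc k) + p * (x + p) ^ Suc k + real (Suc k) * p * (x + p) ^ Suc k"
    using assms by (intro add_mono mult_left_mono power_mono) auto
  finally show ?case
    by (simp add: algebra_simps)
qed simp

text \<open>Matches \<open>bern_tail_le\<close> asymptotically when the mean tends to
  \<open>0\<close> and \<open>\<delta>\<close> is small against it. One minus the mean pays for the
  failures of the other variables, and the shift by \<open>m * \<delta>\<close> for the repeated
  indices that a power counts but distinct successes exclude.\<close>

lemma bern_tail_ge:
  assumes "finite A" "\<And>a. a \<in> A \<Longrightarrow> 0 \<le> p a \<and> p a \<le> \<delta>" "0 \<le> \<delta>" "\<delta> \<le> 1" "(\<Sum>a\<in>A. p a) \<le> 1"
  shows "(1 - (\<Sum>a\<in>A. p a)) * max 0 ((\<Sum>a\<in>A. p a) - real m * \<delta>) ^ m / fact m \<le> bern_tail p A m"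
  using assms
proof (induction A arbitrary: m rule: finite_induct)
  case empty
  then show ?case
    by (cases "m = 0") (auto simp: bern_tail_empty power_0_left)
next
  case (insert x A)
  define s where "s = sum p A"
  have s: "0 \<le> s" and px: "0 \<le> p x" "p x \<le> \<delta>"
    using insert by (auto simp: s_def intro: sum_nonneg)
  have px1: "p x \<le> 1"
    using px insert.prems(3) by simp
  have s1: "s + p x \<le> 1"
    using insert by (simp add: s_def add.commute)
  have IH: "(1 - s) * max 0 (s - real m * \<delta>) ^ m / fact m \<le> bern_tail p A m" for m
    unfolding s_def
  proof (rule insert.IH)
    show "sum p A \<le> 1"
      using s1 px by (simp add: s_def)
  qed (use insert.prems in auto)
  show ?case
  proof (cases m)
    case 0
    have "0 \<le> sum p (insert x A)"
      using insert s px by (simp add: s_def)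
    then show ?thesis
      by (simp add: 0)
  next
    case (Suc k)
    let ?a = "max 0 (s - real m * \<delta>) ^ m / fact m"
    let ?b = "max 0 (s - real k * \<delta>) ^ k / fact k"
    have nn: "0 \<le> ?a" "0 \<le> ?b"
      by auto
    have pow: "max 0 (s + p x - real m * \<delta>) ^ Suc k \<le>
        max 0 (s - real m * \<delta>) ^ Suc k + real (Suc k) * p x * max 0 (s - real k * \<delta>) ^ k"
    proof (cases "s + p x - real m * \<delta> \<le> 0")
      case True
      then show ?thesis
        using px by (auto simp: max_def intro!: add_nonneg_nonneg mult_nonneg_nonneg zero_le_power)
    next
      case False
      have le: "s + p x - real m * \<delta> \<le> s - real k * \<delta>"
        using px by (simp add: Suc algebra_simps)
      \<comment> \<open>If the truncation at \<open>0\<close> is active in \<open>y\<close>, the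
        base grows by less than \<open>p x\<close>; \<open>p'\<close> is the actual growth.\<close>
      define y where "y = max 0 (s - real m * \<delta>)"
      define p' where "p' = (s + p x - real m * \<delta>) - y"
      have p': "0 \<le> p'" "p' \<le> p x" "0 \<le> y"
        using False px by (auto simp: p'_def y_def max_def)
      have "(y + p') ^ Suc k \<le> y ^ Suc k + real (Suc k) * p' * (y + p') ^ k"
        by (rule power_increment_le) (use p' in auto)
      also have "\<dots> \<le> y ^ Suc k + real (Suc k) * p x * max 0 (s - real k * \<delta>) ^ k"
        using False p' px le by (intro add_left_mono mult_mono power_mono) (auto simp: p'_def)
      moreover have "max 0 (s + p x - real m * \<delta>) = y + p'"
        using False by (simp add: p'_def)
      ultimately show ?thesis
        by (simp only: y_def)
    qed
    have "(1 - (s + p x)) * max 0 (s + p x - real m * \<delta>) ^ m / fact m \<le> (1 - (s + p x)) * (?a + p x * ?b)"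
    proof -
      have "max 0 (s + p x - real m * \<delta>) ^ m / fact m \<le>
          (max 0 (s - real m * \<delta>) ^ Suc k + real (Suc k) * p x * max 0 (s - real k * \<delta>) ^ k) / fact m"
        using pow by (intro divide_right_mono) (auto simp: Suc)
      also have "\<dots> = ?a + p x * ?b"
        by (simp add: Suc field_simps del: of_nat_Suc)
      finally show ?thesis
        using s1 mult_left_mono[of _ _ "1 - (s + p x)"] by fastforce
    qed
    also have "\<dots> = (1 - (s + p x)) * ?a + (1 - (s + p x)) * (p x * ?b)"
      by (simp add: algebra_simps)
    \<comment> \<open>The first factor satisfies
      \<open>1 - (s + p x) \<le> (1 - p x) * (1 - s)\<close> because \<open>s * p x \<ge> 0\<close>;
      in the second term \<open>p x\<close> is dropped.\<close>
    also have "\<dots> \<le> ((1 - p x) * (1 - s)) * ?a + (1 - s) * (p x * ?b)"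
      using nn px s by (intro add_mono mult_right_mono mult_nonneg_nonneg) (auto simp: algebra_simps)
    also have "\<dots> = (1 - p x) * ((1 - s) * ?a) + p x * ((1 - s) * ?b)"
      by (simp add: algebra_simps)
    also have "\<dots> \<le> (1 - p x) * bern_tail p A m + p x * bern_tail p A k"
      using IH[of m] IH[of k] px px1 by (intro add_mono mult_left_mono) auto
    also have "\<dots> = bern_tail p (insert x A) m"
      using insert.hyps px px1 by (simp add: bern_tail_insert Suc)
    finally show ?thesis
      using insert by (simp add: s_def add.commute)
  qed
qed


subsection \<open>Exposing the edges of a node\<close>

text \<open>
  The probability that a given node of community \<open>i\<close> has at least \<open>m\<close> neighbours in a fixed set
  containing \<open>t j\<close> nodes of each community \<open>j\<close>.
\<close>

definition hit_prob :: "('k::finite \<Rightarrow> 'k \<Rightarrow> real) \<Rightarrow> ('k \<Rightarrow> nat) \<Rightarrow> 'k \<Rightarrow> nat \<Rightarrow> real" where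
  "hit_prob q t i m = bern_tail (\<lambda>(j, l). q j i) (SIGMA j:UNIV. {..<t j}) m"

lemma hit_prob_0 [simp]: "hit_prob q t i 0 = 1"
  by (simp add: hit_prob_def)

lemma hit_prob_bounds: "0 \<le> hit_prob q t i m" "hit_prob q t i m \<le> 1"
  by (simp_all add: hit_prob_def bern_tail_nonneg bern_tail_le_1)

lemma hit_prob_none: "m > 0 \<Longrightarrow> hit_prob q (\<lambda>_. 0) i m = 0"
  by (simp add: hit_prob_def bern_tail_empty)

text \<open>Splits according to adjacency to one distinguished member of community \<open>j\<close>.
  Revealing the edge to an activated node makes the same case distinction, which is why the
  exponential functional is preserved.\<close>

lemma hit_prob_step:
  assumes "0 \<le> q j i" "q j i \<le> 1" "t j > 0"
  shows "hit_prob q t i m =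
    q j i * hit_prob q (t(j := t j - 1)) i (m - 1) + (1 - q j i) * hit_prob q (t(j := t j - 1)) i m"
proof -
  have eq: "(SIGMA j:UNIV. {..<t j}) = insert (j, t j - 1) (SIGMA k:UNIV. {..<(t(j := t j - 1)) k})"
    using assms(3) by (auto split: if_splits)
  show ?thesis
    unfolding hit_prob_def eq using assms by (subst bern_tail_insert) auto
qed

text \<open>For \<open>t j = 0\<close> truncated subtraction leaves \<open>t\<close> unchanged and
  only an inequality remains, since a lower threshold is easier to reach. The lower tail meets this
  case, as terms of the chain may be \<open>0\<close>.\<close>

lemma hit_prob_step_le:
  assumes "0 \<le> q j i" "q j i \<le> 1"
  shows "hit_prob q t i m \<le>
    q j i * hit_prob q (t(j := t j - 1)) i (m - 1) + (1 - q j i) * hit_prob q (t(j := t j - 1)) i m"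
proof (cases "t j = 0")
  case True
  then have "t(j := t j - 1) = t"
    by auto
  moreover have "hit_prob q t i m \<le> hit_prob q t i (m - 1)"
    unfolding hit_prob_def by (intro bern_tail_antimono) auto
  then have "q j i * hit_prob q t i m \<le> q j i * hit_prob q t i (m - 1)"
    using assms by (intro mult_left_mono)
  ultimately show ?thesis
    by (simp add: algebra_simps)
qed (use hit_prob_step[of q j i t m] assms in auto)

section \<open>Random edges on a node set and the removal of one node\<close>

definition inner_pairs :: "nat set \<Rightarrow> (nat \<times> nat) set" where
  "inner_pairs W = {(x, y). x \<in> W \<and> y \<in> W \<and> x < y}"

definition link :: "nat \<Rightarrow> nat \<Rightarrow> nat \<times> nat" where
  "link u v = (min u v, max u v)"

definition edges_pmf ::
    "('k \<Rightarrow> 'k \<Rightarrow> real) \<Rightarrow> (nat \<Rightarrow> 'k) \<Rightarrow> (nat \<times> nat) set \<Rightarrow> (nat \<times> nat \<Rightarrow> bool) pmf" where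
  "edges_pmf q c J = Pi_pmf J False (\<lambda>(x, y). bernoulli_pmf (q (c x) (c y)))"

lemma finite_set_edges_pmf: "finite J \<Longrightarrow> finite (set_pmf (edges_pmf q c J))"
  by (auto simp: edges_pmf_def set_Pi_pmf intro!: finite_PiE_dflt)

lemma finite_inner_pairs: "finite W \<Longrightarrow> finite (inner_pairs W)"
  by (rule finite_subset[of _ "W \<times> W"]) (auto simp: inner_pairs_def)

lemma inner_pairs_peel:
  assumes "u \<in> W"
  shows "inner_pairs W = link u ` (W - {u}) \<union> inner_pairs (W - {u})"
proof (intro set_eqI iffI)
  fix e assume "e \<in> inner_pairs W"
  then obtain x y where e: "e = (x, y)" "x \<in> W" "y \<in> W" "x < y"
    by (auto simp: inner_pairs_def)
  then have "e = link u y" if "x = u"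
    using that by (simp add: link_def)
  moreover have "e = link u x" if "y = u"
    using that e by (simp add: link_def)
  ultimately show "e \<in> link u ` (W - {u}) \<union> inner_pairs (W - {u})"
    using e by (auto simp: inner_pairs_def)
qed (use assms in \<open>auto simp: inner_pairs_def link_def min_def max_def\<close>)

lemma inj_link: "inj_on (link u) (W - {u})"
  by (auto simp: inj_on_def link_def min_def max_def split: if_splits)

text \<open>The edges at \<open>u\<close> are independent of the remaining ones and act on the rest
  only through the lowered thresholds. \<open>R\<close> is arbitrary so that both tails can use the
  lemma.\<close>

lemma prob_act_hull_peel:
  fixes q :: "'k \<Rightarrow> 'k \<Rightarrow> real"
  assumes "finite W" "u \<in> W" "th u = 0"
  shows "measure_pmf.prob (edges_pmf q c (inner_pairs W)) {f. R (act_hull W (Collect f) th)} =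
    measure_pmf.expectation (edges_pmf q c (link u ` (W - {u})))
      (\<lambda>b. measure_pmf.prob (edges_pmf q c (inner_pairs (W - {u})))
        {f. R (insert u (act_hull (W - {u}) (Collect f) (\<lambda>v. th v - of_bool (b (link u v)))))})"
proof -
  define J where "J = link u ` (W - {u})"
  define mix where "mix = (\<lambda>(b :: nat \<times> nat \<Rightarrow> bool, f) x. if x \<in> J then b x else f x)"
  have fin: "finite J" "finite (inner_pairs (W - {u}))"
    using assms(1) by (auto simp: J_def finite_inner_pairs)
  have disj: "J \<inter> inner_pairs (W - {u}) = {}"
    by (auto simp: J_def inner_pairs_def link_def min_def max_def split: if_splits)
  have Jlt: "x < y" if "(x, y) \<in> J" for x y
    using that by (auto simp: J_def link_def min_def max_def split: if_splits)
  have mixW: "edges_pmf q c (inner_pairs W) =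
      map_pmf mix (pair_pmf (edges_pmf q c J) (edges_pmf q c (inner_pairs (W - {u}))))"
    unfolding edges_pmf_def inner_pairs_peel[OF assms(2)] J_def[symmetric] mix_def
    by (rule Pi_pmf_union[OF fin disj])
  have hull: "act_hull W (Collect (mix (b, f))) th =
      insert u (act_hull (W - {u}) (Collect f) (\<lambda>v. th v - of_bool (b (link u v))))"
    if "f \<in> set_pmf (edges_pmf q c (inner_pairs (W - {u})))" for b f
  proof -
    \<comment> \<open>The default value \<open>False\<close> matters: outside the remaining pairs
      \<open>f\<close> contributes no edge, in particular none at \<open>u\<close>.\<close>
    have f0: "\<not> f x" if "x \<notin> inner_pairs (W - {u})" for x
      using set_Pi_pmf_subset[OF fin(2), of False "\<lambda>(x, y). bernoulli_pmf (q (c x) (c y))"]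
        that \<open>f \<in> _\<close> unfolding edges_pmf_def by blast
    have adj: "mix (b, f) (u, v) \<or> mix (b, f) (v, u) \<longleftrightarrow> b (link u v)" if "v \<in> W - {u}" for v
    proof -
      have "\<not> f (u, v)" "\<not> f (v, u)"
        by (auto intro!: f0 simp: inner_pairs_def)
      moreover have "link u v \<in> J"
        using that by (auto simp: J_def)
      moreover have "link u v = (u, v) \<and> (v, u) \<notin> J \<or> link u v = (v, u) \<and> (u, v) \<notin> J"
        using that Jlt[of u v] Jlt[of v u] by (cases "u < v") (auto simp: link_def)
      ultimately show ?thesis
        by (auto simp: mix_def)
    qed
    have eq: "(x, y) \<in> Collect (mix (b, f)) \<longleftrightarrow> (x, y) \<in> Collect f"
      if "x \<in> W - {u}" "y \<in> W - {u}" for x y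
    proof -
      have "(x, y) \<notin> J"
        using that by (auto simp: J_def link_def min_def max_def split: if_splits)
      then show ?thesis
        by (simp add: mix_def)
    qed
    show ?thesis
      by (subst act_hull_peel[of W u th, OF assms], rule arg_cong[of _ _ "insert u"], rule act_hull_cong)
        (use adj eq in auto)
  qed
  have "measure_pmf.prob (edges_pmf q c (inner_pairs W)) {f. R (act_hull W (Collect f) th)} =
      measure_pmf.expectation (edges_pmf q c J)
      (\<lambda>b. measure_pmf.prob (edges_pmf q c (inner_pairs (W - {u})))
        {f. R (act_hull W (Collect (mix (b, f))) th)})"
    by (simp add: mixW measure_map_pmf measure_pair_pmf vimage_def)
  also have "\<dots> = measure_pmf.expectation (edges_pmf q c J)
      (\<lambda>b. measure_pmf.prob (edges_pmf q c (inner_pairs (W - {u})))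
        {f. R (insert u (act_hull (W - {u}) (Collect f) (\<lambda>v. th v - of_bool (b (link u v)))))})"
    by (intro Bochner_Integration.integral_cong refl measure_pmf.finite_measure_eq_AE)
      (auto simp: AE_measure_pmf_iff hull)
  finally show ?thesis
    by (simp add: J_def)
qed

text \<open>Each remaining node shares exactly one pair with \<open>u\<close>, so the factors depend
  on distinct independent variables. Symmetry of \<open>q\<close> hides the orientation chosen by
  \<open>link\<close>.\<close>

lemma expectation_link_prod:
  fixes q :: "'k \<Rightarrow> 'k \<Rightarrow> real" and g :: "nat \<Rightarrow> bool \<Rightarrow> real"
  assumes "finite W" and q: "\<And>i j. 0 \<le> q i j \<and> q i j \<le> 1 \<and> q i j = q j i"
    and g: "\<And>v y. 0 \<le> g v y"
  shows "measure_pmf.expectation (edges_pmf q c (link u ` (W - {u})))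
      (\<lambda>b. \<Prod>v\<in>W - {u}. g v (b (link u v))) =
    (\<Prod>v\<in>W - {u}. q (c u) (c v) * g v True + (1 - q (c u) (c v)) * g v False)"
proof -
  let ?W = "W - {u}"
  \<comment> \<open>Recovers \<open>v\<close> from \<open>link u v\<close>, so that a product over
    nodes becomes one over pairs.\<close>
  define o' where "o' = inv_into ?W (link u)"
  have o': "o' (link u v) = v" if "v \<in> ?W" for v
    unfolding o'_def using that inj_link[of u W] by (rule inv_into_f_f[rotated])
  have "(\<Prod>v\<in>?W. g v (b (link u v))) = (\<Prod>x\<in>link u ` ?W. g (o' x) (b x))" for b
    by (subst prod.reindex[OF inj_link]) (auto intro!: prod.cong simp: o')
  moreover have "measure_pmf.expectation (edges_pmf q c (link u ` ?W))
        (\<lambda>b. \<Prod>x\<in>link u ` ?W. g (o' x) (b x)) =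
      (\<Prod>x\<in>link u ` ?W. measure_pmf.expectation ((\<lambda>(x, y). bernoulli_pmf (q (c x) (c y))) x) (g (o' x)))"
    unfolding edges_pmf_def
    by (rule expectation_prod_Pi_pmf)
      (use assms(1) g in \<open>auto intro!: integrable_measure_pmf_finite\<close>)
  moreover have "\<dots> = (\<Prod>v\<in>?W. q (c u) (c v) * g v True + (1 - q (c u) (c v)) * g v False)"
  proof -
    have "measure_pmf.expectation ((\<lambda>(x, y). bernoulli_pmf (q (c x) (c y))) (link u v)) (g v) =
        q (c u) (c v) * g v True + (1 - q (c u) (c v)) * g v False" for v
    proof -
      have "q (c v) (c u) = q (c u) (c v)" "0 \<le> q (c u) (c v)" "q (c u) (c v) \<le> 1"
        using q by blast+
      then show ?thesis
        by (simp add: link_def min_def max_def)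
    qed
    then show ?thesis
      by (subst prod.reindex[OF inj_link]) (auto intro!: prod.cong simp: o')
  qed
  ultimately show ?thesis
    by simp
qed


subsection \<open>Exponential bounds for the number of active nodes\<close>

lemma expectation_link_sum:
  fixes q :: "'k \<Rightarrow> 'k \<Rightarrow> real" and g :: "'i \<Rightarrow> nat \<Rightarrow> bool \<Rightarrow> real"
  assumes "finite W" and q: "\<And>i j. 0 \<le> q i j \<and> q i j \<le> 1 \<and> q i j = q j i"
    and g: "\<And>i v y. 0 \<le> g i v y"
  shows "measure_pmf.expectation (edges_pmf q c (link u ` (W - {u})))
      (\<lambda>b. \<Sum>i\<in>I. K i * (\<Prod>v\<in>W - {u}. g i v (b (link u v)))) =
    (\<Sum>i\<in>I. K i * (\<Prod>v\<in>W - {u}. q (c u) (c v) * g i v True + (1 - q (c u) (c v)) * g i v False))"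
proof -
  have int: "integrable (edges_pmf q c (link u ` (W - {u}))) f" for f :: "_ \<Rightarrow> real"
    using assms(1) by (intro integrable_measure_pmf_finite finite_set_edges_pmf) simp
  have "measure_pmf.expectation (edges_pmf q c (link u ` (W - {u})))
      (\<lambda>b. \<Prod>v\<in>W - {u}. g i v (b (link u v))) =
      (\<Prod>v\<in>W - {u}. q (c u) (c v) * g i v True + (1 - q (c u) (c v)) * g i v False)" for i
    by (rule expectation_link_prod[where g = "g i", OF assms(1) q g])
  then show ?thesis
    by (simp add: Bochner_Integration.integral_sum int)
qed

lemma card_class_insert:
  assumes "finite H" "u \<notin> H"
  shows "card {v \<in> insert u H. c v = i} = card {v \<in> H. c v = i} + (if c u = i then 1 else 0)"
proof -
  have "{v \<in> insert u H. c v = i} = (if c u = i then insert u {v \<in> H. c v = i} else {v \<in> H. c v = i})"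
    by auto
  then show ?thesis
    using assms by simp
qed

lemma finite_act_hull: "finite W \<Longrightarrow> finite (act_hull W E th)"
  using act_hull_subset by (rule finite_subset)

text \<open>Each summand is a Markov bound for reaching \<open>t i + 1\<close> nodes. When an active
  \<open>u\<close> of community \<open>j\<close> is removed and \<open>t j\<close> lowered by one,
  its own factor \<open>exp (\<beta> j)\<close> cancels against the prefactor, and by
  \<open>hit_prob_step\<close> the other factors keep their mean. Once no node is active, the event
  is impossible.\<close>

lemma act_hull_upper_tail:
  fixes q :: "'k::finite \<Rightarrow> 'k \<Rightarrow> real" and \<beta> :: "'k \<Rightarrow> real"
  assumes "finite W" and q: "\<And>i j. 0 \<le> q i j \<and> q i j \<le> 1 \<and> q i j = q j i"
    and \<beta>: "\<And>i. 0 \<le> \<beta> i"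
  shows "measure_pmf.prob (edges_pmf q c (inner_pairs W))
      {f. \<exists>i. t i < card {v \<in> act_hull W (Collect f) th. c v = i}} \<le>
    (\<Sum>i\<in>UNIV. exp (- \<beta> i * (real (t i) + 1)) *
      (\<Prod>v\<in>W. if c v = i then 1 + (exp (\<beta> i) - 1) * hit_prob q t i (th v) else 1))"
  using assms(1)
proof (induction W arbitrary: th t rule: finite_psubset_induct)
  case (psubset W)
  define G where "G t i v m = (if c v = i then 1 + (exp (\<beta> i) - 1) * hit_prob q t i m else 1)"
    for t i v m
  have G1: "1 \<le> G t i v m" for t i v m
    using \<beta>[of i] hit_prob_bounds[of q t i m] by (simp add: G_def)
  have G0: "0 \<le> G t i v m" for t i v m
    using G1[of t i v m] by linarith
  have prod1: "1 \<le> (\<Prod>v\<in>V. G t i v (th v))" for V t i th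
    using G1 by (intro prod_ge_1)
  let ?S = "\<Sum>i\<in>UNIV. exp (- \<beta> i * (real (t i) + 1)) * (\<Prod>v\<in>W. G t i v (th v))"
  have term0: "0 \<le> exp (- \<beta> i * (real (t i) + 1)) * (\<Prod>v\<in>W. G t i v (th v))" for i
    using prod1[of t i th W] by simp
  have "measure_pmf.prob (edges_pmf q c (inner_pairs W))
      {f. \<exists>i. t i < card {v \<in> act_hull W (Collect f) th. c v = i}} \<le> ?S"
  proof (cases "\<exists>u\<in>W. th u = 0")
    case False
    then have "act_hull W E th = {}" for E
      by (intro act_hull_eq_empty) auto
    then show ?thesis
      using term0 by (simp add: sum_nonneg)
  next
    case True
    then obtain u where u: "u \<in> W" "th u = 0"
      by blast
    define j where "j = c u"
    have remove: "(\<Prod>v\<in>W. G t i v (th v)) =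
        (if i = j then exp (\<beta> j) else 1) * (\<Prod>v\<in>W - {u}. G t i v (th v))" for i
      using u psubset.hyps by (subst prod.remove[of _ u]) (auto simp: G_def j_def)
    show ?thesis
    proof (cases "t j = 0")
      case True
      \<comment> \<open>\<open>u\<close> alone exceeds the level \<open>0\<close>, so the event is
        certain; the bound is trivial here because the factor of \<open>u\<close> cancels the
        prefactor \<open>exp (- \<beta> j)\<close>.\<close>
      have "1 \<le> exp (- \<beta> j * (real (t j) + 1)) * (\<Prod>v\<in>W. G t j v (th v))"
        using prod1[of t j th "W - {u}"] by (simp add: remove True exp_minus mult.assoc[symmetric])
      also have "\<dots> \<le> ?S"
        by (rule member_le_sum) (use term0 in auto)
      finally show ?thesis
        using measure_pmf.prob_le_1 order_trans by blast
    next
      case False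
      define t' where "t' = t(j := t j - 1)"
      have "card {v \<in> insert u (act_hull (W - {u}) E th'). c v = i} =
          card {v \<in> act_hull (W - {u}) E th'. c v = i} + (if j = i then 1 else 0)" for E th' i
        unfolding j_def using psubset.hyps act_hull_subset[of "W - {u}" E th']
        by (intro card_class_insert finite_act_hull) auto
      then have ev: "t i < card {v \<in> insert u (act_hull (W - {u}) E th'). c v = i} \<longleftrightarrow>
          t' i < card {v \<in> act_hull (W - {u}) E th'. c v = i}" for E th' i
        using False by (auto simp: t'_def)
      have fin: "finite (W - {u})"
        using psubset.hyps by simp
      define D where "D b = (\<lambda>v. th v - of_bool (b (link u v)))" for b
      have "measure_pmf.prob (edges_pmf q c (inner_pairs W))
          {f. \<exists>i. t i < card {v \<in> act_hull W (Collect f) th. c v = i}} =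
        measure_pmf.expectation (edges_pmf q c (link u ` (W - {u})))
          (\<lambda>b. measure_pmf.prob (edges_pmf q c (inner_pairs (W - {u})))
            {f. \<exists>i. t' i < card {v \<in> act_hull (W - {u}) (Collect f) (D b). c v = i}})"
        using prob_act_hull_peel[of W u th q c, where R = "\<lambda>H. \<exists>i. t i < card {v \<in> H. c v = i}",
            OF psubset.hyps(1) u]
        by (simp only: ev D_def)
      also have "\<dots> \<le> measure_pmf.expectation (edges_pmf q c (link u ` (W - {u})))
          (\<lambda>b. \<Sum>i\<in>UNIV. exp (- \<beta> i * (real (t' i) + 1)) *
            (\<Prod>v\<in>W - {u}. G t' i v (th v - of_bool (b (link u v)))))"
      proof (intro integral_mono)
        fix b
        show "measure_pmf.prob (edges_pmf q c (inner_pairs (W - {u})))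
            {f. \<exists>i. t' i < card {v \<in> act_hull (W - {u}) (Collect f) (D b). c v = i}} \<le>
          (\<Sum>i\<in>UNIV. exp (- \<beta> i * (real (t' i) + 1)) *
            (\<Prod>v\<in>W - {u}. G t' i v (th v - of_bool (b (link u v)))))"
          using psubset.IH[of "W - {u}" t' "D b"] u(1) unfolding G_def D_def by auto
      qed (auto intro!: integrable_measure_pmf_finite finite_set_edges_pmf simp: psubset.hyps)
      also have "\<dots> = (\<Sum>i\<in>UNIV. exp (- \<beta> i * (real (t' i) + 1)) *
          (\<Prod>v\<in>W - {u}. q j (c v) * G t' i v (th v - of_bool True) +
            (1 - q j (c v)) * G t' i v (th v - of_bool False)))"
        unfolding j_def
        by (rule expectation_link_sum[OF psubset.hyps(1) q,
              where g = "\<lambda>i v y. G t' i v (th v - of_bool y)"]) (rule G0)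
      also have "\<dots> = ?S"
      proof (intro sum.cong refl)
        fix i
        have "q j (c v) * G t' i v (th v - of_bool True) + (1 - q j (c v)) * G t' i v (th v - of_bool False) =
            G t i v (th v)" for v
        proof (cases "c v = i")
          case True
          have hit: "hit_prob q t i (th v) =
              q j i * hit_prob q t' i (th v - 1) + (1 - q j i) * hit_prob q t' i (th v)"
            unfolding t'_def by (rule hit_prob_step) (use q False in auto)
          show ?thesis
            using True by (simp add: G_def hit) (simp add: algebra_simps)
        qed (simp add: G_def)
        moreover have "exp (- \<beta> i * (real (t' i) + 1)) =
            exp (- \<beta> i * (real (t i) + 1)) * (if i = j then exp (\<beta> j) else 1)"
          using False by (auto simp: t'_def exp_add[symmetric] algebra_simps of_nat_diff)
        ultimately show "exp (- \<beta> i * (real (t' i) + 1)) *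
            (\<Prod>v\<in>W - {u}. q j (c v) * G t' i v (th v - of_bool True) +
              (1 - q j (c v)) * G t' i v (th v - of_bool False)) =
            exp (- \<beta> i * (real (t i) + 1)) * (\<Prod>v\<in>W. G t i v (th v))"
          by (simp add: remove)
      qed
      finally show ?thesis .
    qed
  qed
  then show ?case
    by (simp add: G_def)
qed

text \<open>
  If no node is active, the sum is dominated by the first step at which the chain \<open>T\<close> leaves \<open>0\<close>:
  no node can reach its threshold through \<open>T h = 0\<close> active nodes.
\<close>

lemma act_hull_lower_tail:
  fixes q :: "'k::finite \<Rightarrow> 'k \<Rightarrow> real" and \<beta> :: "'k \<Rightarrow> real" and T :: "nat \<Rightarrow> 'k \<Rightarrow> nat"
  assumes "finite W" and q: "\<And>i j. 0 \<le> q i j \<and> q i j \<le> 1 \<and> q i j = q j i"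
    and \<beta>: "\<And>i. 0 \<le> \<beta> i" and T: "T 0 = (\<lambda>_. 0)"
  shows "measure_pmf.prob (edges_pmf q c (inner_pairs W))
      {f. \<exists>i. card {v \<in> act_hull W (Collect f) th. c v = i} < T m i} \<le>
    (\<Sum>(h, i)\<in>{..<m} \<times> UNIV. (if T (Suc h) i = 0 then 0 else exp (\<beta> i * (real (T (Suc h) i) - 1))) *
      (\<Prod>v\<in>W. if c v = i then 1 - (1 - exp (- \<beta> i)) * hit_prob q (T h) i (th v) else 1))"
  using assms(1) T
proof (induction W arbitrary: th T rule: finite_psubset_induct)
  case (psubset W)
  define G where "G t i v m = (if c v = i then 1 - (1 - exp (- \<beta> i)) * hit_prob q t i m else 1)"
    for t i v m
  have G0: "0 \<le> G t i v m" for t i v m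
  proof -
    have "(1 - exp (- \<beta> i)) * hit_prob q t i m \<le> 1 * 1"
      using \<beta>[of i] hit_prob_bounds[of q t i m] by (intro mult_mono) auto
    then show ?thesis
      by (simp add: G_def)
  qed
  \<comment> \<open>A level \<open>0\<close> cannot be missed, hence the weight \<open>0\<close>.
    Missing a level \<open>T > 0\<close> means a count of at most \<open>T - 1\<close>, the origin
    of the \<open>- 1\<close> in the exponent.\<close>
  define K where "K T h i = (if T (Suc h) i = 0 then 0 else exp (\<beta> i * (real (T (Suc h) i) - 1)))"
    for T :: "nat \<Rightarrow> 'k \<Rightarrow> nat" and h i
  have K0: "0 \<le> K T h i" for T h i
    by (simp add: K_def)
  let ?S = "\<Sum>(h, i)\<in>{..<m} \<times> UNIV. K T h i * (\<Prod>v\<in>W. G (T h) i v (th v))"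
  have term0: "0 \<le> (case x of (h, i) \<Rightarrow> K T h i * (\<Prod>v\<in>W. G (T h) i v (th v)))" for x
    using K0 G0 by (auto intro!: mult_nonneg_nonneg prod_nonneg split: prod.split)
  have S0: "0 \<le> ?S"
    by (rule sum_nonneg) (rule term0)
  have "measure_pmf.prob (edges_pmf q c (inner_pairs W))
      {f. \<exists>i. card {v \<in> act_hull W (Collect f) th. c v = i} < T m i} \<le> ?S"
  proof (cases "\<exists>u\<in>W. th u = 0")
    case False
    then have empty: "act_hull W E th = {}" for E
      by (intro act_hull_eq_empty) auto
    show ?thesis
    proof (cases "T m = (\<lambda>_. 0)")
      case True
      then show ?thesis
        using S0 by (simp add: empty)
    next
      case ne: False
      define n where "n = (LEAST n. T n \<noteq> (\<lambda>_. 0))"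
      have n: "T n \<noteq> (\<lambda>_. 0)" "n \<le> m"
        unfolding n_def using LeastI[of "\<lambda>n. T n \<noteq> (\<lambda>_. 0)", OF ne] ne by (auto intro: Least_le)
      then obtain h where h: "n = Suc h"
        using psubset.prems by (cases n) auto
      have Th: "T h = (\<lambda>_. 0)"
        using not_less_Least[of h "\<lambda>n. T n \<noteq> (\<lambda>_. 0)"] h unfolding n_def by auto
      obtain i where i: "T (Suc h) i > 0"
        using n h by (metis ext gr0I)
      have "G (T h) i v (th v) = 1" if "v \<in> W" for v
        using False that by (simp add: G_def Th hit_prob_none)
      then have "1 \<le> (case (h, i) of (h, i) \<Rightarrow> K T h i * (\<Prod>v\<in>W. G (T h) i v (th v)))"
        using i \<beta>[of i] by (simp add: K_def)
      also have "\<dots> \<le> ?S"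
        by (rule member_le_sum) (use n h term0 in auto)
      finally show ?thesis
        using measure_pmf.prob_le_1 order_trans by blast
    qed
  next
    case True
    then obtain u where u: "u \<in> W" "th u = 0"
      by blast
    define j where "j = c u"
    have remove: "(\<Prod>v\<in>W. G t i v (th v)) =
        (if i = j then exp (- \<beta> j) else 1) * (\<Prod>v\<in>W - {u}. G t i v (th v))" for t i
      using u psubset.hyps by (subst prod.remove[of _ u]) (auto simp: G_def j_def)
    \<comment> \<open>\<open>u\<close> counts towards every term of the chain, so all of them are
      lowered together.\<close>
    define T' where "T' h = (T h)(j := T h j - 1)" for h
    have T'0: "T' 0 = (\<lambda>_. 0)"
      using psubset.prems by (auto simp: T'_def)
    have "card {v \<in> insert u (act_hull (W - {u}) E th'). c v = i} =
        card {v \<in> act_hull (W - {u}) E th'. c v = i} + (if j = i then 1 else 0)" for E th' i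
      unfolding j_def using psubset.hyps act_hull_subset[of "W - {u}" E th']
      by (intro card_class_insert finite_act_hull) auto
    then have ev: "card {v \<in> insert u (act_hull (W - {u}) E th'). c v = i} < T m i \<longleftrightarrow>
        card {v \<in> act_hull (W - {u}) E th'. c v = i} < T' m i" for E th' i
      by (auto simp: T'_def)
    define D where "D b = (\<lambda>v. th v - of_bool (b (link u v)))" for b
    have "measure_pmf.prob (edges_pmf q c (inner_pairs W))
        {f. \<exists>i. card {v \<in> act_hull W (Collect f) th. c v = i} < T m i} =
      measure_pmf.expectation (edges_pmf q c (link u ` (W - {u})))
        (\<lambda>b. measure_pmf.prob (edges_pmf q c (inner_pairs (W - {u})))
          {f. \<exists>i. card {v \<in> act_hull (W - {u}) (Collect f) (D b). c v = i} < T' m i})"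
      using prob_act_hull_peel[of W u th q c, where R = "\<lambda>H. \<exists>i. card {v \<in> H. c v = i} < T m i",
            OF psubset.hyps(1) u]
      by (simp only: ev D_def)
    also have "\<dots> \<le> measure_pmf.expectation (edges_pmf q c (link u ` (W - {u})))
        (\<lambda>b. \<Sum>x\<in>{..<m} \<times> UNIV. K T' (fst x) (snd x) *
          (\<Prod>v\<in>W - {u}. G (T' (fst x)) (snd x) v (th v - of_bool (b (link u v)))))"
    proof (intro integral_mono)
      fix b
      show "measure_pmf.prob (edges_pmf q c (inner_pairs (W - {u})))
          {f. \<exists>i. card {v \<in> act_hull (W - {u}) (Collect f) (D b). c v = i} < T' m i} \<le>
        (\<Sum>x\<in>{..<m} \<times> UNIV. K T' (fst x) (snd x) *
          (\<Prod>v\<in>W - {u}. G (T' (fst x)) (snd x) v (th v - of_bool (b (link u v)))))"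
        using psubset.IH[of "W - {u}" T' "D b"] u(1) T'0
        unfolding G_def K_def D_def by (auto simp: case_prod_unfold)
    qed (auto intro!: integrable_measure_pmf_finite finite_set_edges_pmf simp: psubset.hyps)
    also have "\<dots> = (\<Sum>x\<in>{..<m} \<times> UNIV. K T' (fst x) (snd x) *
        (\<Prod>v\<in>W - {u}. q j (c v) * G (T' (fst x)) (snd x) v (th v - of_bool True) +
          (1 - q j (c v)) * G (T' (fst x)) (snd x) v (th v - of_bool False)))"
      unfolding j_def
      by (rule expectation_link_sum[OF psubset.hyps(1) q,
            where g = "\<lambda>x v y. G (T' (fst x)) (snd x) v (th v - of_bool y)"]) (rule G0)
    also have "\<dots> \<le> (\<Sum>x\<in>{..<m} \<times> UNIV. K T (fst x) (snd x) * (\<Prod>v\<in>W. G (T (fst x)) (snd x) v (th v)))"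
    proof (intro sum_mono)
      fix x :: "nat \<times> 'k"
      obtain h i where x: "x = (h, i)"
        by (cases x)
      let ?G' = "\<lambda>v. q j (c v) * G (T' h) i v (th v - of_bool True) +
          (1 - q j (c v)) * G (T' h) i v (th v - of_bool False)"
      have "?G' v \<le> G (T h) i v (th v)" for v
      proof (cases "c v = i")
        case True
        have "(1 - exp (- \<beta> i)) * hit_prob q (T h) i (th v) \<le> (1 - exp (- \<beta> i)) *
            (q j i * hit_prob q (T' h) i (th v - 1) + (1 - q j i) * hit_prob q (T' h) i (th v))"
          using q[of j i] \<beta>[of i] hit_prob_step_le[of q j i "T h" "th v"]
          by (intro mult_left_mono) (auto simp: T'_def)
        then show ?thesis
          using True by (simp add: G_def algebra_simps)
      qed (simp add: G_def)
      moreover have "0 \<le> ?G' v" for v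
        using q[of j "c v"] G0 by (intro add_nonneg_nonneg mult_nonneg_nonneg) auto
      ultimately have prod_le: "(\<Prod>v\<in>W - {u}. ?G' v) \<le> (\<Prod>v\<in>W - {u}. G (T h) i v (th v))"
        by (intro prod_mono) auto
      \<comment> \<open>Equality unless \<open>i = j\<close> and \<open>T (Suc h) j = 1\<close>:
        then the lowered level is \<open>0\<close> and the left-hand side vanishes.\<close>
      have K_le: "K T' h i \<le> K T h i * (if i = j then exp (- \<beta> j) else 1)"
        by (auto simp: K_def T'_def exp_add[symmetric] algebra_simps of_nat_diff)
      have "K T' h i * (\<Prod>v\<in>W - {u}. ?G' v) \<le>
          (K T h i * (if i = j then exp (- \<beta> j) else 1)) * (\<Prod>v\<in>W - {u}. G (T h) i v (th v))"
        using K_le prod_le by (rule mult_mono) (use K0 G0 q in \<open>auto intro!: prod_nonneg mult_nonneg_nonneg add_nonneg_nonneg\<close>)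
      also have "\<dots> = K T h i * (\<Prod>v\<in>W. G (T h) i v (th v))"
        by (simp add: remove)
      finally show "K T' (fst x) (snd x) *
          (\<Prod>v\<in>W - {u}. q j (c v) * G (T' (fst x)) (snd x) v (th v - of_bool True) +
            (1 - q j (c v)) * G (T' (fst x)) (snd x) v (th v - of_bool False)) \<le>
          K T (fst x) (snd x) * (\<Prod>v\<in>W. G (T (fst x)) (snd x) v (th v))"
        by (simp add: x)
    qed
    also have "\<dots> = ?S"
      by (simp add: case_prod_unfold)
    finally show ?thesis .
  qed
  then show ?case
    by (simp add: G_def K_def)
qed

section \<open>From fixed seeds to the random model\<close>

lemma prob_pair_pmf_le:
  assumes "\<And>b. b \<in> set_pmf B \<Longrightarrow> measure_pmf.prob A {a. (a, b) \<in> X} \<le> K"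
  shows "measure_pmf.prob (pair_pmf A B) X \<le> K"
proof -
  have "measure_pmf.prob (pair_pmf A B) X =
      measure_pmf.expectation B (\<lambda>b. measure_pmf.prob A {a. (a, b) \<in> X})"
    by (subst pair_commute_pmf) (simp add: measure_map_pmf measure_pair_pmf vimage_def case_prod_unfold)
  also have "\<dots> \<le> measure_pmf.expectation B (\<lambda>_. K)"
  proof (rule integral_mono_AE)
    show "integrable B (\<lambda>b. measure_pmf.prob A {a. (a, b) \<in> X})"
      by (rule measure_pmf.integrable_const_bound[where B = 1]) auto
  qed (use assms in \<open>auto simp: AE_measure_pmf_iff\<close>)
  finally show ?thesis
    by simp
qed

lemma inner_pairs_lessThan: "inner_pairs {..<n} = node_pairs n"
  by (auto simp: inner_pairs_def node_pairs_def)

lemma seeds_pmf_class_card: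
  fixes c :: "nat \<Rightarrow> 'k::finite"
  assumes "\<And>i. a i \<le> card (community n c i)" "s \<in> set_pmf (seeds_pmf n c a)"
  shows "s \<subseteq> {..<n}" "card {v \<in> s. c v = i} = a i"
proof -
  define F where "F i = {T. T \<subseteq> community n c i \<and> card T = a i}" for i
  have fin: "finite (community n c i)" for i
    by (simp add: community_def)
  have F: "finite (F i)" "F i \<noteq> {}" for i
    using fin[of i] assms(1)[of i] obtain_subset_with_card_n[of "a i" "community n c i"]
    by (auto simp: F_def)
  obtain T where T: "T \<in> set_pmf (Pi_pmf UNIV {} (\<lambda>i. pmf_of_set (F i)))" "s = (\<Union>i. T i)"
    using assms(2) by (auto simp: seeds_pmf_def F_def)
  have "T i \<in> F i" for i
    using T(1) F by (auto simp: set_Pi_pmf PiE_dflt_def set_pmf_of_set)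
  then have T': "T i \<subseteq> community n c i" "card (T i) = a i" for i
    by (auto simp: F_def)
  show "s \<subseteq> {..<n}"
    using T' by (auto simp: T(2) community_def)
  have "{v \<in> s. c v = i} = T i"
    using T' by (auto simp: T(2) community_def)
  then show "card {v \<in> s. c v = i} = a i"
    using T' by simp
qed

text \<open>Given the seed set, the process has deterministic thresholds. Only the numbers of seeds
  per community, which the law fixes, are available in \<open>bound\<close>, so an estimate uniform
  over such seed sets suffices.\<close>

lemma sbm_event_le:
  fixes c :: "nat \<Rightarrow> 'k::finite"
  assumes model: "sbm_with_seeds M n c q a E S"
    and a: "\<And>i. a i \<le> card (community n c i)"
    and bound: "\<And>s. s \<subseteq> {..<n} \<Longrightarrow> (\<And>i. card {v \<in> s. c v = i} = a i) \<Longrightarrow>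
      measure_pmf.prob (edges_pmf q c (inner_pairs {..<n}))
        {f. R (act_hull {..<n} (Collect f) (\<lambda>v. if v \<in> s then 0 else r))} \<le> K"
  shows "{\<omega> \<in> space M. R (final_active r n (E \<omega>) (S \<omega>))} \<in> sets M"
    and "measure M {\<omega> \<in> space M. R (final_active r n (E \<omega>) (S \<omega>))} \<le> K"
proof -
  let ?X = "{z. R (final_active r n (fst z) (snd z))}"
  have meas: "(\<lambda>\<omega>. (E \<omega>, S \<omega>)) \<in> M \<rightarrow>\<^sub>M count_space UNIV"
    and distr: "distr M (count_space UNIV) (\<lambda>\<omega>. (E \<omega>, S \<omega>)) =
      measure_pmf (pair_pmf (sbm_pmf n c q) (seeds_pmf n c a))"
    using model by (auto simp: sbm_with_seeds_def)
  have eq: "{\<omega> \<in> space M. R (final_active r n (E \<omega>) (S \<omega>))} = (\<lambda>\<omega>. (E \<omega>, S \<omega>)) -` ?X \<inter> space M"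
    by auto
  show "{\<omega> \<in> space M. R (final_active r n (E \<omega>) (S \<omega>))} \<in> sets M"
    unfolding eq using meas by (rule measurable_sets) simp
  have "measure M {\<omega> \<in> space M. R (final_active r n (E \<omega>) (S \<omega>))} =
      measure_pmf.prob (pair_pmf (sbm_pmf n c q) (seeds_pmf n c a)) ?X"
    unfolding eq distr[symmetric] by (rule measure_distr[symmetric]) (use meas in auto)
  also have "\<dots> \<le> K"
  proof (rule prob_pair_pmf_le)
    fix s assume s: "s \<in> set_pmf (seeds_pmf n c a)"
    have s': "s \<subseteq> {..<n}" "card {v \<in> s. c v = i} = a i" for i
      using seeds_pmf_class_card[OF a s] by auto
    have "measure_pmf.prob (sbm_pmf n c q) {e. (e, s) \<in> ?X} =
        measure_pmf.prob (edges_pmf q c (inner_pairs {..<n}))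
          {f. R (act_hull {..<n} (Collect f) (\<lambda>v. if v \<in> s then 0 else r))}"
      by (simp add: sbm_pmf_def edges_pmf_def inner_pairs_lessThan measure_map_pmf vimage_def
          final_active_eq_act_hull[OF s'(1)])
    also have "\<dots> \<le> K"
      using s' by (rule bound)
    finally show "measure_pmf.prob (sbm_pmf n c q) {e. (e, s) \<in> ?X} \<le> K" .
  qed
  finally show "measure M {\<omega> \<in> space M. R (final_active r n (E \<omega>) (S \<omega>))} \<le> K" .
qed

lemma prod_class:
  fixes x y :: real and c :: "nat \<Rightarrow> 'k"
  assumes "s \<subseteq> {..<n}"
  shows "(\<Prod>v<n. if c v = i then if v \<in> s then x else y else 1) =
    x ^ card {v \<in> s. c v = i} * y ^ (card (community n c i) - card {v \<in> s. c v = i})"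
proof -
  let ?C = "community n c i" and ?D = "{v \<in> s. c v = i}"
  have D: "?D \<subseteq> ?C" "finite ?C"
    using assms by (auto simp: community_def)
  have "(\<Prod>v<n. if c v = i then if v \<in> s then x else y else 1) = (\<Prod>v\<in>?C. if v \<in> s then x else y)"
    by (rule prod.mono_neutral_cong_right) (auto simp: community_def)
  also have "\<dots> = (\<Prod>v\<in>?C - ?D. if v \<in> s then x else y) * (\<Prod>v\<in>?D. if v \<in> s then x else y)"
    by (rule prod.subset_diff) (use D in auto)
  also have "\<dots> = (\<Prod>v\<in>?C - ?D. y) * (\<Prod>v\<in>?D. x)"
    by (intro arg_cong2[of _ _ _ _ "(*)"] prod.cong) (auto simp: community_def)
  also have "\<dots> = x ^ card ?D * y ^ (card ?C - card ?D)"
    using D by (simp add: card_Diff_subset finite_subset)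
  finally show ?thesis .
qed

lemma one_plus_power_le_exp:
  fixes x :: real
  assumes "-1 \<le> x"
  shows "(1 + x) ^ k \<le> exp (real k * x)"
proof -
  have "(1 + x) ^ k \<le> exp x ^ k"
    using assms exp_ge_add_one_self[of x] by (intro power_mono) auto
  then show ?thesis
    by (simp add: exp_of_nat_mult)
qed

text \<open>The exponent is the Chernoff exponent of \<open>a i\<close> plus a Poisson variable with
  mean \<open>N i * hit_prob q t i r\<close>: a seed contributes \<open>exp (\<beta> i)\<close>
  exactly, and \<open>1 + x \<le> exp x\<close> handles the other nodes.\<close>

lemma sbm_upper_tail:
  fixes q :: "'k::finite \<Rightarrow> 'k \<Rightarrow> real" and c :: "nat \<Rightarrow> 'k" and \<beta> :: "'k \<Rightarrow> real"
  assumes model: "sbm_with_seeds M n c q a E S"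
    and N: "\<And>i. card (community n c i) = N i" and a: "\<And>i. a i \<le> N i"
    and q: "\<And>i j. 0 \<le> q i j \<and> q i j \<le> 1 \<and> q i j = q j i"
    and \<beta>: "\<And>i. 0 \<le> \<beta> i"
  shows "measure M {\<omega> \<in> space M. \<exists>i. t i < card {v \<in> final_active r n (E \<omega>) (S \<omega>). c v = i}} \<le>
    (\<Sum>i\<in>UNIV. exp (- \<beta> i * (real (t i) + 1 - real (a i)) +
      (exp (\<beta> i) - 1) * (real (N i) * hit_prob q t i r)))"
    and "{\<omega> \<in> space M. \<exists>i. t i < card {v \<in> final_active r n (E \<omega>) (S \<omega>). c v = i}} \<in> sets M"
proof -
  let ?K = "\<Sum>i\<in>UNIV. exp (- \<beta> i * (real (t i) + 1 - real (a i)) +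
      (exp (\<beta> i) - 1) * (real (N i) * hit_prob q t i r))"
  have bound: "measure_pmf.prob (edges_pmf q c (inner_pairs {..<n}))
        {f. \<exists>i. t i < card {v \<in> act_hull {..<n} (Collect f) (\<lambda>v. if v \<in> s then 0 else r). c v = i}} \<le> ?K"
    if s: "s \<subseteq> {..<n}" "\<And>i. card {v \<in> s. c v = i} = a i" for s
  proof (rule order_trans[OF act_hull_upper_tail[OF _ q \<beta>] sum_mono])
    fix i
    let ?h = "hit_prob q t i r"
    let ?x = "(exp (\<beta> i) - 1) * ?h"
    have x0: "0 \<le> ?x"
      using \<beta>[of i] hit_prob_bounds[of q t i r] by auto
    have "(\<Prod>v<n. if c v = i then 1 + (exp (\<beta> i) - 1) * hit_prob q t i (if v \<in> s then 0 else r) else 1) =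
        (\<Prod>v<n. if c v = i then if v \<in> s then exp (\<beta> i) else 1 + ?x else 1)"
      by (intro prod.cong) auto
    also have "\<dots> = exp (\<beta> i) ^ a i * (1 + ?x) ^ (N i - a i)"
      unfolding prod_class[OF s(1)] s(2) N ..
    also have "\<dots> \<le> exp (real (a i) * \<beta> i) * exp (real (N i) * ?x)"
    proof (intro mult_mono)
      have "(1 + ?x) ^ (N i - a i) \<le> exp (real (N i - a i) * ?x)"
        using x0 by (intro one_plus_power_le_exp) linarith
      also have "\<dots> \<le> exp (real (N i) * ?x)"
        using x0 by (auto intro!: mult_right_mono)
      finally show "(1 + ?x) ^ (N i - a i) \<le> exp (real (N i) * ?x)" .
    qed (use x0 in \<open>auto simp: exp_of_nat_mult\<close>)
    finally have "exp (- \<beta> i * (real (t i) + 1)) *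
        (\<Prod>v<n. if c v = i then 1 + (exp (\<beta> i) - 1) * hit_prob q t i (if v \<in> s then 0 else r) else 1) \<le>
      exp (- \<beta> i * (real (t i) + 1)) * (exp (real (a i) * \<beta> i) * exp (real (N i) * ?x))"
      by (rule mult_left_mono) simp
    also have "\<dots> = exp (- \<beta> i * (real (t i) + 1 - real (a i)) + (exp (\<beta> i) - 1) * (real (N i) * ?h))"
      by (simp add: exp_add[symmetric] algebra_simps)
    finally show "exp (- \<beta> i * (real (t i) + 1)) *
        (\<Prod>v<n. if c v = i then 1 + (exp (\<beta> i) - 1) * hit_prob q t i (if v \<in> s then 0 else r) else 1) \<le>
      exp (- \<beta> i * (real (t i) + 1 - real (a i)) + (exp (\<beta> i) - 1) * (real (N i) * ?h))" .
  qed simp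
  have a': "a i \<le> card (community n c i)" for i
    by (simp add: N a)
  show "measure M {\<omega> \<in> space M. \<exists>i. t i < card {v \<in> final_active r n (E \<omega>) (S \<omega>). c v = i}} \<le> ?K"
    and "{\<omega> \<in> space M. \<exists>i. t i < card {v \<in> final_active r n (E \<omega>) (S \<omega>). c v = i}} \<in> sets M"
    using sbm_event_le[where R = "\<lambda>H. \<exists>i. t i < card {v \<in> H. c v = i}", OF model a' bound]
    by simp_all
qed

lemma sbm_lower_tail:
  fixes q :: "'k::finite \<Rightarrow> 'k \<Rightarrow> real" and c :: "nat \<Rightarrow> 'k" and \<beta> :: "'k \<Rightarrow> real"
    and T :: "nat \<Rightarrow> 'k \<Rightarrow> nat"
  assumes model: "sbm_with_seeds M n c q a E S"
    and N: "\<And>i. card (community n c i) = N i" and a: "\<And>i. a i \<le> N i"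
    and q: "\<And>i j. 0 \<le> q i j \<and> q i j \<le> 1 \<and> q i j = q j i"
    and \<beta>: "\<And>i. 0 \<le> \<beta> i" and T: "T 0 = (\<lambda>_. 0)"
  shows "measure M {\<omega> \<in> space M. \<exists>i. card {v \<in> final_active r n (E \<omega>) (S \<omega>). c v = i} < T m i} \<le>
    (\<Sum>(h, i)\<in>{..<m} \<times> UNIV. if T (Suc h) i = 0 then 0
      else exp (\<beta> i * (real (T (Suc h) i) - 1) -
        (1 - exp (- \<beta> i)) * (real (a i) + (real (N i) - real (a i)) * hit_prob q (T h) i r)))"
    and "{\<omega> \<in> space M. \<exists>i. card {v \<in> final_active r n (E \<omega>) (S \<omega>). c v = i} < T m i} \<in> sets M"
proof -
  let ?K = "\<Sum>(h, i)\<in>{..<m} \<times> UNIV. if T (Suc h) i = 0 then 0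
      else exp (\<beta> i * (real (T (Suc h) i) - 1) -
        (1 - exp (- \<beta> i)) * (real (a i) + (real (N i) - real (a i)) * hit_prob q (T h) i r))"
  have bound: "measure_pmf.prob (edges_pmf q c (inner_pairs {..<n}))
        {f. \<exists>i. card {v \<in> act_hull {..<n} (Collect f) (\<lambda>v. if v \<in> s then 0 else r). c v = i} < T m i} \<le> ?K"
    if s: "s \<subseteq> {..<n}" "\<And>i. card {v \<in> s. c v = i} = a i" for s
  proof (rule order_trans[OF act_hull_lower_tail[where T = T, OF _ q \<beta> T] sum_mono])
    fix z :: "nat \<times> 'k"
    obtain h i where z: "z = (h, i)"
      by (cases z)
    let ?h = "hit_prob q (T h) i r"
    define y where "y = 1 - exp (- \<beta> i)"
    have y: "0 \<le> y" "y \<le> 1"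
      using \<beta>[of i] by (auto simp: y_def)
    have yh: "y * ?h \<le> 1 * 1"
      using y hit_prob_bounds[of q "T h" i r] by (intro mult_mono) auto
    let ?P = "\<Prod>v<n. if c v = i then 1 - (1 - exp (- \<beta> i)) *
        hit_prob q (T h) i (if v \<in> s then 0 else r) else 1"
    have "?P = (\<Prod>v<n. if c v = i then if v \<in> s then 1 + - y else 1 + - (y * ?h) else 1)"
      by (intro prod.cong) (auto simp: y_def)
    also have "\<dots> = (1 + - y) ^ a i * (1 + - (y * ?h)) ^ (N i - a i)"
      unfolding prod_class[OF s(1)] s(2) N ..
    \<comment> \<open>The exact factor \<open>1 - y = exp (- \<beta> i)\<close> of a seed is
      weakened too, so that seeds and activated nodes enter a single mean. \<open>N i - a i\<close>
      has to stay: replacing it by \<open>N i\<close> would decrease the right-hand side.\<close>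
    also have "\<dots> \<le> exp (real (a i) * - y) * exp (real (N i - a i) * - (y * ?h))"
      using y yh by (intro mult_mono one_plus_power_le_exp) auto
    finally have P: "?P \<le> exp (real (a i) * - y) * exp (real (N i - a i) * - (y * ?h))" .
    show "(case z of (h, i) \<Rightarrow>
        (if T (Suc h) i = 0 then 0 else exp (\<beta> i * (real (T (Suc h) i) - 1))) *
        (\<Prod>v<n. if c v = i then 1 - (1 - exp (- \<beta> i)) *
          hit_prob q (T h) i (if v \<in> s then 0 else r) else 1)) \<le>
      (case z of (h, i) \<Rightarrow> if T (Suc h) i = 0 then 0
        else exp (\<beta> i * (real (T (Suc h) i) - 1) -
          (1 - exp (- \<beta> i)) * (real (a i) + (real (N i) - real (a i)) * hit_prob q (T h) i r)))"
    proof (cases "T (Suc h) i = 0")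
      case False
      have "exp (\<beta> i * (real (T (Suc h) i) - 1)) * ?P \<le>
          exp (\<beta> i * (real (T (Suc h) i) - 1)) *
            (exp (real (a i) * - y) * exp (real (N i - a i) * - (y * ?h)))"
        using P by (rule mult_left_mono) simp
      also have "\<dots> = exp (\<beta> i * (real (T (Suc h) i) - 1) -
          y * (real (a i) + (real (N i) - real (a i)) * ?h))"
        using a[of i] by (simp add: exp_add[symmetric] of_nat_diff algebra_simps)
      finally show ?thesis
        using False by (simp add: z y_def)
    qed (simp add: z)
  qed simp
  have a': "a i \<le> card (community n c i)" for i
    by (simp add: N a)
  show "measure M {\<omega> \<in> space M. \<exists>i. card {v \<in> final_active r n (E \<omega>) (S \<omega>). c v = i} < T m i} \<le> ?K"
    and "{\<omega> \<in> space M. \<exists>i. card {v \<in> final_active r n (E \<omega>) (S \<omega>). c v = i} < T m i} \<in> sets M"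
    using sbm_event_le[where R = "\<lambda>H. \<exists>i. card {v \<in> H. c v = i} < T m i", OF model a' bound]
    by simp_all
qed


subsection \<open>The fixed-point map\<close>

definition coef :: "nat \<Rightarrow> real" where
  "coef r = (1 / real r) * (1 - 1 / real r) ^ (r - 1)"

definition fp_map :: "nat \<Rightarrow> ('k \<Rightarrow> real) \<Rightarrow> 'k::finite rmat \<Rightarrow> 'k rvec \<Rightarrow> 'k rvec" where
  "fp_map r \<alpha> C x = (\<chi> i. \<alpha> i + coef r * (\<Sum>j\<in>UNIV. C $ i $ j * x $ j) ^ r)"

lemma coef_pos: "r \<ge> 2 \<Longrightarrow> 0 < coef r"
  by (simp add: coef_def)

lemma rho_eq: "rho r \<alpha> C x $ i = fp_map r \<alpha> C x $ i - x $ i"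
  by (simp add: rho_def fp_map_def coef_def)

lemma mat_power_Suc': "mat_power C (Suc h) = mat_power C h ** C"
  by (induction h) (simp_all add: matrix_mul_assoc)

lemma mat_power_nonneg:
  assumes "\<And>i j. 0 \<le> C $ i $ j"
  shows "0 \<le> mat_power C h $ i $ j"
  using assms by (induction h arbitrary: i j)
    (auto simp: mat_def matrix_matrix_mult_def intro!: sum_nonneg mult_nonneg_nonneg)

text \<open>\<open>C_sym\<close> connects two directions: the layers follow the row
  \<open>fst_idx\<close> of the powers of \<open>C\<close>, whereas component \<open>i\<close> of
  the fixed-point map is fed through the entries \<open>C $ i $ j\<close>.\<close>

locale subcrit_system =
  fixes r :: nat and \<alpha> :: "'k::{finite,linorder} \<Rightarrow> real" and C :: "'k rmat"
  assumes r2: "r \<ge> 2"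
    and C_nonneg: "\<And>i j. 0 \<le> C $ i $ j"
    and C_sym: "\<And>i j. 0 < C $ i $ j \<Longrightarrow> 0 < C $ j $ i"
    and irred: "irreducible_mat C"
    and \<alpha>_nonneg: "\<And>i. 0 \<le> \<alpha> i"
    and \<alpha>_fst: "0 < \<alpha> fst_idx"
    and subcrit: "subcritical r \<alpha> C"
begin

abbreviation "F \<equiv> fp_map r \<alpha> C"
abbreviation "x0 \<equiv> init_point r \<alpha> C"

lemma F_nth: "F x $ i = \<alpha> i + coef r * (\<Sum>j\<in>UNIV. C $ i $ j * x $ j) ^ r"
  by (simp add: fp_map_def)

lemma lin_mono: "0 \<le> x \<Longrightarrow> x \<le> y \<Longrightarrow>
    0 \<le> (\<Sum>j\<in>UNIV. C $ i $ j * x $ j) \<and> (\<Sum>j\<in>UNIV. C $ i $ j * x $ j) \<le> (\<Sum>j\<in>UNIV. C $ i $ j * y $ j)"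
  using C_nonneg by (auto simp: less_eq_vec_def intro!: sum_nonneg sum_mono mult_left_mono)

lemma F_mono: "0 \<le> x \<Longrightarrow> x \<le> y \<Longrightarrow> F x \<le> F y"
  using lin_mono[of x y] coef_pos[OF r2]
  by (auto simp: less_eq_vec_def F_nth intro!: mult_left_mono power_mono)

lemma F_nonneg: "0 \<le> x \<Longrightarrow> 0 \<le> F x"
  using lin_mono[of x x] coef_pos[OF r2] \<alpha>_nonneg
  by (auto simp: less_eq_vec_def F_nth intro!: add_nonneg_nonneg mult_nonneg_nonneg)

lemma continuous_F: "continuous_on S (\<lambda>x. F x $ i)"
  unfolding F_nth by (intro continuous_intros)

lemma F_ge_neighbour:
  assumes "0 \<le> v" "0 \<le> y" "y \<le> v $ j"
  shows "\<alpha> i + coef r * (C $ i $ j * y) ^ r \<le> F v $ i"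
proof -
  have "C $ i $ j * y \<le> C $ i $ j * v $ j"
    using assms C_nonneg by (intro mult_left_mono) auto
  also have "\<dots> \<le> (\<Sum>j\<in>UNIV. C $ i $ j * v $ j)"
    using assms C_nonneg by (intro member_le_sum[where f = "\<lambda>j. C $ i $ j * v $ j"])
      (auto simp: less_eq_vec_def)
  finally show ?thesis
    using C_nonneg assms coef_pos[OF r2] by (auto simp: F_nth intro!: mult_left_mono power_mono)
qed

section \<open>The layers and the initial point\<close>

lemma finite_pos_entries: "finite {C $ i $ j | i j. C $ i $ j > 0}"
  by (rule finite_subset[of _ "(\<lambda>(i, j). C $ i $ j) ` UNIV"]) auto

text \<open>A zero matrix is not irreducible, so the minimum runs over a nonempty finite
  set.\<close>

lemma chi_min_pos: "0 < chi_min C"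
proof -
  have "\<exists>i j. C $ i $ j > 0"
  proof (rule ccontr)
    assume "\<not> ?thesis"
    then have "C $ i $ j = 0" for i j
      using C_nonneg[of i j] by (meson antisym not_less)
    then have "mat_power C (Suc h) $ i $ j = 0" for h i j
      by (simp add: matrix_matrix_mult_def)
    then have "\<not> mat_power C h $ i $ j > 0" if "h \<ge> 1" for h i j
      using that by (cases h) auto
    then show False
      using irred unfolding irreducible_mat_def by blast
  qed
  then have "{C $ i $ j | i j. C $ i $ j > 0} \<noteq> {}"
    by blast
  from Min_in[OF finite_pos_entries this] show ?thesis
    by (auto simp: chi_min_def)
qed

lemma chi_min_le: "C $ i $ j > 0 \<Longrightarrow> chi_min C \<le> C $ i $ j"
  unfolding chi_min_def by (rule Min_le[OF finite_pos_entries]) blast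

lemma beta_pos: "0 < beta_seq r \<alpha> C h"
  using r2 chi_min_pos \<alpha>_fst by (induction h) auto

lemma beta_Suc: "2 * beta_seq r \<alpha> C (Suc h) = coef r * (chi_min C * beta_seq r \<alpha> C h) ^ r"
  by (simp add: coef_def)

text \<open>Layer \<open>h\<close> collects the indices at distance \<open>h\<close> from
  \<open>fst_idx\<close> in the graph of positive entries, and irreducibility makes all distances
  finite. Hence the \<open>THE\<close> in \<open>init_point\<close> is meaningful.\<close>

lemma layer_ex1: "\<exists>!h. i \<in> layer C h"
proof (cases "i = fst_idx")
  case True
  then show ?thesis
    by (auto simp: layer_def intro!: ex1I[of _ 0] split: if_splits)
next
  case False
  define P where "P h \<longleftrightarrow> h \<ge> 1 \<and> mat_power C h $ fst_idx $ i > 0" for h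
  have "\<exists>h. P h"
    using irred unfolding irreducible_mat_def P_def by blast
  then have P: "P (Least P)"
    by (rule LeastI_ex)
  have zero: "mat_power C s $ fst_idx $ i = 0" if "1 \<le> s" "s < Least P" for s
    using not_less_Least[OF that(2)] that(1) mat_power_nonneg[of C s fst_idx i] C_nonneg
    by (auto simp: P_def less_le)
  have in_layer: "i \<in> layer C h \<longleftrightarrow> P h \<and> (\<forall>s\<in>{1..<h}. mat_power C s $ fst_idx $ i = 0)" for h
    using False by (auto simp: layer_def P_def)
  show ?thesis
  proof (rule ex1I[of _ "Least P"])
    show "i \<in> layer C (Least P)"
      using P zero by (auto simp: in_layer)
  next
    fix h assume "i \<in> layer C h"
    then have "P h" and h0: "\<And>s. s \<in> {1..<h} \<Longrightarrow> mat_power C s $ fst_idx $ i = 0"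
      by (auto simp: in_layer)
    then have "Least P \<le> h"
      by (intro Least_le)
    moreover have "\<not> Least P < h"
      using h0[of "Least P"] P by (auto simp: P_def)
    ultimately show "h = Least P"
      by simp
  qed
qed

text \<open>The last but one vertex of a shortest walk from \<open>fst_idx\<close> to
  \<open>i\<close> lies in the preceding layer; \<open>C_sym\<close> then reverses the last
  edge.\<close>

lemma layer_pred:
  assumes "i \<in> layer C (Suc h)"
  shows "\<exists>j\<in>layer C h. C $ i $ j > 0"
proof -
  have i: "i \<noteq> fst_idx" "mat_power C (Suc h) $ fst_idx $ i > 0"
    "\<And>s. 1 \<le> s \<Longrightarrow> s \<le> h \<Longrightarrow> mat_power C s $ fst_idx $ i = 0"
    using assms by (auto simp: layer_def)
  have expand: "mat_power C (Suc s) $ fst_idx $ i = (\<Sum>j\<in>UNIV. mat_power C s $ fst_idx $ j * C $ j $ i)" for s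
    unfolding mat_power_Suc' by (simp add: matrix_matrix_mult_def)
  have term0: "0 \<le> mat_power C s $ fst_idx $ j * C $ j $ i" for s j
    using mat_power_nonneg[of C] C_nonneg by simp
  obtain j where j: "mat_power C h $ fst_idx $ j * C $ j $ i > 0"
  proof (rule ccontr)
    assume "\<not> thesis"
    then have "mat_power C h $ fst_idx $ j * C $ j $ i \<le> 0" for j
      using that by (meson not_less)
    then show False
      using i(2) unfolding expand by (simp add: sum_nonpos leD)
  qed
  then have ji: "mat_power C h $ fst_idx $ j > 0" "C $ j $ i > 0"
    using mat_power_nonneg[of C h fst_idx j] C_nonneg[of j i] C_nonneg
    by (auto simp: zero_less_mult_iff)
  \<comment> \<open>A shorter walk to \<open>j\<close> would give a shorter walk to
    \<open>i\<close>. For \<open>h > 0\<close> the case \<open>s = 0\<close> is included and yields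
    \<open>j \<noteq> fst_idx\<close>.\<close>
  have zero: "mat_power C s $ fst_idx $ j = 0" if "s < h" for s
  proof (rule ccontr)
    assume "\<not> ?thesis"
    then have "mat_power C s $ fst_idx $ j * C $ j $ i > 0"
      using mat_power_nonneg[of C s fst_idx j] C_nonneg ji(2) by (simp add: less_le)
    also have "mat_power C s $ fst_idx $ j * C $ j $ i \<le> mat_power C (Suc s) $ fst_idx $ i"
      unfolding expand
      by (rule member_le_sum[where f = "\<lambda>j. mat_power C s $ fst_idx $ j * C $ j $ i"]) (use term0 in auto)
    finally show False
      using i(3)[of "Suc s"] that by simp
  qed
  have "j \<in> layer C h"
  proof (cases h)
    case 0
    then show ?thesis
      using ji by (auto simp: layer_def mat_def split: if_splits)
  next
    case (Suc h')
    have "j \<noteq> fst_idx"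
      using zero[of 0] Suc by (auto simp: mat_def)
    then show ?thesis
      using ji zero Suc by (auto simp: layer_def)
  qed
  then show ?thesis
    using ji C_sym by blast
qed

lemma init_nth: "i \<in> layer C h \<Longrightarrow> x0 $ i = beta_seq r \<alpha> C h"
  using layer_ex1[of i] by (simp add: init_point_def the1_equality)

lemma layer_obtain: obtains h where "i \<in> layer C h"
  using layer_ex1[of i] by blast

lemma init_pos: "0 < x0 $ i"
  by (rule layer_obtain[of i]) (simp add: init_nth beta_pos)

lemma init_nonneg: "0 \<le> x0"
  using init_pos by (simp add: less_eq_vec_def less_imp_le)

text \<open>Layer \<open>0\<close> is fed by \<open>\<alpha> fst_idx\<close>, every later one by a
  neighbour in the layer before; keeping this single term of the sum reproduces the recursion of
  \<open>beta_seq\<close>. The factor \<open>2\<close> undoes the halving in that recursion and is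
  the room for the strict inequality in \<open>init_sub\<close>.\<close>

lemma F_ge_layer:
  assumes "0 \<le> v" "i \<in> layer C h" and "\<And>j h'. h = Suc h' \<Longrightarrow> j \<in> layer C h' \<Longrightarrow> beta_seq r \<alpha> C h' \<le> v $ j"
  shows "2 * beta_seq r \<alpha> C h \<le> F v $ i"
proof (cases h)
  case 0
  then have "i = fst_idx"
    using assms(2) by (simp add: layer_def)
  then show ?thesis
    using F_ge_neighbour[of v 0 i i] assms(1) r2 0 by (auto simp: less_eq_vec_def power_0_left)
next
  case (Suc h')
  then obtain j where j: "j \<in> layer C h'" "C $ i $ j > 0"
    using layer_pred assms(2) by blast
  have "coef r * (chi_min C * beta_seq r \<alpha> C h') ^ r \<le> coef r * (C $ i $ j * beta_seq r \<alpha> C h') ^ r"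
    using chi_min_le[OF j(2)] chi_min_pos beta_pos[of h'] coef_pos[OF r2]
    by (intro mult_left_mono power_mono mult_right_mono) auto
  also have "\<dots> \<le> \<alpha> i + coef r * (C $ i $ j * beta_seq r \<alpha> C h') ^ r"
    using \<alpha>_nonneg by simp
  also have "\<dots> \<le> F v $ i"
    using assms(1) beta_pos[of h'] assms(3)[OF Suc j(1)] by (intro F_ge_neighbour) auto
  finally show ?thesis
    using beta_Suc by (simp add: Suc)
qed

text \<open>Induction along the layers: a supersolution that dominates \<open>beta_seq\<close> on
  one layer does so on the next by \<open>F_ge_layer\<close>.\<close>

lemma init_le:
  assumes "0 \<le> v" "F v \<le> v"
  shows "x0 \<le> v"
proof -
  have "\<forall>i\<in>layer C h. beta_seq r \<alpha> C h \<le> v $ i" for h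
  proof (induction h rule: less_induct)
    case (less h)
    show ?case
    proof
      fix i assume i: "i \<in> layer C h"
      have "2 * beta_seq r \<alpha> C h \<le> F v $ i"
        using assms(1) i less.IH by (intro F_ge_layer) auto
      also have "\<dots> \<le> v $ i"
        using assms(2) by (simp add: less_eq_vec_def)
      finally show "beta_seq r \<alpha> C h \<le> v $ i"
        using beta_pos[of h] by simp
    qed
  qed
  then show ?thesis
    unfolding less_eq_vec_def by (metis layer_obtain init_nth)
qed

text \<open>The start of the monotone flow: all components of \<open>rho\<close> are positive at the
  initial point.\<close>

lemma init_sub: "x0 $ i < F x0 $ i"
proof (rule layer_obtain[of i])
  fix h assume i: "i \<in> layer C h"
  have "2 * beta_seq r \<alpha> C h \<le> F x0 $ i"
    using init_nonneg i by (intro F_ge_layer) (auto simp: init_nth)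
  then show ?thesis
    using beta_pos[of h] init_nth[OF i] by simp
qed


subsection \<open>The least fixed point\<close>

lemma dom_D_down:
  assumes "0 \<le> v" "v \<le> w" "w \<in> dom_D r C"
  shows "v \<in> dom_D r C"
proof -
  have "v $ i + (\<Sum>j\<in>UNIV - {i}. C $ i $ j * v $ j) \<le> w $ i + (\<Sum>j\<in>UNIV - {i}. C $ i $ j * w $ j)" for i
    using assms C_nonneg by (intro add_mono sum_mono mult_left_mono) (auto simp: less_eq_vec_def)
  also have "w $ i + (\<Sum>j\<in>UNIV - {i}. C $ i $ j * w $ j) \<le> real r / (real r - 1)" for i
    using assms(3) by (simp add: dom_D_def)
  finally have "v $ i + (\<Sum>j\<in>UNIV - {i}. C $ i $ j * v $ j) \<le> real r / (real r - 1)" for i .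
  then show ?thesis
    using assms by (auto simp: dom_D_def less_eq_vec_def intro: order_trans)
qed

text \<open>Such a point exists by the subcriticality condition.\<close>

definition upper_pt :: "'k rvec" where
  "upper_pt = (SOME w. w \<in> dom_D r C \<and> (\<forall>i. F w $ i < w $ i))"

text \<open>At the minimiser all components of \<open>rho\<close> coincide by the definition of
  \<open>dom_D_rho\<close>, so the negative first one makes all of them negative.\<close>

lemma upper_pt: "upper_pt \<in> dom_D r C" "F upper_pt $ i < upper_pt $ i"
proof -
  obtain x where x: "x \<in> dom_D_rho r \<alpha> C" "rho r \<alpha> C x $ fst_idx < 0"
    using subcrit by (auto simp: subcritical_def is_arg_min_def)
  then have "x \<in> dom_D r C" "F x $ i < x $ i" for i
    using rho_eq[of r \<alpha> C x i] by (auto simp: dom_D_rho_def) (metis diff_less_0_iff_less)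
  then have "\<exists>w. w \<in> dom_D r C \<and> (\<forall>i. F w $ i < w $ i)"
    by blast
  from someI_ex[OF this] show "upper_pt \<in> dom_D r C" "F upper_pt $ i < upper_pt $ i"
    by (auto simp: upper_pt_def)
qed

lemma upper_pt_nonneg: "0 \<le> upper_pt"
  using upper_pt(1) by (simp add: dom_D_def less_eq_vec_def)

lemma F_upper_pt_le: "F upper_pt \<le> upper_pt"
  using upper_pt(2) by (simp add: less_eq_vec_def less_imp_le)

definition iter :: "nat \<Rightarrow> 'k rvec" where
  "iter m = (F ^^ m) 0"

lemma iter_0 [simp]: "iter 0 = 0" and iter_Suc [simp]: "iter (Suc m) = F (iter m)"
  by (simp_all add: iter_def)

lemma iter_nonneg: "0 \<le> iter m"
  by (induction m) (auto intro: F_nonneg)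

lemma iter_mono: "iter m \<le> iter (Suc m)"
proof (induction m)
  case 0
  then show ?case
    using F_nonneg[of 0] by simp
next
  case (Suc m)
  then show ?case
    using F_mono[OF iter_nonneg] by simp
qed

lemma iter_le: "0 \<le> v \<Longrightarrow> F v \<le> v \<Longrightarrow> iter m \<le> v"
proof (induction m)
  case (Suc m)
  then have "F (iter m) \<le> F v"
    by (intro F_mono iter_nonneg) auto
  then show ?case
    using Suc.prems by simp
qed simp

definition L :: "'k rvec" where
  "L = (\<chi> i. lim (\<lambda>m. iter m $ i))"

text \<open>Monotone and bounded by \<open>upper_pt\<close>: here subcriticality keeps the iteration
  from escaping.\<close>

lemma iter_tendsto: "(\<lambda>m. iter m $ i) \<longlonglongrightarrow> L $ i"
proof -
  have "incseq (\<lambda>m. iter m $ i)"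
    using iter_mono by (intro incseq_SucI) (simp add: less_eq_vec_def)
  moreover have "iter m $ i \<le> upper_pt $ i" for m
    using iter_le[OF upper_pt_nonneg F_upper_pt_le] by (simp add: less_eq_vec_def)
  ultimately obtain l where "(\<lambda>m. iter m $ i) \<longlonglongrightarrow> l"
    using incseq_convergent[of "\<lambda>m. iter m $ i" "upper_pt $ i"] by blast
  then show ?thesis
    by (simp add: L_def limI)
qed

lemma iter_tendsto_vec: "iter \<longlonglongrightarrow> L"
  using iter_tendsto by (intro vec_tendstoI)

lemma L_least: "0 \<le> v \<Longrightarrow> F v \<le> v \<Longrightarrow> L \<le> v"
  using iter_le[of v] LIMSEQ_le_const2[OF iter_tendsto] by (auto simp: less_eq_vec_def)

lemma L_nonneg: "0 \<le> L"
  using iter_nonneg LIMSEQ_le_const[OF iter_tendsto] by (auto simp: less_eq_vec_def)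

lemma F_L: "F L = L"
proof -
  have "F L $ i = L $ i" for i
  proof (rule LIMSEQ_unique)
    have "isCont (\<lambda>x. F x $ i) L"
      using continuous_F[of UNIV i] by (simp add: continuous_on_eq_continuous_at)
    then show "(\<lambda>m. F (iter m) $ i) \<longlonglongrightarrow> F L $ i"
      using iter_tendsto_vec by (rule isCont_tendsto_compose)
    show "(\<lambda>m. F (iter m) $ i) \<longlonglongrightarrow> L $ i"
      using LIMSEQ_Suc[OF iter_tendsto[of i]] by simp
  qed
  then show ?thesis
    by (simp add: vec_eq_iff)
qed

lemma L_less_upper_pt: "L $ i < upper_pt $ i"
proof -
  have "F L \<le> F upper_pt"
    by (intro F_mono L_nonneg L_least upper_pt_nonneg F_upper_pt_le)
  then have "L $ i \<le> F upper_pt $ i"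
    by (simp add: F_L less_eq_vec_def)
  then show ?thesis
    using upper_pt(2)[of i] by simp
qed

lemma init_le_L: "x0 \<le> L"
  by (rule init_le) (simp_all add: L_nonneg F_L)

lemma L_pos: "0 < L $ i"
  using init_pos[of i] init_le_L by (simp add: less_eq_vec_def) (meson less_le_trans)

definition super :: "real \<Rightarrow> 'k rvec" where
  "super s = L + s *\<^sub>R (upper_pt - L)"

lemma super_bounds:
  assumes "0 < s" "s \<le> 1"
  shows "L $ i < super s $ i" "super s $ i \<le> upper_pt $ i"
proof -
  have pos: "0 < upper_pt $ i - L $ i"
    using L_less_upper_pt by simp
  then have "0 < s * (upper_pt $ i - L $ i)" "s * (upper_pt $ i - L $ i) \<le> 1 * (upper_pt $ i - L $ i)"
    using assms by (auto intro!: mult_right_mono)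
  then show "L $ i < super s $ i" "super s $ i \<le> upper_pt $ i"
    by (auto simp: super_def)
qed

text \<open>Each component of \<open>F\<close> is convex on the nonnegative orthant.\<close>

lemma F_super_less:
  assumes "0 < s" "s \<le> 1"
  shows "F (super s) $ i < super s $ i"
proof -
  define a where "a = (\<Sum>j\<in>UNIV. C $ i $ j * L $ j)"
  define b where "b = (\<Sum>j\<in>UNIV. C $ i $ j * upper_pt $ j)"
  have ab: "0 \<le> a" "0 \<le> b"
    using lin_mono[of L L i] lin_mono[of upper_pt upper_pt i] L_nonneg upper_pt_nonneg by (auto simp: a_def b_def)
  have "convex_on {0::real..} (\<lambda>x. x ^ r)"
    using convex_power_odd[of r] convex_on_subset[OF convex_power_even[of r]] by (cases "even r") auto
  then have conv: "((1 - s) *\<^sub>R a + s *\<^sub>R b) ^ r \<le> (1 - s) * a ^ r + s * b ^ r"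
    using convex_onD[of "{0..}" "\<lambda>x. x ^ r" s a b] assms ab by auto
  have "(\<Sum>j\<in>UNIV. C $ i $ j * super s $ j) = (1 - s) *\<^sub>R a + s *\<^sub>R b"
    by (simp add: super_def a_def b_def sum_distrib_left sum.distrib[symmetric] algebra_simps
        sum_subtractf[symmetric])
  then have "F (super s) $ i = \<alpha> i + coef r * ((1 - s) *\<^sub>R a + s *\<^sub>R b) ^ r"
    by (simp add: F_nth)
  also have "\<dots> \<le> \<alpha> i + coef r * ((1 - s) * a ^ r + s * b ^ r)"
    using conv coef_pos[OF r2] by (intro add_left_mono mult_left_mono) auto
  also have "\<dots> = (1 - s) * F L $ i + s * F upper_pt $ i"
    by (simp add: F_nth a_def b_def algebra_simps)
  \<comment> \<open>Strict because \<open>upper_pt\<close> enters with weight \<open>s > 0\<close>;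
    at \<open>L\<close> there is equality.\<close>
  also have "\<dots> < (1 - s) * L $ i + s * upper_pt $ i"
    using upper_pt(2)[of i] assms by (simp add: F_L)
  also have "\<dots> = super s $ i"
    by (simp add: super_def algebra_simps)
  finally show ?thesis .
qed

end


subsection \<open>The flow of the vector field\<close>

text \<open>Derivatives are asked for in the interior only, since at the starting time the solution
  has a merely one-sided derivative.\<close>

lemma nondecreasing_open:
  fixes f :: "real \<Rightarrow> real"
  assumes "a \<le> b" "continuous_on {a..b} f"
    and "\<And>x. a < x \<Longrightarrow> x < b \<Longrightarrow> \<exists>y. (f has_real_derivative y) (at x) \<and> 0 \<le> y"
  shows "f a \<le> f b"
proof (cases "a = b")
  case False
  then have "a < b"
    using assms(1) by simp
  moreover have "f differentiable (at x)" if "a < x" "x < b" for x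
    using assms(3)[OF that] by (auto simp: real_differentiable_def)
  ultimately obtain l s where s: "a < s" "s < b" "(f has_real_derivative l) (at s)" "f b - f a = (b - a) * l"
    using MVT[of a b f] assms(2) by blast
  have "0 \<le> l"
    using assms(3)[OF s(1,2)] s(3) DERIV_unique by blast
  then have "0 \<le> (b - a) * l"
    using \<open>a < b\<close> by simp
  then show ?thesis
    using s(4) by linarith
qed simp

text \<open>The failure times of finitely many continuous functions form a closed set, so a failure
  would have a first time, which \<open>start\<close> and \<open>step\<close> exclude.\<close>

lemma positive_by_first_failure:
  fixes f :: "'i::finite \<Rightarrow> real \<Rightarrow> real"
  assumes cont: "\<And>i. continuous_on {a..} (f i)" and start: "\<And>i. 0 < f i a"
    and step: "\<And>\<tau> i. a < \<tau> \<Longrightarrow> (\<And>t j. a \<le> t \<Longrightarrow> t < \<tau> \<Longrightarrow> 0 < f j t) \<Longrightarrow> 0 < f i \<tau>"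
    and "a \<le> t"
  shows "0 < f i t"
proof (rule ccontr)
  define B where "B = (\<Union>i. {a..} \<inter> f i -` {..0})"
  assume "\<not> ?thesis"
  then have ne: "B \<noteq> {}"
    using \<open>a \<le> t\<close> by (auto simp: B_def not_less)
  have closed: "closed B"
    unfolding B_def
    by (rule closed_UN) (simp_all add: continuous_closed_preimage[OF cont])
  have bdd: "bdd_below B"
    by (rule bdd_belowI[of _ a]) (auto simp: B_def)
  define \<tau> where "\<tau> = Inf B"
  have "\<tau> \<in> B"
    unfolding \<tau>_def using closed ne bdd by (intro closed_contains_Inf)
  then obtain i where i: "a \<le> \<tau>" "f i \<tau> \<le> 0"
    by (auto simp: B_def)
  have before: "0 < f j s" if "a \<le> s" "s < \<tau>" for s j
  proof (rule ccontr)
    assume "\<not> ?thesis"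
    then have "s \<in> B"
      using that by (auto simp: B_def not_less)
    then show False
      using cInf_lower[OF _ bdd, of s] that by (simp add: \<tau>_def)
  qed
  have "\<tau> \<noteq> a"
    using i start[of i] by auto
  then show False
    using step[of \<tau> i] before i by auto
qed

context subcrit_system
begin

section \<open>Monotonicity and convergence of the flow\<close>

abbreviation "flow y0 x \<equiv> cauchy_on r \<alpha> C y0 \<infinity> x"

lemma flow_deriv:
  assumes "flow y0 x" "y0 \<le> t"
  shows "((\<lambda>t. x t $ i) has_real_derivative rho r \<alpha> C (x t) $ i) (at t within {y0..})"
proof -
  have "{y. y0 \<le> y \<and> ereal y < \<infinity>} = {y0..}"
    by auto
  then have "(x has_vector_derivative rho r \<alpha> C (x t)) (at t within {y0..})"
    using assms by (auto simp: cauchy_on_def)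
  then have "((\<lambda>t. x t $ i) has_vector_derivative rho r \<alpha> C (x t) $ i) (at t within {y0..})"
    by (rule bounded_linear.has_vector_derivative[OF bounded_linear_vec_nth])
  then show ?thesis
    by (simp add: has_real_derivative_iff_has_vector_derivative)
qed

lemma flow_deriv_at:
  assumes "flow y0 x" "y0 < t"
  shows "((\<lambda>t. x t $ i) has_real_derivative rho r \<alpha> C (x t) $ i) (at t)"
proof -
  have "at t within {y0..} = at t"
    using assms(2) by (intro at_within_interior) simp
  then show ?thesis
    using flow_deriv[OF assms(1), of t i] assms(2) by simp
qed

lemma flow_cont:
  assumes "flow y0 x"
  shows "continuous_on {y0..} x"
proof -
  have "continuous_on {y0..} (\<lambda>t. \<chi> i. x t $ i)"
    by (intro continuous_on_vec_lambda DERIV_continuous_on[OF flow_deriv[OF assms]]) simp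
  then show ?thesis
    by simp
qed

lemma flow_init: "flow y0 x \<Longrightarrow> x y0 = x0"
  by (simp add: cauchy_on_def)

lemma flow_rho_cont: "flow y0 x \<Longrightarrow> continuous_on {y0..} (\<lambda>t. rho r \<alpha> C (x t) $ i)"
  unfolding rho_eq F_nth using flow_cont[of y0 x] by (intro continuous_intros)

text \<open>Positivity is assumed only before \<open>b\<close>, so that the lemma applies inside the
  first-failure argument of \<open>flow_rho_pos\<close>, where nothing is known from the critical
  time on.\<close>

lemma flow_ge:
  assumes sol: "flow y0 x" and pos: "\<And>s j. y0 \<le> s \<Longrightarrow> s < b \<Longrightarrow> 0 < rho r \<alpha> C (x s) $ j"
    and "y0 \<le> a" "a \<le> b"
  shows "x a \<le> x b"
proof -
  have "x a $ i \<le> x b $ i" for i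
  proof (rule nondecreasing_open[OF \<open>a \<le> b\<close>])
    show "continuous_on {a..b} (\<lambda>t. x t $ i)"
      using continuous_on_subset[OF flow_cont[OF sol], of "{a..b}"] assms(3)
      by (intro continuous_on_component) auto
    fix s assume "a < s" "s < b"
    then show "\<exists>y. ((\<lambda>t. x t $ i) has_real_derivative y) (at s) \<and> 0 \<le> y"
      using flow_deriv_at[OF sol, of s i] pos[of s i] assms(3) by (auto intro!: exI less_imp_le)
  qed
  then show ?thesis
    by (simp add: less_eq_vec_def)
qed

text \<open>
  The system is cooperative: as long as \<open>\<rho>\<close> is positive along the solution, \<open>exp t * \<rho>\<^sub>i (x t)\<close> is
  nondecreasing.
\<close>

lemma flow_rho_pos:
  assumes sol: "flow y0 x" and "y0 \<le> t"
  shows "0 < rho r \<alpha> C (x t) $ i"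
proof (rule positive_by_first_failure[where a = y0 and f = "\<lambda>i t. rho r \<alpha> C (x t) $ i"])
  show "continuous_on {y0..} (\<lambda>t. rho r \<alpha> C (x t) $ i)" for i
    using sol by (rule flow_rho_cont)
  show "0 < rho r \<alpha> C (x y0) $ i" for i
    using init_sub[of i] by (simp add: flow_init[OF sol] rho_eq)
  show "y0 \<le> t"
    by fact
next
  fix \<tau> i
  assume \<tau>: "y0 < \<tau>" and pos: "\<And>t j. y0 \<le> t \<Longrightarrow> t < \<tau> \<Longrightarrow> 0 < rho r \<alpha> C (x t) $ j"
  have x_nonneg: "0 \<le> x t" if "y0 \<le> t" "t < \<tau>" for t
    using flow_ge[OF sol, of t y0] pos that init_nonneg flow_init[OF sol] by (metis order_trans less_trans order_refl)
  define d where "d j t = rho r \<alpha> C (x t) $ j" for j t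
  define \<phi> where "\<phi> t = exp t * d i t" for t
  \<comment> \<open>With \<open>e = exp t\<close>, \<open>b = d i t\<close> and \<open>a\<close> the
    derivative of the \<open>F\<close>-part this is the derivative of \<open>\<phi>\<close>: the
    weight cancels the damping term of the vector field.\<close>
  have weighted: "0 \<le> e * b + (a - b) * e" if "0 \<le> a" "0 \<le> e" for a b e :: real
    using that by (simp add: algebra_simps)
  have "\<phi> y0 \<le> \<phi> \<tau>"
  proof (rule nondecreasing_open[where f = \<phi>])
    have "continuous_on {y0..} (d i)"
      unfolding d_def by (rule flow_rho_cont[OF sol])
    then have "continuous_on {y0..} \<phi>"
      unfolding \<phi>_def by (intro continuous_on_mult continuous_on_exp continuous_on_id)
    then show "continuous_on {y0..\<tau>} \<phi>"
      by (rule continuous_on_subset) auto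
  next
    fix t assume t: "y0 < t" "t < \<tau>"
    define S where "S = (\<Sum>j\<in>UNIV. C $ i $ j * x t $ j)"
    have dx: "((\<lambda>t. x t $ j) has_real_derivative d j t) (at t)" for j
      unfolding d_def by (rule flow_deriv_at[OF sol t(1)])
    have dS: "((\<lambda>t. \<Sum>j\<in>UNIV. C $ i $ j * x t $ j) has_real_derivative (\<Sum>j\<in>UNIV. C $ i $ j * d j t)) (at t)"
      by (intro derivative_eq_intros DERIV_sum DERIV_cmult dx)
    have dF: "((\<lambda>t. \<alpha> i + coef r * (\<Sum>j\<in>UNIV. C $ i $ j * x t $ j) ^ r) has_real_derivative
        coef r * (real r * (\<Sum>j\<in>UNIV. C $ i $ j * d j t) * S ^ (r - 1))) (at t)"
      by (rule DERIV_cong[OF DERIV_add[OF DERIV_const DERIV_cmult[OF DERIV_power[OF dS]]]]) (simp add: S_def)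
    have "(d i has_real_derivative
        coef r * (real r * (\<Sum>j\<in>UNIV. C $ i $ j * d j t) * S ^ (r - 1)) - d i t) (at t)"
      unfolding d_def[of i, abs_def] rho_eq F_nth
      using DERIV_diff[OF dF dx[of i]] by (simp add: d_def rho_eq F_nth)
    then have "(\<phi> has_real_derivative exp t * d i t +
        (coef r * (real r * (\<Sum>j\<in>UNIV. C $ i $ j * d j t) * S ^ (r - 1)) - d i t) * exp t) (at t)"
      unfolding \<phi>_def[abs_def] by (intro DERIV_mult DERIV_exp)
    moreover have "0 \<le> S"
      using lin_mono[OF x_nonneg order_refl] t by (simp add: S_def)
    then have "0 \<le> coef r * (real r * (\<Sum>j\<in>UNIV. C $ i $ j * d j t) * S ^ (r - 1))"
      using coef_pos[OF r2] C_nonneg pos[of t] t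
      by (auto simp: d_def intro!: mult_nonneg_nonneg sum_nonneg less_imp_le[OF pos])
    then have "0 \<le> exp t * d i t +
        (coef r * (real r * (\<Sum>j\<in>UNIV. C $ i $ j * d j t) * S ^ (r - 1)) - d i t) * exp t"
      by (rule weighted) simp
    ultimately show "\<exists>y. (\<phi> has_real_derivative y) (at t) \<and> 0 \<le> y"
      by blast
  qed (use \<tau> in simp)
  moreover have "0 < \<phi> y0"
    using init_sub[of i] by (simp add: \<phi>_def d_def flow_init[OF sol] rho_eq)
  ultimately have "0 < \<phi> \<tau>"
    by simp
  then show "0 < rho r \<alpha> C (x \<tau>) $ i"
    by (simp add: \<phi>_def d_def zero_less_mult_iff)
qed

lemma flow_mono: "flow y0 x \<Longrightarrow> y0 \<le> s \<Longrightarrow> s \<le> t \<Longrightarrow> x s \<le> x t"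
  using flow_ge flow_rho_pos by blast

lemma flow_ge_init: "flow y0 x \<Longrightarrow> y0 \<le> t \<Longrightarrow> x0 \<le> x t"
  using flow_mono[of y0 x y0 t] flow_init by simp

text \<open>At a first contact time continuity still gives \<open>x \<tau> \<le> super s\<close>,
  while \<open>x \<tau> $ i < F (x \<tau>) $ i \<le> F (super s) $ i < super s $ i\<close> by
  \<open>flow_rho_pos\<close>, monotonicity and \<open>F_super_less\<close>; so there is no
  contact.\<close>

lemma flow_less_super:
  assumes sol: "flow y0 x" and s: "0 < s" "s \<le> 1" and "y0 \<le> t"
  shows "x t $ i < super s $ i"
proof -
  have "0 < super s $ i - x t $ i"
  proof (rule positive_by_first_failure[where a = y0 and f = "\<lambda>i t. super s $ i - x t $ i"])
    show "continuous_on {y0..} (\<lambda>t. super s $ i - x t $ i)" for i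
      using flow_cont[OF sol] by (intro continuous_intros)
    show "0 < super s $ i - x y0 $ i" for i
      using init_le_L super_bounds(1)[OF s, of i] by (auto simp: flow_init[OF sol] less_eq_vec_def) (meson le_less_trans)
  next
    fix \<tau> i
    assume \<tau>: "y0 < \<tau>" and less: "\<And>t j. y0 \<le> t \<Longrightarrow> t < \<tau> \<Longrightarrow> 0 < super s $ j - x t $ j"
    have "x \<tau> $ j \<le> super s $ j" for j
    proof (rule tendsto_upperbound)
      have "((\<lambda>t. x t $ j) has_real_derivative rho r \<alpha> C (x \<tau>) $ j) (at \<tau>)"
        using sol \<tau> by (rule flow_deriv_at)
      then show "((\<lambda>t. x t $ j) \<longlongrightarrow> x \<tau> $ j) (at_left \<tau>)"
        using DERIV_isCont isCont_def filterlim_at_split by blast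
      show "\<forall>\<^sub>F t in at_left \<tau>. x t $ j \<le> super s $ j"
        using eventually_at_left_real[OF \<tau>] by eventually_elim (use less[of _ j] in \<open>auto intro: less_imp_le\<close>)
    qed simp
    then have le: "x \<tau> \<le> super s"
      by (simp add: less_eq_vec_def)
    have "0 \<le> x \<tau>"
      using flow_ge_init[OF sol, of \<tau>] init_nonneg \<tau> by simp
    then have "F (x \<tau>) $ i \<le> F (super s) $ i"
      using F_mono[OF _ le] by (simp add: less_eq_vec_def)
    then have "x \<tau> $ i < super s $ i"
      using flow_rho_pos[OF sol, of \<tau> i] F_super_less[OF s, of i] \<tau> by (simp add: rho_eq)
    then show "0 < super s $ i - x \<tau> $ i"
      by simp
  qed fact
  then show ?thesis
    by simp
qed

lemma flow_le_L:
  assumes "flow y0 x" "y0 \<le> t"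
  shows "x t \<le> L"
proof -
  have "x t $ i \<le> L $ i" for i
  proof (rule tendsto_lowerbound)
    have "((\<lambda>s. (L + s *\<^sub>R (upper_pt - L)) $ i) \<longlongrightarrow> (L + 0 *\<^sub>R (upper_pt - L)) $ i) (at_right 0)"
      by (intro tendsto_intros)
    then show "((\<lambda>s. super s $ i) \<longlongrightarrow> L $ i) (at_right 0)"
      by (simp add: super_def)
    show "\<forall>\<^sub>F s in at_right 0. x t $ i \<le> super s $ i"
      using eventually_at_right_real[of 0 1]
      by (auto elim!: eventually_mono intro!: less_imp_le flow_less_super[OF assms(1) _ _ assms(2)])
  qed simp
  then show ?thesis
    by (simp add: less_eq_vec_def)
qed

text \<open>A monotone bounded path converges to some \<open>l \<le> L\<close>. If
  \<open>F l $ i > l $ i\<close>, component \<open>i\<close> would eventually grow at a positive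
  rate and pass \<open>L $ i\<close>; so \<open>l\<close> is a supersolution, and \<open>L\<close>
  is the least of these.\<close>

lemma flow_tendsto:
  assumes sol: "flow y0 x"
  shows "(x \<longlongrightarrow> L) at_top"
proof -
  define l where "l = (\<chi> i. SUP t\<in>{y0..}. x t $ i)"
  have bdd: "bdd_above ((\<lambda>t. x t $ i) ` {y0..})" for i
    using flow_le_L[OF sol] by (intro bdd_aboveI[of _ "L $ i"]) (auto simp: less_eq_vec_def)
  have upper: "x t $ i \<le> l $ i" if "y0 \<le> t" for t i
    using that cSUP_upper[OF _ bdd, of t i] by (simp add: l_def)
  have x_lim: "((\<lambda>t. x t $ i) \<longlongrightarrow> l $ i) at_top" for i
  proof (rule order_tendstoI)
    fix a assume "a < l $ i"
    then obtain t where t: "y0 \<le> t" "a < x t $ i"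
      using less_cSUP_iff[OF _ bdd] by (auto simp: l_def)
    have "a < x s $ i" if "t \<le> s" for s
      using flow_mono[OF sol t(1) that] t(2) by (auto simp: less_eq_vec_def intro: less_le_trans)
    then show "\<forall>\<^sub>F s in at_top. a < x s $ i"
      by (auto simp: eventually_at_top_linorder)
  next
    fix a assume "l $ i < a"
    then show "\<forall>\<^sub>F s in at_top. x s $ i < a"
      using upper le_less_trans unfolding eventually_at_top_linorder by blast
  qed
  then have lim: "(x \<longlongrightarrow> l) at_top"
    by (rule vec_tendstoI)
  have l_le: "l \<le> L"
    unfolding less_eq_vec_def l_def
    using flow_le_L[OF sol] by (auto intro!: cSUP_least simp: less_eq_vec_def)
  have l_nonneg: "0 \<le> l"
    using upper[of y0] init_nonneg flow_init[OF sol] by (auto simp: less_eq_vec_def intro: order_trans)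
  have "F l $ i \<le> l $ i" for i
  proof (rule ccontr)
    assume greater: "\<not> F l $ i \<le> l $ i"
    define e where "e = (F l $ i - l $ i) / 2"
    have e: "0 < e" "e < F l $ i - l $ i"
      using greater by (auto simp: e_def)
    have "isCont (\<lambda>x. F x $ i) l"
      using continuous_F[of UNIV i] by (simp add: continuous_on_eq_continuous_at)
    then have "((\<lambda>t. F (x t) $ i) \<longlongrightarrow> F l $ i) at_top"
      using lim by (rule isCont_tendsto_compose)
    then have "((\<lambda>t. F (x t) $ i - x t $ i) \<longlongrightarrow> F l $ i - l $ i) at_top"
      using x_lim[of i] by (rule tendsto_diff)
    then have "\<forall>\<^sub>F t in at_top. e < F (x t) $ i - x t $ i"
      using e(2) by (rule order_tendstoD)
    then obtain t0 where t0: "\<And>t. t0 \<le> t \<Longrightarrow> e < F (x t) $ i - x t $ i"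
      by (auto simp: eventually_at_top_linorder)
    define t1 where "t1 = max t0 (y0 + 1)"
    \<comment> \<open>Growth at rate \<open>e\<close> from \<open>t1\<close> to \<open>t2\<close>
      overshoots \<open>L $ i\<close> by \<open>e\<close>.\<close>
    define t2 where "t2 = t1 + (L $ i - x t1 $ i) / e + 1"
    have t1: "t0 \<le> t1" "y0 < t1"
      by (auto simp: t1_def)
    have "0 \<le> L $ i - x t1 $ i"
      using flow_le_L[OF sol, of t1] t1 by (simp add: less_eq_vec_def)
    then have t12: "t1 < t2"
      using e by (auto simp: t2_def intro!: add_nonneg_pos)
    have "x t1 $ i - e * t1 \<le> x t2 $ i - e * t2"
    proof (rule nondecreasing_open[where f = "\<lambda>t. x t $ i - e * t"])
      have "continuous_on {t1..t2} x"
        by (rule continuous_on_subset[OF flow_cont[OF sol]]) (use t1 in auto)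
      then show "continuous_on {t1..t2} (\<lambda>t. x t $ i - e * t)"
        by (intro continuous_intros)
      fix t assume "t1 < t" "t < t2"
      then have "((\<lambda>t. x t $ i - e * t) has_real_derivative rho r \<alpha> C (x t) $ i - e) (at t)"
        using t1 by (auto intro!: derivative_eq_intros flow_deriv_at[OF sol])
      moreover have "0 \<le> rho r \<alpha> C (x t) $ i - e"
        using t0[of t] t1 \<open>t1 < t\<close> by (simp add: rho_eq)
      ultimately show "\<exists>y. ((\<lambda>t. x t $ i - e * t) has_real_derivative y) (at t) \<and> 0 \<le> y"
        by blast
    qed (use t12 in simp)
    moreover have "e * (t2 - t1) = L $ i - x t1 $ i + e"
      using e by (simp add: t2_def field_simps)
    ultimately have "L $ i + e \<le> x t2 $ i"
      by (simp add: algebra_simps)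
    moreover have "x t2 $ i \<le> L $ i"
      using flow_le_L[OF sol, of t2] t1 t12 by (simp add: less_eq_vec_def)
    ultimately show False
      using e by simp
  qed
  then have "F l \<le> l"
    by (simp add: less_eq_vec_def)
  then have "l = L"
    using L_least[OF l_nonneg] l_le by (intro antisym) auto
  then show ?thesis
    using lim by simp
qed


subsection \<open>Existence of the solution\<close>

text \<open>
  The Picard iteration for \<open>x' = F x - x\<close> in its integrated form
  \<open>x t = exp (y0 - t) * (x0 + \<integral> exp (s - y0) * F (x s) ds)\<close> is monotone and bounded by \<open>L\<close>.
\<close>

primrec picard :: "real \<Rightarrow> nat \<Rightarrow> real \<Rightarrow> 'k rvec" where
  "picard y0 0 t = x0"
| "picard y0 (Suc m) t = (\<chi> i. exp (y0 - t) *
     (x0 $ i + integral {y0..t} (\<lambda>s. exp (s - y0) * F (picard y0 m s) $ i)))"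

lemma integral_exp_shift:
  fixes c y0 t :: real
  assumes "y0 \<le> t"
  shows "((\<lambda>s. exp (s - y0) * c) has_integral (exp (t - y0) - 1) * c) {y0..t}"
proof -
  have "((\<lambda>s. exp (s - y0) * c) has_integral exp (t - y0) * c - exp (y0 - y0) * c) {y0..t}"
    using assms
    by (intro fundamental_theorem_of_calculus[where f = "\<lambda>s. exp (s - y0) * c"])
      (auto intro!: derivative_eq_intros simp: has_real_derivative_iff_has_vector_derivative[symmetric])
  then show ?thesis
    by (simp add: algebra_simps)
qed

lemma picard_cont: "continuous_on {y0..b} (picard y0 m)"
proof (induction m)
  case (Suc m)
  have "continuous_on {y0..b} (\<lambda>s. exp (s - y0) * F (picard y0 m s) $ i)" for i
    unfolding F_nth using Suc by (intro continuous_intros)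
  then have "continuous_on {y0..b} (\<lambda>t. integral {y0..t} (\<lambda>s. exp (s - y0) * F (picard y0 m s) $ i))" for i
    by (intro indefinite_integral_continuous_1 integrable_continuous_real)
  then show ?case
    by (auto intro!: continuous_intros)
qed simp

lemma picard_integrable:
  "(\<lambda>s. exp (s - y0) * F (picard y0 m s) $ i) integrable_on {y0..t}"
proof (rule integrable_continuous_real)
  show "continuous_on {y0..t} (\<lambda>s. exp (s - y0) * F (picard y0 m s) $ i)"
    unfolding F_nth using picard_cont[of y0 t m] by (intro continuous_intros)
qed

text \<open>As functions constant in time, \<open>x0\<close> is a subsolution and \<open>L\<close> a
  supersolution of the integral equation. The lower bound keeps the iterates nonnegative, where the
  integral operator is monotone.\<close>

lemma picard_bounds:
  "y0 \<le> t \<Longrightarrow> x0 \<le> picard y0 m t \<and> picard y0 m t \<le> picard y0 (Suc m) t \<and> picard y0 m t \<le> L"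
proof (induction m arbitrary: t)
  case 0
  have "x0 $ i \<le> picard y0 (Suc 0) t $ i" for i
  proof -
    have "(exp (t - y0) - 1) * x0 $ i \<le> (exp (t - y0) - 1) * F x0 $ i"
      using 0 init_sub[of i] by (intro mult_left_mono) auto
    also have "\<dots> = integral {y0..t} (\<lambda>s. exp (s - y0) * F x0 $ i)"
      by (rule integral_unique[OF integral_exp_shift[OF 0], symmetric])
    finally have "exp (y0 - t) * (exp (t - y0) * x0 $ i) \<le>
        exp (y0 - t) * (x0 $ i + integral {y0..t} (\<lambda>s. exp (s - y0) * F x0 $ i))"
      by (intro mult_left_mono) (auto simp: algebra_simps)
    then show ?thesis
      by (simp add: mult.assoc[symmetric] exp_add[symmetric])
  qed
  then show ?case
    using init_le_L by (simp add: less_eq_vec_def)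
next
  case (Suc m)
  have IH: "x0 \<le> picard y0 m s" "picard y0 m s \<le> picard y0 (Suc m) s" "picard y0 m s \<le> L"
    if "y0 \<le> s" for s
    using Suc.IH[OF that] by auto
  have nonneg: "0 \<le> picard y0 m s" if "y0 \<le> s" for s
    using IH(1)[OF that] init_nonneg by (rule order_trans[rotated])
  have "picard y0 (Suc m) t $ i \<le> L $ i" for i
  proof -
    have *: "integral {y0..t} (\<lambda>s. exp (s - y0) * F (picard y0 m s) $ i) \<le> (exp (t - y0) - 1) * L $ i"
    proof (rule has_integral_le[OF integrable_integral[OF picard_integrable] integral_exp_shift[OF Suc.prems]])
      fix s assume "s \<in> {y0..t}"
      then have "F (picard y0 m s) \<le> F L"
        using IH(3) nonneg by (intro F_mono) auto
      then show "exp (s - y0) * F (picard y0 m s) $ i \<le> exp (s - y0) * L $ i"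
        by (simp add: F_L less_eq_vec_def)
    qed
    have "x0 $ i + integral {y0..t} (\<lambda>s. exp (s - y0) * F (picard y0 m s) $ i) \<le> exp (t - y0) * L $ i"
    proof -
      have "x0 $ i \<le> L $ i"
        using init_le_L by (simp add: less_eq_vec_def)
      then show ?thesis
        using * unfolding left_diff_distrib by linarith
    qed
    then have "picard y0 (Suc m) t $ i \<le> exp (y0 - t) * (exp (t - y0) * L $ i)"
      by (simp only: picard.simps vec_lambda_beta mult_left_mono exp_ge_zero)
    then show ?thesis
      by (simp only: mult.assoc[symmetric] exp_add[symmetric]) simp
  qed
  moreover have "picard y0 (Suc m) t $ i \<le> picard y0 (Suc (Suc m)) t $ i" for i
  proof -
    have "integral {y0..t} (\<lambda>s. exp (s - y0) * F (picard y0 m s) $ i) \<le>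
        integral {y0..t} (\<lambda>s. exp (s - y0) * F (picard y0 (Suc m) s) $ i)"
    proof (rule integral_le[OF picard_integrable picard_integrable])
      fix s assume "s \<in> {y0..t}"
      then have "F (picard y0 m s) \<le> F (picard y0 (Suc m) s)"
        using IH(2) nonneg by (intro F_mono) auto
      then show "exp (s - y0) * F (picard y0 m s) $ i \<le> exp (s - y0) * F (picard y0 (Suc m) s) $ i"
        by (simp only: less_eq_vec_def mult_left_mono exp_ge_zero)
    qed
    then show ?thesis
      unfolding picard.simps(2)[of y0 "Suc m"] picard.simps(2)[of y0 m] vec_lambda_beta
      by (intro mult_left_mono add_left_mono) (simp_all only: picard.simps exp_ge_zero)
  qed
  moreover have "x0 \<le> picard y0 (Suc m) t"
    using IH(1,2)[OF Suc.prems] by (rule order_trans)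
  ultimately show ?case
    unfolding less_eq_vec_def by blast
qed

text \<open>The monotone limit of the iterates satisfies the integral equation by dominated
  convergence with majorant \<open>exp (s - y0) * L $ i\<close>; this makes it continuous, then
  differentiable. It is global because it stays between \<open>x0\<close> and
  \<open>L\<close>.\<close>

lemma flow_exists: "\<exists>x. flow y0 x"
proof -
  define U where "U t = (\<chi> i. lim (\<lambda>m. picard y0 m t $ i))" for t
  have conv: "(\<lambda>m. picard y0 m t $ i) \<longlonglongrightarrow> U t $ i" if "y0 \<le> t" for t i
  proof -
    have "incseq (\<lambda>m. picard y0 m t $ i)"
      by (rule incseq_SucI) (use picard_bounds[OF that] in \<open>unfold less_eq_vec_def, blast\<close>)
    moreover have "picard y0 m t $ i \<le> L $ i" for m
      using picard_bounds[OF that] unfolding less_eq_vec_def by blast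
    ultimately obtain l where "(\<lambda>m. picard y0 m t $ i) \<longlonglongrightarrow> l"
      using incseq_convergent[of "\<lambda>m. picard y0 m t $ i" "L $ i"] by blast
    then show ?thesis
      by (simp add: U_def limI)
  qed
  have U_bounds: "x0 \<le> U t" "U t \<le> L" if "y0 \<le> t" for t
    unfolding less_eq_vec_def
    using LIMSEQ_le_const[OF conv[OF that]] LIMSEQ_le_const2[OF conv[OF that]] picard_bounds[OF that]
    unfolding less_eq_vec_def by blast+
  define G where "G i s = exp (s - y0) * F (U s) $ i" for i s
  have conv_G: "(\<lambda>m. exp (s - y0) * F (picard y0 m s) $ i) \<longlonglongrightarrow> G i s" if "y0 \<le> s" for s i
  proof -
    have "isCont (\<lambda>x. F x $ i) (U s)"
      using continuous_F[of UNIV i] by (simp add: continuous_on_eq_continuous_at)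
    moreover have "(\<lambda>m. picard y0 m s) \<longlonglongrightarrow> U s"
      by (rule vec_tendstoI) (rule conv[OF that])
    ultimately have "(\<lambda>m. F (picard y0 m s) $ i) \<longlonglongrightarrow> F (U s) $ i"
      by (rule isCont_tendsto_compose)
    then show ?thesis
      unfolding G_def by (rule tendsto_mult_left)
  qed
  have G: "G i integrable_on {y0..t}"
    "(\<lambda>m. integral {y0..t} (\<lambda>s. exp (s - y0) * F (picard y0 m s) $ i)) \<longlonglongrightarrow> integral {y0..t} (G i)"
    if "y0 \<le> t" for t i
  proof -
    have le: "norm (exp (s - y0) * F (picard y0 m s) $ i) \<le> exp (s - y0) * L $ i"
      if "s \<in> {y0..t}" for m s
    proof -
      have b: "0 \<le> picard y0 m s" "picard y0 m s \<le> L"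
        using picard_bounds[of y0 s m] that init_nonneg by (auto intro: order_trans)
      then have "0 \<le> F (picard y0 m s) $ i" "F (picard y0 m s) $ i \<le> L $ i"
        using F_nonneg[OF b(1)] F_mono[OF b] by (auto simp: F_L less_eq_vec_def)
      then show ?thesis
        by (simp add: abs_mult)
    qed
    have int_L: "(\<lambda>s. exp (s - y0) * L $ i) integrable_on {y0..t}"
      using integral_exp_shift[OF \<open>y0 \<le> t\<close>] by blast
    from int_L le show "G i integrable_on {y0..t}"
      by (rule dominated_convergence(1)[OF picard_integrable]) (auto intro: conv_G)
    from int_L le
    show "(\<lambda>m. integral {y0..t} (\<lambda>s. exp (s - y0) * F (picard y0 m s) $ i)) \<longlonglongrightarrow> integral {y0..t} (G i)"
      by (rule dominated_convergence(2)[OF picard_integrable]) (auto intro: conv_G)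
  qed
  have U_eq: "U t $ i = exp (y0 - t) * (x0 $ i + integral {y0..t} (G i))" if "y0 \<le> t" for t i
  proof (rule LIMSEQ_unique)
    show "(\<lambda>m. picard y0 (Suc m) t $ i) \<longlonglongrightarrow> U t $ i"
      using conv[OF that, of i] by (rule LIMSEQ_Suc)
    have "(\<lambda>m. exp (y0 - t) *
        (x0 $ i + integral {y0..t} (\<lambda>s. exp (s - y0) * F (picard y0 m s) $ i))) \<longlonglongrightarrow>
        exp (y0 - t) * (x0 $ i + integral {y0..t} (G i))"
      using G(2)[OF that] by (intro tendsto_intros)
    then show "(\<lambda>m. picard y0 (Suc m) t $ i) \<longlonglongrightarrow> exp (y0 - t) * (x0 $ i + integral {y0..t} (G i))"
      by simp
  qed
  have U_cont: "continuous_on {y0..b} U" for b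
  proof -
    have "continuous_on {y0..b} (\<lambda>t. exp (y0 - t) * (x0 $ i + integral {y0..t} (G i)))" for i
    proof (cases "y0 \<le> b")
      case True
      then show ?thesis
        by (intro continuous_intros indefinite_integral_continuous_1 G)
    qed simp
    then have "continuous_on {y0..b} (\<lambda>t. U t $ i)" for i
      by (rule continuous_on_cong[THEN iffD1, rotated -1]) (auto simp: U_eq)
    then have "continuous_on {y0..b} (\<lambda>t. \<chi> i. U t $ i)"
      by (rule continuous_on_vec_lambda)
    then show ?thesis
      by simp
  qed
  have U_deriv: "((\<lambda>t. U t $ i) has_real_derivative rho r \<alpha> C (U t) $ i) (at t within {y0..})"
    if t: "y0 \<le> t" for t i
  proof -
    \<comment> \<open>The end \<open>t + 1\<close> keeps \<open>t\<close> off the right boundary, so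
      that only \<open>y0\<close> is one-sided.\<close>
    have "continuous_on {y0..t + 1} (G i)"
      unfolding G_def F_nth using U_cont[of "t + 1"] by (intro continuous_intros)
    then have "((\<lambda>t. integral {y0..t} (G i)) has_real_derivative G i t) (at t within {y0..t + 1})"
      by (rule integral_has_real_derivative) (use t in auto)
    moreover have "at t within {y0..t + 1} = at t within {y0..}"
      by (rule at_within_nhd[of _ "{..<t + 1}"]) auto
    ultimately have dG: "((\<lambda>t. integral {y0..t} (G i)) has_real_derivative G i t) (at t within {y0..})"
      by simp
    have "((\<lambda>t. exp (y0 - t) * (x0 $ i + integral {y0..t} (G i))) has_real_derivative
        exp (y0 - t) * G i t - exp (y0 - t) * (x0 $ i + integral {y0..t} (G i))) (at t within {y0..})"
      by (auto intro!: derivative_eq_intros dG)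
    moreover have "exp (y0 - t) * G i t = F (U t) $ i"
      by (simp add: G_def mult.assoc[symmetric] exp_add[symmetric])
    ultimately have "((\<lambda>t. exp (y0 - t) * (x0 $ i + integral {y0..t} (G i))) has_real_derivative
        rho r \<alpha> C (U t) $ i) (at t within {y0..})"
      by (simp add: rho_eq U_eq[OF t])
    then show ?thesis
      by (rule has_field_derivative_transform_within[where d = 1]) (use t in \<open>auto simp: U_eq\<close>)
  qed
  have bdd_D: "bounded (dom_D r C)"
  proof (rule bounded_subset[OF bounded_cbox])
    show "dom_D r C \<subseteq> cbox 0 (\<chi> i. real r / (real r - 1))"
      by (auto simp: dom_D_def mem_box_cart)
  qed
  \<comment> \<open>Both \<open>x0\<close> and \<open>U t\<close> lie in \<open>dom_D r C\<close>,
    so their distance is at most its diameter, the radius of \<open>ball_B\<close>.\<close>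
  have in_D: "v \<in> dom_D r C" if "0 \<le> v" "v \<le> L" for v
  proof -
    have "v \<le> upper_pt"
      using that L_least[OF upper_pt_nonneg F_upper_pt_le] by (meson order_trans)
    then show ?thesis
      by (rule dom_D_down[OF that(1) _ upper_pt(1)])
  qed
  have "flow y0 U"
    unfolding cauchy_on_def
  proof (intro conjI allI impI)
    show "U y0 = x0"
      by (simp add: vec_eq_iff U_eq)
    fix t assume "y0 \<le> t \<and> ereal t < \<infinity>"
    then have t: "y0 \<le> t"
      by simp
    show "U t \<in> ball_B r \<alpha> C"
      unfolding ball_B_def mem_cball using U_bounds[OF t] init_nonneg init_le_L
      by (intro diameter_bounded_bound[OF bdd_D] in_D) auto
    have "(U has_vector_derivative rho r \<alpha> C (U t)) (at t within {y0..})"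
      unfolding has_vector_derivative_def
    proof (subst has_derivative_componentwise_within, rule ballI)
      fix b :: "'k rvec" assume "b \<in> Basis"
      then obtain i where b: "b = axis i 1"
        by (auto simp: Basis_vec_def)
      show "((\<lambda>t. U t \<bullet> b) has_derivative (\<lambda>h. (h *\<^sub>R rho r \<alpha> C (U t)) \<bullet> b)) (at t within {y0..})"
        using U_deriv[OF t, of i]
        by (simp add: b inner_axis has_field_derivative_def mult.commute[of _ "rho r \<alpha> C (U t) $ i"])
    qed
    moreover have "{y. y0 \<le> y \<and> ereal y < \<infinity>} = {y0..}"
      by auto
    ultimately show "(U has_vector_derivative rho r \<alpha> C (U t)) (at t within {y. y0 \<le> y \<and> ereal y < \<infinity>})"
      by simp
  qed simp
  then show ?thesis
    by blast
qed


subsection \<open>The exit point\<close>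

lemma y_plus_eq: "y_plus r \<alpha> C y0 = \<infinity>"
proof -
  have "\<infinity> \<in> {T. \<exists>x. cauchy_on r \<alpha> C y0 T x}"
    using flow_exists by blast
  from Sup_upper[OF this] show ?thesis
    unfolding y_plus_def by simp
qed

text \<open>The facts on \<open>flow\<close> hold for every global solution, hence for the one
  picked by \<open>SOME\<close>.\<close>

lemma flow_cauchy_sol: "flow y0 (cauchy_sol r \<alpha> C y0)"
  using someI_ex[OF flow_exists] by (simp add: cauchy_sol_def y_plus_eq)

text \<open>The strict inequalities valid along the path define an open set inside
  \<open>set_E'\<close>. The path up to time \<open>t\<close> together with a small ball around its
  end point is connected and contains \<open>x0\<close>, so the ball belongs to the
  component.\<close>

lemma flow_in_interior:
  assumes sol: "flow y0 x" and t: "y0 \<le> t"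
  shows "x t \<in> interior (set_E r \<alpha> C)"
proof -
  define W where "W = {v. \<forall>i. 0 < v $ i \<and> v $ i < upper_pt $ i \<and> 0 < F v $ i - v $ i}"
  have W_eq: "W = (\<Inter>i. {v. 0 < v $ i} \<inter> {v. v $ i < upper_pt $ i} \<inter> {v. 0 < F v $ i - v $ i})"
    by (auto simp: W_def)
  have "open W"
    unfolding W_eq F_nth by (intro open_INT finite ballI open_Int open_Collect_less continuous_intros)
  have "W \<subseteq> set_E' r \<alpha> C"
  proof
    fix v assume v: "v \<in> W"
    then have "0 \<le> v" "v \<le> upper_pt"
      by (auto simp: W_def less_eq_vec_def intro: less_imp_le)
    then have "v \<in> dom_D r C"
      using upper_pt(1) by (rule dom_D_down)
    then show "v \<in> set_E' r \<alpha> C"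
      using v by (auto simp: set_E'_def W_def rho_eq intro: less_imp_le)
  qed
  have xW: "x s \<in> W" if "y0 \<le> s" for s
  proof -
    have "0 < x s $ i" "x s $ i < upper_pt $ i" "0 < F (x s) $ i - x s $ i" for i
      using flow_ge_init[OF sol that] init_pos[of i] flow_le_L[OF sol that] L_less_upper_pt[of i]
        flow_rho_pos[OF sol that, of i]
      by (auto simp: less_eq_vec_def rho_eq intro: less_le_trans le_less_trans)
    then show ?thesis
      by (simp add: W_def)
  qed
  obtain e where e: "0 < e" "ball (x t) e \<subseteq> W"
    using \<open>open W\<close> xW[OF t] open_contains_ball by blast
  let ?T = "x ` {y0..t} \<union> ball (x t) e"
  have "connected (x ` {y0..t})"
    by (intro connected_continuous_image continuous_on_subset[OF flow_cont[OF sol]]) auto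
  moreover have "x t \<in> x ` {y0..t} \<inter> ball (x t) e"
    using t e by auto
  ultimately have "connected ?T"
    by (intro connected_Un) auto
  moreover have "x0 \<in> ?T"
    using t flow_init[OF sol] by force
  moreover have "?T \<subseteq> set_E' r \<alpha> C"
    using xW e \<open>W \<subseteq> set_E' r \<alpha> C\<close> by auto
  ultimately have "?T \<subseteq> connected_component_set (set_E' r \<alpha> C) x0"
    by (intro connected_component_maximal)
  then have "ball (x t) e \<subseteq> set_E r \<alpha> C"
    unfolding set_E_def using closure_subset by fastforce
  then show ?thesis
    using e by (intro interiorI[of "ball (x t) e"]) auto
qed

lemma x_exit_eq: "x_exit r \<alpha> C y0 = L"
proof -
  have empty: "{y. y0 < y \<and> ereal y < y_plus r \<alpha> C y0 \<and> cauchy_sol r \<alpha> C y0 y \<notin> interior (set_E r \<alpha> C)} = {}"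
    using flow_in_interior[OF flow_cauchy_sol] by auto
  have "y_exit r \<alpha> C y0 = \<infinity>"
    unfolding y_exit_def empty by (simp add: top_ereal_def)
  then show ?thesis
    unfolding x_exit_def using tendsto_Lim[OF _ flow_tendsto[OF flow_cauchy_sol]] by simp
qed

end


subsection \<open>Asymptotics of the scaling\<close>

lemma sum_columns:
  fixes q :: "'k::finite \<Rightarrow> 'k \<Rightarrow> real"
  shows "(\<Sum>(j, l)\<in>(SIGMA j:UNIV. {..<t j}). q j i) = (\<Sum>j\<in>UNIV. real (t j) * q j i)"
  by (subst sum.Sigma[symmetric]) auto

lemma hit_prob_le:
  fixes q :: "'k::finite \<Rightarrow> 'k \<Rightarrow> real"
  assumes "\<And>j. 0 \<le> q j i \<and> q j i \<le> 1"
  shows "hit_prob q t i m \<le> (\<Sum>j\<in>UNIV. real (t j) * q j i) ^ m / fact m"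
proof -
  have "hit_prob q t i m \<le> (\<Sum>(j, l)\<in>(SIGMA j:UNIV. {..<t j}). q j i) ^ m / fact m"
    unfolding hit_prob_def by (rule bern_tail_le) (use assms in auto)
  then show ?thesis
    by (simp only: sum_columns)
qed

lemma hit_prob_ge:
  fixes q :: "'k::finite \<Rightarrow> 'k \<Rightarrow> real"
  assumes "\<And>j. 0 \<le> q j i \<and> q j i \<le> \<delta>" "\<delta> \<le> 1" and s: "s = (\<Sum>j\<in>UNIV. real (t j) * q j i)" "s \<le> 1"
  shows "(1 - s) * max 0 (s - real m * \<delta>) ^ m / fact m \<le> hit_prob q t i m"
proof -
  have "0 \<le> \<delta>"
    using assms(1) order_trans by blast
  then show ?thesis
    unfolding hit_prob_def s(1) sum_columns[symmetric]
    by (intro bern_tail_ge) (use assms in \<open>auto simp: sum_columns\<close>)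
qed

text \<open>\<open>exp y \<ge> (y / k) ^ k\<close> with \<open>k\<close> so large that
  \<open>\<delta> * k > 2\<close> bounds the terms by a summable power of \<open>n\<close>.\<close>

lemma summable_exp_neg_powr:
  fixes \<kappa> \<delta> :: real
  assumes "0 < \<kappa>" "0 < \<delta>"
  shows "summable (\<lambda>n. exp (- \<kappa> * real n powr \<delta>))"
proof -
  obtain k :: nat where k: "2 / \<delta> < real k"
    using reals_Archimedean2 by blast
  then have k0: "0 < k" "2 < \<delta> * real k"
    using assms by (auto simp: field_simps intro: gr0I)
  have "exp (- \<kappa> * real n powr \<delta>) \<le> (real k / \<kappa>) ^ k * real n powr (- (\<delta> * real k))" if "n \<ge> 1" for n
  proof -
    let ?y = "\<kappa> * real n powr \<delta>"
    have y: "0 < ?y"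
      using assms that by simp
    have "(?y / real k) ^ k \<le> (1 + ?y / real k) ^ k"
      using y by (intro power_mono) auto
    also have "\<dots> \<le> exp ?y"
      using y k0 by (intro exp_ge_one_plus_x_over_n_power_n) auto
    finally have "exp (- ?y) \<le> inverse ((?y / real k) ^ k)"
      unfolding exp_minus using y k0 by (intro le_imp_inverse_le) auto
    also have "\<dots> = (real k / \<kappa>) ^ k * inverse ((real n powr \<delta>) ^ k)"
      by (simp add: power_mult_distrib power_divide field_simps)
    also have "(real n powr \<delta>) ^ k = real n powr (\<delta> * real k)"
      using that by (simp add: powr_powr[symmetric] powr_realpow)
    finally show ?thesis
      by (simp add: powr_minus)
  qed
  then have "\<forall>\<^sub>F n in sequentially. norm (exp (- \<kappa> * real n powr \<delta>)) \<le>
      (real k / \<kappa>) ^ k * real n powr (- (\<delta> * real k))"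
    unfolding eventually_sequentially by (intro exI[of _ 1]) simp
  moreover have "summable (\<lambda>n. (real k / \<kappa>) ^ k * real n powr (- (\<delta> * real k)))"
    using k0 by (intro summable_mult) (simp add: summable_real_powr_iff)
  ultimately show ?thesis
    by (rule summable_comparison_test_ev)
qed

lemma powr_root_cancel:
  fixes x :: real
  assumes "0 < x" "r \<ge> 2"
  shows "(x powr (1 / (real r - 1))) ^ (r - 1) = x"
  using assms by (simp add: powr_realpow[symmetric] powr_powr of_nat_diff)

text \<open>The hypotheses at fixed \<open>n\<close> start at \<open>CARD('k)\<close> because fewer
  nodes cannot be split into nonempty communities.\<close>

locale sbm_limit =
  fixes r :: nat and r' :: real
    and c :: "nat \<Rightarrow> nat \<Rightarrow> 'k::{finite,linorder}"
    and N a :: "nat \<Rightarrow> 'k \<Rightarrow> nat"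
    and q :: "nat \<Rightarrow> 'k \<Rightarrow> 'k \<Rightarrow> real"
    and \<nu> \<mu> \<gamma> :: "'k \<Rightarrow> 'k \<Rightarrow> real"
    and \<alpha> :: "'k \<Rightarrow> real"
  assumes r2: "r \<ge> 2"
    and sizes: "\<And>n i. n \<ge> CARD('k) \<Longrightarrow> card (community n (c n) i) = N n i \<and> N n i \<ge> 1"
    and q_range: "\<And>n i j. n \<ge> CARD('k) \<Longrightarrow> 0 \<le> q n i j \<and> q n i j < 1 \<and> q n i j = q n j i"
    and a_range: "\<And>n i. n \<ge> CARD('k) \<Longrightarrow> a n i \<le> N n i"
    and nu: "\<And>i j. 0 < \<nu> i j \<and> (\<lambda>n. real (N n i) / real (N n j)) \<longlonglongrightarrow> \<nu> i j"
    and r': "1 < r'" "r' < real r"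
    and p_lower: "\<And>i. much_less (\<lambda>n. 1 / real (N n i)) (\<lambda>n. q n i i)"
    and p_upper: "\<And>i. less_sim (\<lambda>n. q n i i) (\<lambda>n. real (N n i) powr (- 1 / r'))"
    and q_le: "\<And>n i j. n \<ge> CARD('k) \<Longrightarrow> q n i j \<le> min (q n i i) (q n j j)"
    and gamma: "\<And>i j. 0 \<le> \<gamma> i j \<and> \<gamma> i j \<le> 1 \<and> (\<lambda>n. q n i j / q n i i) \<longlonglongrightarrow> \<gamma> i j"
    and mu: "\<And>i j. 0 < \<mu> i j \<and> (\<lambda>n. q n i i / q n j j) \<longlonglongrightarrow> \<mu> i j"
    and alpha: "\<And>i. 0 \<le> \<alpha> i \<and> (\<lambda>n. real (a n i) / crit_scale r N q n i) \<longlonglongrightarrow> \<alpha> i"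
begin

abbreviation "g n i \<equiv> crit_scale r N q n i"
abbreviation "X \<equiv> chi_mat r N q"

section \<open>Size of the communities and of the critical scale\<close>

lemma ev_large: "\<forall>\<^sub>F n in sequentially. CARD('k) \<le> n"
  by (rule eventually_ge_at_top)

lemma p_pos: "\<forall>\<^sub>F n in sequentially. 0 < q n i i"
proof -
  have "\<forall>\<^sub>F n in sequentially. q n i i \<noteq> 0"
    using p_lower[of i] by (simp add: much_less_def)
  with ev_large show ?thesis
    by eventually_elim (use q_range in \<open>auto simp: less_le\<close>)
qed

lemma sum_sizes:
  assumes "n \<ge> CARD('k)"
  shows "(\<Sum>i\<in>UNIV. N n i) = n"
proof -
  have "(\<Sum>i\<in>UNIV. N n i) = (\<Sum>i\<in>UNIV. card (community n (c n) i))"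
    using sizes[OF assms] by simp
  also have "\<dots> = card (\<Union>i. community n (c n) i)"
    by (rule card_UN_disjoint[symmetric]) (auto simp: community_def)
  also have "(\<Union>i. community n (c n) i) = {..<n}"
    by (auto simp: community_def)
  finally show ?thesis
    by simp
qed

text \<open>\<open>n / N n i\<close> is the sum of all size ratios to community \<open>i\<close> and
  hence converges; doubling its limit leaves room for the error.\<close>

lemma N_linear: "\<exists>s>0. \<forall>\<^sub>F n in sequentially. s * real n \<le> real (N n i)"
proof -
  have "(\<lambda>n. \<Sum>j\<in>UNIV. real (N n j) / real (N n i)) \<longlonglongrightarrow> (\<Sum>j\<in>UNIV. \<nu> j i)"
    using nu by (intro tendsto_sum) blast
  moreover have S: "0 < (\<Sum>j\<in>UNIV. \<nu> j i)" (is "0 < ?S")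
    using nu by (intro sum_pos) auto
  ultimately have "\<forall>\<^sub>F n in sequentially. (\<Sum>j\<in>UNIV. real (N n j) / real (N n i)) < 2 * ?S"
    by (intro order_tendstoD) auto
  with ev_large have "\<forall>\<^sub>F n in sequentially. 1 / (2 * ?S) * real n \<le> real (N n i)"
  proof eventually_elim
    case (elim n)
    have "(\<Sum>j\<in>UNIV. real (N n j) / real (N n i)) = real n / real (N n i)"
      using sum_sizes[OF elim(1)] by (simp add: sum_divide_distrib[symmetric] of_nat_sum[symmetric])
    moreover have "0 < real (N n i)"
      using sizes[OF elim(1), of i] by simp
    ultimately have "real n < 2 * ?S * real (N n i)"
      using elim(2) by (simp only: pos_divide_less_eq)
    then show ?case
      using S by (simp add: field_simps)
  qed
  then show ?thesis
    using S by (intro exI[of _ "1 / (2 * ?S)"]) simp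
qed

lemma N_pos: "\<forall>\<^sub>F n in sequentially. 0 < N n i"
  using ev_large
proof eventually_elim
  case (elim n)
  then show ?case
    using sizes[of n i] by simp
qed

lemma g_pos: "\<forall>\<^sub>F n in sequentially. 0 < g n i"
  using p_pos[of i] N_pos[of i] by eventually_elim (use r2 in \<open>simp add: crit_scale_def\<close>)

lemma g_pos_all: "\<forall>\<^sub>F n in sequentially. \<forall>i. 0 < g n i"
  by (intro eventually_all_finite g_pos)

lemma Np_infinity: "(\<lambda>n. 1 / (real (N n i) * q n i i)) \<longlonglongrightarrow> 0"
  using p_lower[of i] by (simp add: much_less_def field_simps)

text \<open>The mean number of neighbours in a set of critical size depends on the density only
  through \<open>N p\<close>, so it tends to \<open>0\<close> as \<open>N p\<close> tends to
  infinity.\<close>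

lemma gp_eq:
  assumes "0 < q n i i" "0 < N n i"
  shows "g n i * q n i i = (1 - 1 / real r) * (fact (r - 1) * (1 / (real (N n i) * q n i i))) powr (1 / (real r - 1))"
proof -
  have "q n i i = (q n i i powr (real r - 1)) powr (1 / (real r - 1))"
    using assms r2 by (simp add: powr_powr)
  then have "g n i * q n i i = (1 - 1 / real r) *
      ((fact (r - 1) / (real (N n i) * q n i i ^ r)) powr (1 / (real r - 1)) *
        (q n i i powr (real r - 1)) powr (1 / (real r - 1)))"
    by (simp add: crit_scale_def)
  also have "\<dots> = (1 - 1 / real r) *
      (fact (r - 1) / (real (N n i) * q n i i ^ r) * q n i i powr (real r - 1)) powr (1 / (real r - 1))"
    using assms by (subst powr_mult) auto
  also have "q n i i powr (real r - 1) = q n i i ^ r / q n i i"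
    using assms by (simp add: powr_diff powr_realpow)
  also have "fact (r - 1) / (real (N n i) * q n i i ^ r) * (q n i i ^ r / q n i i) =
      fact (r - 1) * (1 / (real (N n i) * q n i i))"
    using assms by simp
  finally show ?thesis .
qed

lemma gp_tendsto: "(\<lambda>n. g n i * q n i i) \<longlonglongrightarrow> 0"
proof -
  have "(\<lambda>n. fact (r - 1) * (1 / (real (N n i) * q n i i))) \<longlonglongrightarrow> fact (r - 1) * 0"
    by (intro tendsto_mult_left Np_infinity)
  moreover have "\<forall>\<^sub>F n in sequentially. 0 \<le> fact (r - 1) * (1 / (real (N n i) * q n i i))"
    using p_pos[of i] by eventually_elim simp
  ultimately have "(\<lambda>n. (fact (r - 1) * (1 / (real (N n i) * q n i i))) powr (1 / (real r - 1))) \<longlonglongrightarrow>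
      0 powr (1 / (real r - 1))"
    using r2 by (intro tendsto_powr2 tendsto_const) auto
  then have "(\<lambda>n. (1 - 1 / real r) *
      (fact (r - 1) * (1 / (real (N n i) * q n i i))) powr (1 / (real r - 1))) \<longlonglongrightarrow> 0"
    by (intro tendsto_mult_right_zero) simp
  then show ?thesis
  proof (rule Lim_transform_eventually)
    show "\<forall>\<^sub>F n in sequentially. (1 - 1 / real r) *
      (fact (r - 1) * (1 / (real (N n i) * q n i i))) powr (1 / (real r - 1)) = g n i * q n i i"
      using p_pos[of i] N_pos[of i] by eventually_elim (simp add: gp_eq)
  qed
qed

lemma g_over_N: "(\<lambda>n. g n i / real (N n i)) \<longlonglongrightarrow> 0"
proof -
  have "(\<lambda>n. (g n i * q n i i) * (1 / (real (N n i) * q n i i))) \<longlonglongrightarrow> 0"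
    using tendsto_mult[OF gp_tendsto[of i] Np_infinity[of i]] by (simp only: mult_zero_left)
  then show ?thesis
  proof (rule Lim_transform_eventually)
    show "\<forall>\<^sub>F n in sequentially. (g n i * q n i i) * (1 / (real (N n i) * q n i i)) = g n i / real (N n i)"
      using p_pos[of i] by eventually_elim simp
  qed
qed

lemma a_over_N: "(\<lambda>n. real (a n i) / real (N n i)) \<longlonglongrightarrow> 0"
proof -
  have "(\<lambda>n. real (a n i) / g n i * (g n i / real (N n i))) \<longlonglongrightarrow> 0"
    using tendsto_mult[OF conjunct2[OF alpha[of i]] g_over_N[of i]] by (simp only: mult_zero_right)
  then show ?thesis
  proof (rule Lim_transform_eventually)
    show "\<forall>\<^sub>F n in sequentially. real (a n i) / g n i * (g n i / real (N n i)) = real (a n i) / real (N n i)"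
      using g_pos[of i] by eventually_elim simp
  qed
qed

text \<open>Eventually \<open>N * p ^ r \<le> 2 ^ r * N powr (- d)\<close> with
  \<open>d = r / r' - 1 > 0\<close>, and \<open>N\<close> is linear in \<open>n\<close>; the root
  leaves the exponent \<open>d / (r - 1)\<close>. The factor \<open>2\<close> covers both
  alternatives of \<open>less_sim\<close>, a ratio tending to \<open>0\<close> or to
  \<open>1\<close>.\<close>

lemma g_polynomial: "\<exists>\<kappa>>0. \<exists>\<delta>>0. \<forall>\<^sub>F n in sequentially. \<kappa> * real n powr \<delta> \<le> g n i"
proof -
  obtain s where s: "s > 0" "\<forall>\<^sub>F n in sequentially. s * real n \<le> real (N n i)"
    using N_linear by blast
  define d where "d = real r / r' - 1"
  define b where "b = 1 / (real r - 1)"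
  have d: "0 < d" and b: "0 < b"
    using r' r2 by (auto simp: d_def b_def)
  have "\<forall>\<^sub>F n in sequentially. q n i i / real (N n i) powr (- 1 / r') < 2"
    using p_upper[of i] unfolding less_sim_def much_less_def by (auto dest: order_tendstoD(2)[where a = 2])
  with p_pos[of i] N_pos[of i] s(2)
  have "\<forall>\<^sub>F n in sequentially. (1 - 1 / real r) * (s powr d / 2 ^ r) powr b * real n powr (d * b) \<le> g n i"
  proof eventually_elim
    case (elim n)
    have Npos: "0 < real (N n i)"
      using elim(2) by simp
    have "q n i i \<le> 2 * real (N n i) powr (- 1 / r')"
      using elim(4) Npos by (simp add: pos_divide_less_eq)
    then have "q n i i ^ r \<le> (2 * real (N n i) powr (- 1 / r')) ^ r"
      using elim(1) by (intro power_mono) auto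
    also have "\<dots> = 2 ^ r * real (N n i) powr (- real r / r')"
      using Npos by (simp add: power_mult_distrib powr_powr flip: powr_realpow)
    finally have "real (N n i) * q n i i ^ r \<le> 2 ^ r * (real (N n i) * real (N n i) powr (- real r / r'))"
      using Npos by (simp add: mult.left_commute)
    also have "real (N n i) * real (N n i) powr (- real r / r') = real (N n i) powr (- d)"
      using Npos by (simp add: d_def powr_mult_base)
    finally have "1 / (2 ^ r * real (N n i) powr (- d)) \<le> 1 / (real (N n i) * q n i i ^ r)"
      using Npos elim(1) by (intro divide_left_mono) auto
    also have "\<dots> \<le> fact (r - 1) / (real (N n i) * q n i i ^ r)"
      using Npos elim(1) by (intro divide_right_mono) auto
    finally have "real (N n i) powr d / 2 ^ r \<le> fact (r - 1) / (real (N n i) * q n i i ^ r)"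
      using Npos by (simp add: powr_minus field_simps)
    moreover have "(s * real n) powr d / 2 ^ r \<le> real (N n i) powr d / 2 ^ r"
      using elim(3) s(1) d by (intro divide_right_mono powr_mono2) auto
    ultimately have "(s * real n) powr d / 2 ^ r \<le> fact (r - 1) / (real (N n i) * q n i i ^ r)"
      by linarith
    then have "((s powr d / 2 ^ r) * real n powr d) powr b \<le> (fact (r - 1) / (real (N n i) * q n i i ^ r)) powr b"
      using s(1) b by (intro powr_mono2) (auto simp: powr_mult)
    also have "((s powr d / 2 ^ r) * real n powr d) powr b = (s powr d / 2 ^ r) powr b * real n powr (d * b)"
      using s(1) by (subst powr_mult) (auto simp: powr_powr)
    finally show ?case
      using r2 by (simp add: crit_scale_def b_def mult.assoc mult_left_mono)
  qed
  moreover have "0 < (1 - 1 / real r) * (s powr d / 2 ^ r) powr b"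
    using r2 s(1) by simp
  ultimately show ?thesis
    using d b by (intro exI[of _ "(1 - 1 / real r) * (s powr d / 2 ^ r) powr b"] conjI
        exI[of _ "d * b"]) auto
qed

lemma summable_exp_scale:
  assumes "0 < \<kappa>"
  shows "summable (\<lambda>n. exp (- \<kappa> * g n i))"
proof -
  obtain s \<delta> where s: "0 < s" "0 < \<delta>" "\<forall>\<^sub>F n in sequentially. s * real n powr \<delta> \<le> g n i"
    using g_polynomial by blast
  have "\<forall>\<^sub>F n in sequentially. norm (exp (- \<kappa> * g n i)) \<le> exp (- (\<kappa> * s) * real n powr \<delta>)"
    using s(3) by eventually_elim (use assms in \<open>simp add: mult.assoc\<close>)
  then show ?thesis
    by (rule summable_comparison_test_ev) (use summable_exp_neg_powr assms s in simp)
qed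

lemma g_at_top: "filterlim (\<lambda>n. g n i) at_top sequentially"
proof -
  obtain s \<delta> where s: "0 < s" "0 < \<delta>" "\<forall>\<^sub>F n in sequentially. s * real n powr \<delta> \<le> g n i"
    using g_polynomial by blast
  have "filterlim (\<lambda>n. exp (\<delta> * ln (real n))) at_top sequentially"
    using s(2) by (intro filterlim_compose[OF exp_at_top] filterlim_tendsto_pos_mult_at_top[OF tendsto_const]
        filterlim_compose[OF ln_at_top filterlim_real_sequentially])
  moreover have "\<forall>\<^sub>F n in sequentially. exp (\<delta> * ln (real n)) \<le> real n powr \<delta>"
    using eventually_ge_at_top[of 1] by eventually_elim (simp add: powr_def)
  ultimately have "filterlim (\<lambda>n. real n powr \<delta>) at_top sequentially"
    by (rule filterlim_at_top_mono)
  then have "filterlim (\<lambda>n. s * real n powr \<delta>) at_top sequentially"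
    using s(1) by (intro filterlim_tendsto_pos_mult_at_top[OF tendsto_const])
  then show ?thesis
    using s(3) by (rule filterlim_at_top_mono)
qed

lemma inverse_g: "(\<lambda>n. b / g n i) \<longlonglongrightarrow> 0"
  by (rule tendsto_divide_0[OF tendsto_const filterlim_at_top_imp_at_infinity[OF g_at_top]])

text \<open>The limit of \<open>g n j / g n i\<close>; for \<open>i = fst_idx\<close> it is the
  weight of community \<open>j\<close> in \<open>x_star\<close>.\<close>

definition ratio :: "'k \<Rightarrow> 'k \<Rightarrow> real" where
  "ratio i j = (\<nu> i j * \<mu> i j ^ r) powr (1 / (real r - 1))"

lemma ratio_pos: "0 < ratio i j"
  using nu[of i j] mu[of i j] by (simp add: ratio_def less_imp_neq[THEN not_sym])

lemma g_ratio: "(\<lambda>n. g n j / g n i) \<longlonglongrightarrow> ratio i j"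
proof -
  have "(\<lambda>n. (real (N n i) / real (N n j)) * (q n i i / q n j j) ^ r) \<longlonglongrightarrow> \<nu> i j * \<mu> i j ^ r"
    using nu mu by (intro tendsto_mult tendsto_power) auto
  then have "(\<lambda>n. ((real (N n i) / real (N n j)) * (q n i i / q n j j) ^ r) powr (1 / (real r - 1))) \<longlonglongrightarrow> ratio i j"
    unfolding ratio_def using nu[of i j] mu[of i j] by (intro tendsto_powr tendsto_const) auto
  then show ?thesis
  proof (rule Lim_transform_eventually)
    show "\<forall>\<^sub>F n in sequentially.
        ((real (N n i) / real (N n j)) * (q n i i / q n j j) ^ r) powr (1 / (real r - 1)) = g n j / g n i"
      using p_pos[of i] p_pos[of j] N_pos[of i] N_pos[of j]
    proof eventually_elim
      case (elim n)
      have "g n j / g n i = (fact (r - 1) / (real (N n j) * q n j j ^ r)) powr (1 / (real r - 1)) /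
          (fact (r - 1) / (real (N n i) * q n i i ^ r)) powr (1 / (real r - 1))"
        using r2 by (simp add: crit_scale_def)
      also have "\<dots> = ((fact (r - 1) / (real (N n j) * q n j j ^ r)) /
          (fact (r - 1) / (real (N n i) * q n i i ^ r))) powr (1 / (real r - 1))"
        using elim by (subst powr_divide) auto
      also have "(fact (r - 1) / (real (N n j) * q n j j ^ r)) / (fact (r - 1) / (real (N n i) * q n i i ^ r)) =
          (real (N n i) / real (N n j)) * (q n i i / q n j j) ^ r"
        by (simp add: power_divide)
      finally show ?case
        by simp
    qed
  qed
qed

lemma X_tendsto: "(\<lambda>n. (q n i j * g n j) / (q n i i * g n i)) \<longlonglongrightarrow> \<gamma> i j * ratio i j"
proof -
  have "(\<lambda>n. (q n i j / q n i i) * (g n j / g n i)) \<longlonglongrightarrow> \<gamma> i j * ratio i j"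
    using gamma by (intro tendsto_mult g_ratio) blast
  then show ?thesis
    by simp
qed

lemma X_nth: "X $ i $ j = \<gamma> i j * ratio i j"
  using limI[OF X_tendsto[of i j]] by (simp add: chi_mat_def)

lemma X_nonneg: "0 \<le> X $ i $ j"
  using gamma[of i j] ratio_pos[of i j] by (simp add: X_nth)

text \<open>\<open>q\<close> is symmetric, and the two normalisations differ by a factor converging
  to \<open>\<mu> i j > 0\<close>; so
  \<open>\<gamma> j i = \<gamma> i j * \<mu> i j\<close>.\<close>

lemma X_sym:
  assumes "0 < X $ i $ j"
  shows "0 < X $ j $ i"
proof -
  have "0 < \<gamma> i j"
    using assms ratio_pos[of i j] by (simp add: X_nth zero_less_mult_iff)
  have "(\<lambda>n. q n i j / q n i i * (q n i i / q n j j)) \<longlonglongrightarrow> \<gamma> i j * \<mu> i j"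
    using gamma mu by (intro tendsto_mult) auto
  moreover have "\<forall>\<^sub>F n in sequentially. q n i j / q n i i * (q n i i / q n j j) = q n j i / q n j j"
    using ev_large p_pos[of i] by eventually_elim (use q_range in auto)
  ultimately have "(\<lambda>n. q n j i / q n j j) \<longlonglongrightarrow> \<gamma> i j * \<mu> i j"
    by (rule Lim_transform_eventually)
  moreover have "(\<lambda>n. q n j i / q n j j) \<longlonglongrightarrow> \<gamma> j i"
    using gamma by blast
  ultimately have "\<gamma> j i = \<gamma> i j * \<mu> i j"
    by (intro LIMSEQ_unique)
  then show ?thesis
    using \<open>0 < \<gamma> i j\<close> mu[of i j] ratio_pos[of j i] by (simp add: X_nth)
qed


subsection \<open>The number of nodes activated by a given set\<close>

text \<open>The equation behind the critical scale: to leading order the left-hand side is the mean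
  number of nodes with \<open>r\<close> neighbours in a set of size \<open>g\<close>. The
  coefficient in \<open>rho\<close> originates here.\<close>

lemma scale_identity:
  assumes "0 < q n i i" "0 < N n i"
  shows "real (N n i) * (q n i i * g n i) ^ r / fact r = coef r * g n i"
proof -
  define K where "K = fact (r - 1) / (real (N n i) * q n i i ^ r)"
  have K: "0 < K"
    using assms by (simp add: K_def)
  have "g n i ^ (r - 1) = (1 - 1 / real r) ^ (r - 1) * K"
    using powr_root_cancel[OF K r2] by (simp add: crit_scale_def K_def power_mult_distrib)
  moreover have "(q n i i * g n i) ^ r = q n i i ^ r * (g n i ^ (r - 1) * g n i)"
    using r2 power_minus_mult[of r "g n i"] by (simp add: power_mult_distrib)
  moreover have "real (N n i) * q n i i ^ r * K = fact (r - 1)"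
    using assms by (simp add: K_def)
  ultimately have "real (N n i) * (q n i i * g n i) ^ r = (1 - 1 / real r) ^ (r - 1) * fact (r - 1) * g n i"
    by (simp add: mult_ac)
  moreover have "(fact r :: real) = real r * fact (r - 1)"
    using r2 by (simp add: fact_reduce)
  ultimately show ?thesis
    using r2 by (simp add: coef_def)
qed

definition lvl :: "'k rvec \<Rightarrow> nat \<Rightarrow> 'k \<Rightarrow> nat" where
  "lvl w n i = nat \<lfloor>w $ i * g n i\<rfloor>"

lemma lvl_le: "0 \<le> w $ i \<Longrightarrow> 0 < g n i \<Longrightarrow> real (lvl w n i) \<le> w $ i * g n i"
  unfolding lvl_def by (simp add: of_nat_nat)

lemma lvl_ge: "w $ i * g n i - 1 \<le> real (lvl w n i)"
  unfolding lvl_def by linarith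

lemma lvl_tendsto:
  assumes "0 \<le> w $ i"
  shows "(\<lambda>n. real (lvl w n i) / g n i) \<longlonglongrightarrow> w $ i"
proof (rule tendsto_sandwich)
  show "\<forall>\<^sub>F n in sequentially. w $ i - 1 / g n i \<le> real (lvl w n i) / g n i"
    using g_pos[of i]
  proof eventually_elim
    case (elim n)
    have "(w $ i * g n i - 1) / g n i \<le> real (lvl w n i) / g n i"
      using elim by (intro divide_right_mono lvl_ge) simp
    then show ?case
      using elim by (simp add: diff_divide_distrib)
  qed
  show "\<forall>\<^sub>F n in sequentially. real (lvl w n i) / g n i \<le> w $ i"
    using g_pos[of i] by eventually_elim (use lvl_le[OF assms] in \<open>simp add: field_simps\<close>)
  show "(\<lambda>n. w $ i - 1 / g n i) \<longlonglongrightarrow> w $ i"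
    using tendsto_diff[OF tendsto_const inverse_g[of 1 i]] by simp
qed simp

text \<open>Sandwich between \<open>hit_prob_le\<close> and \<open>hit_prob_ge\<close>. The bounds
  agree in the limit because the mean \<open>s\<close> tends to \<open>0\<close> and the shift
  \<open>r * \<delta>\<close> with \<open>\<delta> = q n i i\<close>, admissible by
  \<open>q_le\<close>, is only \<open>r / g n i\<close> in units of
  \<open>q n i i * g n i\<close>.\<close>

lemma hit_tendsto:
  assumes w: "\<And>i. 0 \<le> w $ i"
  shows "(\<lambda>n. real (N n i) * hit_prob (q n) (lvl w n) i r / g n i) \<longlonglongrightarrow>
    coef r * (\<Sum>j\<in>UNIV. X $ i $ j * w $ j) ^ r"
proof (rule tendsto_sandwich)
  define s where "s n = (\<Sum>j\<in>UNIV. real (lvl w n j) * q n j i)" for n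
  define \<sigma> where "\<sigma> n = s n / (q n i i * g n i)" for n
  let ?l = "\<Sum>j\<in>UNIV. X $ i $ j * w $ j"
  have "(\<lambda>n. \<Sum>j\<in>UNIV. (q n i j * g n j) / (q n i i * g n i) * (real (lvl w n j) / g n j)) \<longlonglongrightarrow> ?l"
    using w X_tendsto[of i] by (intro tendsto_sum tendsto_mult lvl_tendsto) (auto simp: X_nth)
  moreover have "\<forall>\<^sub>F n in sequentially.
      (\<Sum>j\<in>UNIV. (q n i j * g n j) / (q n i i * g n i) * (real (lvl w n j) / g n j)) = \<sigma> n"
    using ev_large g_pos_all
  proof eventually_elim
    case (elim n)
    have "(q n i j * g n j) / (q n i i * g n i) * (real (lvl w n j) / g n j) =
        real (lvl w n j) * q n j i / (q n i i * g n i)" for j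
    proof -
      have "q n i j = q n j i" "g n j \<noteq> 0"
        using q_range[OF elim(1)] elim(2)[rule_format, of j] by auto
      then show ?thesis
        by simp
    qed
    then show ?case
      by (simp add: \<sigma>_def s_def sum_divide_distrib)
  qed
  ultimately have \<sigma>: "\<sigma> \<longlonglongrightarrow> ?l"
    by (rule Lim_transform_eventually)
  have "(\<lambda>n. \<sigma> n * (g n i * q n i i)) \<longlonglongrightarrow> ?l * 0"
    by (intro tendsto_mult \<sigma> gp_tendsto)
  moreover have "\<forall>\<^sub>F n in sequentially. \<sigma> n * (g n i * q n i i) = s n"
    using p_pos[of i] g_pos[of i] by eventually_elim (simp add: \<sigma>_def)
  ultimately have s: "s \<longlonglongrightarrow> 0"
    using Lim_transform_eventually by fastforce
  then have s1: "\<forall>\<^sub>F n in sequentially. s n \<le> 1"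
    by (auto dest: order_tendstoD(2)[where a = 1] elim!: eventually_mono)
  show "\<forall>\<^sub>F n in sequentially. real (N n i) * hit_prob (q n) (lvl w n) i r / g n i \<le> coef r * \<sigma> n ^ r"
    using ev_large p_pos[of i] g_pos[of i] N_pos[of i]
  proof eventually_elim
    case (elim n)
    have "hit_prob (q n) (lvl w n) i r \<le> s n ^ r / fact r"
      unfolding s_def using q_range[OF elim(1)] by (intro hit_prob_le) (auto intro: less_imp_le)
    then have "real (N n i) * hit_prob (q n) (lvl w n) i r / g n i \<le> real (N n i) * (s n ^ r / fact r) / g n i"
      using elim by (intro divide_right_mono mult_left_mono) auto
    also have "s n = \<sigma> n * (q n i i * g n i)"
      using elim by (simp add: \<sigma>_def)
    also have "real (N n i) * ((\<sigma> n * (q n i i * g n i)) ^ r / fact r) / g n i =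
        \<sigma> n ^ r * (real (N n i) * (q n i i * g n i) ^ r / fact r) / g n i"
      by (simp add: power_mult_distrib)
    also have "\<dots> = coef r * \<sigma> n ^ r"
      using elim by (subst scale_identity) auto
    finally show ?case .
  qed
  show "\<forall>\<^sub>F n in sequentially. (1 - s n) * (coef r * max 0 (\<sigma> n - real r / g n i) ^ r) \<le>
      real (N n i) * hit_prob (q n) (lvl w n) i r / g n i"
    using ev_large p_pos[of i] g_pos[of i] N_pos[of i] s1
  proof eventually_elim
    case (elim n)
    define M where "M = max 0 (\<sigma> n - real r / g n i)"
    have "max 0 (s n - real r * q n i i) = (q n i i * g n i) * M"
    proof -
      have "s n - real r * q n i i = (q n i i * g n i) * (\<sigma> n - real r / g n i)"
        using elim by (simp add: \<sigma>_def field_simps)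
      then show ?thesis
        using elim by (simp add: M_def max_mult_distrib_left)
    qed
    moreover have "(1 - s n) * max 0 (s n - real r * q n i i) ^ r / fact r \<le> hit_prob (q n) (lvl w n) i r"
      using q_range[OF elim(1)] q_le[OF elim(1)] elim(5)
      by (intro hit_prob_ge) (auto simp: s_def intro: less_imp_le)
    ultimately have "real (N n i) * ((1 - s n) * ((q n i i * g n i) * M) ^ r / fact r) / g n i \<le>
        real (N n i) * hit_prob (q n) (lvl w n) i r / g n i"
      using elim by (intro divide_right_mono mult_left_mono) auto
    moreover have "real (N n i) * ((1 - s n) * ((q n i i * g n i) * M) ^ r / fact r) / g n i =
        (1 - s n) * M ^ r * (real (N n i) * (q n i i * g n i) ^ r / fact r) / g n i"
      by (simp add: power_mult_distrib)
    moreover have "\<dots> = (1 - s n) * (coef r * M ^ r)"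
      using elim by (subst scale_identity) auto
    ultimately show ?case
      unfolding M_def by linarith
  qed
  show "(\<lambda>n. coef r * \<sigma> n ^ r) \<longlonglongrightarrow> coef r * ?l ^ r"
    by (intro tendsto_intros \<sigma>)
  have "0 \<le> ?l"
    using X_nonneg w by (intro sum_nonneg) simp
  moreover have "(\<lambda>n. (1 - s n) * (coef r * max 0 (\<sigma> n - real r / g n i) ^ r)) \<longlonglongrightarrow>
      (1 - 0) * (coef r * max 0 (?l - 0) ^ r)"
    by (intro tendsto_intros tendsto_max \<sigma> s inverse_g)
  ultimately show "(\<lambda>n. (1 - s n) * (coef r * max 0 (\<sigma> n - real r / g n i) ^ r)) \<longlonglongrightarrow> coef r * ?l ^ r"
    by (simp add: max_absorb2)
qed

end


subsection \<open>Almost sure bounds\<close>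

text \<open>The expression vanishes at \<open>\<beta> = 0\<close> and has derivative
  \<open>B - A < 0\<close> there. The eventual form allows one common \<open>\<beta>\<close> for
  finitely many communities.\<close>

lemma small_exponent_upper:
  fixes A B :: real
  assumes "B < A"
  shows "\<forall>\<^sub>F \<beta> in at_right 0. - \<beta> * A + (exp \<beta> - 1) * B < 0"
proof -
  have "((\<lambda>\<beta>. - \<beta> * A + (exp \<beta> - 1) * B) has_real_derivative - A + B) (at 0)"
    by (auto intro!: derivative_eq_intros)
  from DERIV_neg_dec_right[OF this] assms obtain d where
    "d > 0" "\<And>h. 0 < h \<Longrightarrow> h < d \<Longrightarrow> - h * A + (exp h - 1) * B < 0"
    by auto
  then show ?thesis
    unfolding eventually_at_right_field by blast
qed

lemma small_exponent_lower:
  fixes A B :: real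
  assumes "B < A"
  shows "\<forall>\<^sub>F \<beta> in at_right 0. \<beta> * B - (1 - exp (- \<beta>)) * A < 0"
proof -
  have "((\<lambda>\<beta>. \<beta> * B - (1 - exp (- \<beta>)) * A) has_real_derivative B - A) (at 0)"
    by (auto intro!: derivative_eq_intros)
  from DERIV_neg_dec_right[OF this] assms obtain d where
    "d > 0" "\<And>h. 0 < h \<Longrightarrow> h < d \<Longrightarrow> h * B - (1 - exp (- h)) * A < 0"
    by auto
  then show ?thesis
    unfolding eventually_at_right_field by blast
qed

lemma eventually_at_right_0_ex:
  assumes "\<forall>\<^sub>F \<beta>::real in at_right 0. P \<beta>"
  shows "\<exists>\<beta>>0. P \<beta>"
proof -
  have "\<forall>\<^sub>F \<beta>::real in at_right 0. 0 < \<beta> \<and> P \<beta>"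
    using eventually_at_right_less assms by (rule eventually_conj)
  then show ?thesis
    using eventually_happens' trivial_limit_at_right_real by blast
qed

text \<open>The first Borel-Cantelli lemma, which suits models with an arbitrary joint law for
  different \<open>n\<close>.\<close>

lemma (in prob_space) AE_eventually_not:
  assumes sets: "\<forall>\<^sub>F n in sequentially. {\<omega> \<in> space M. P n \<omega>} \<in> sets M"
    and le: "\<forall>\<^sub>F n in sequentially. prob {\<omega> \<in> space M. P n \<omega>} \<le> b n"
    and "summable b"
  shows "AE \<omega> in M. \<forall>\<^sub>F n in sequentially. \<not> P n \<omega>"
proof -
  obtain n0 where n0: "\<And>n. n \<ge> n0 \<Longrightarrow> {\<omega> \<in> space M. P n \<omega>} \<in> sets M"
    "\<And>n. n \<ge> n0 \<Longrightarrow> prob {\<omega> \<in> space M. P n \<omega>} \<le> b n"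
    using eventually_conj[OF sets le] by (auto simp: eventually_sequentially)
  \<comment> \<open>The finitely many indices not covered by the hypotheses get empty
    events.\<close>
  define B where "B n = (if n \<ge> n0 then {\<omega> \<in> space M. P n \<omega>} else {})" for n
  have "summable (\<lambda>n. prob (B n))"
  proof (rule summable_comparison_test_ev[OF _ \<open>summable b\<close>])
    show "\<forall>\<^sub>F n in sequentially. norm (prob (B n)) \<le> b n"
      using eventually_ge_at_top[of n0] by eventually_elim (use n0 in \<open>simp add: B_def\<close>)
  qed
  then have "AE \<omega> in M. \<forall>\<^sub>F n in sequentially. \<omega> \<in> space M - B n"
    using n0 by (intro borel_cantelli_AE1) (auto simp: B_def emeasure_eq_measure)
  then show ?thesis
  proof (eventually_elim)
    case (elim \<omega>)
    then show ?case
      using eventually_ge_at_top[of n0] by eventually_elim (auto simp: B_def)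
  qed
qed

locale sbm_subcritical = sbm_limit r r' c N a q \<nu> \<mu> \<gamma> \<alpha> + prob_space M
  for M :: "'w measure" and r r' and c :: "nat \<Rightarrow> nat \<Rightarrow> 'k::{finite,linorder}" and N a q \<nu> \<mu> \<gamma> \<alpha> +
  fixes E :: "nat \<Rightarrow> 'w \<Rightarrow> (nat \<times> nat) set" and S :: "nat \<Rightarrow> 'w \<Rightarrow> nat set"
  assumes model: "\<And>n. n \<ge> CARD('k) \<Longrightarrow> sbm_with_seeds M n (c n) (q n) (a n) (E n) (S n)"
    and irred: "irreducible_mat X"
    and alpha_pos: "0 < \<alpha> fst_idx"
    and subcrit: "subcritical r \<alpha> X"
begin

sublocale sys: subcrit_system r \<alpha> X
  using r2 X_nonneg X_sym irred alpha alpha_pos subcrit by unfold_locales auto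

lemma model_facts:
  assumes "n \<ge> CARD('k)"
  shows "card (community n (c n) i) = N n i" "a n i \<le> N n i"
    "0 \<le> q n i j \<and> q n i j \<le> 1 \<and> q n i j = q n j i"
  using sizes[OF assms] a_range[OF assms] q_range[OF assms, of i j] by auto

definition act :: "nat \<Rightarrow> 'k \<Rightarrow> 'w \<Rightarrow> nat" where
  "act n i \<omega> = card {v \<in> final_active r n (E n \<omega>) (S n \<omega>). c n v = i}"

lemma exp_le_scale:
  assumes "(\<lambda>n. e n / g n i) \<longlonglongrightarrow> l" "l < 0"
  shows "\<forall>\<^sub>F n in sequentially. exp (e n) \<le> exp (- (- l / 2) * g n i)"
proof -
  have "\<forall>\<^sub>F n in sequentially. e n / g n i < l / 2"
    using assms by (intro order_tendstoD) auto
  with g_pos[of i] show ?thesis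
    by eventually_elim (simp add: pos_divide_less_eq)
qed

text \<open>Besides the seeds, on the scale \<open>g\<close>, community \<open>i\<close> is allowed
  \<open>w $ i - \<alpha> i\<close> nodes while fewer, \<open>sys.F w $ i - \<alpha> i\<close>, are
  expected. A small \<open>\<beta>\<close> turns this gap into exponents of order
  \<open>- g\<close>, hence summable tails.\<close>

lemma AE_act_le:
  assumes w: "\<And>i. 0 \<le> w $ i" and super: "\<And>i. sys.F w $ i < w $ i"
  shows "AE \<omega> in M. \<forall>\<^sub>F n in sequentially. \<forall>i. act n i \<omega> \<le> lvl w n i"
proof -
  have "\<forall>\<^sub>F \<beta> in at_right 0. \<forall>i. - \<beta> * (w $ i - \<alpha> i) + (exp \<beta> - 1) * (sys.F w $ i - \<alpha> i) < 0"
    by (intro eventually_all_finite small_exponent_upper) (use super in simp)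
  then obtain \<beta> where \<beta>: "0 < \<beta>" "\<And>i. - \<beta> * (w $ i - \<alpha> i) + (exp \<beta> - 1) * (sys.F w $ i - \<alpha> i) < 0"
    using eventually_at_right_0_ex by blast
  define l where "l i = - \<beta> * (w $ i - \<alpha> i) + (exp \<beta> - 1) * (sys.F w $ i - \<alpha> i)" for i
  define e where "e n i = - \<beta> * (real (lvl w n i) + 1 - real (a n i)) +
      (exp \<beta> - 1) * (real (N n i) * hit_prob (q n) (lvl w n) i r)" for n i
  have e_lim: "(\<lambda>n. e n i / g n i) \<longlonglongrightarrow> l i" for i
  proof -
    have "(\<lambda>n. - \<beta> * (real (lvl w n i) / g n i + 1 / g n i - real (a n i) / g n i) +
        (exp \<beta> - 1) * (real (N n i) * hit_prob (q n) (lvl w n) i r / g n i)) \<longlonglongrightarrow>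
      - \<beta> * (w $ i + 0 - \<alpha> i) + (exp \<beta> - 1) * (coef r * (\<Sum>j\<in>UNIV. X $ i $ j * w $ j) ^ r)"
      using w alpha by (intro tendsto_intros lvl_tendsto inverse_g hit_tendsto) auto
    moreover have "e n i / g n i = - \<beta> * (real (lvl w n i) / g n i + 1 / g n i - real (a n i) / g n i) +
        (exp \<beta> - 1) * (real (N n i) * hit_prob (q n) (lvl w n) i r / g n i)" for n
      by (simp add: e_def algebra_simps add_divide_distrib diff_divide_distrib)
    ultimately show ?thesis
      by (simp add: l_def sys.F_nth)
  qed
  have bound: "\<forall>\<^sub>F n in sequentially. \<forall>i. exp (e n i) \<le> exp (- (- l i / 2) * g n i)"
    using \<beta>(2) by (intro eventually_all_finite exp_le_scale[OF e_lim]) (simp add: l_def)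
  have "AE \<omega> in M. \<forall>\<^sub>F n in sequentially. \<not> (\<exists>i. lvl w n i < act n i \<omega>)"
  proof (rule AE_eventually_not)
    have tail: "measure M {\<omega> \<in> space M. \<exists>i. lvl w n i < act n i \<omega>} \<le> (\<Sum>i\<in>UNIV. exp (e n i))"
      "{\<omega> \<in> space M. \<exists>i. lvl w n i < act n i \<omega>} \<in> sets M" if n: "n \<ge> CARD('k)" for n
      unfolding act_def e_def
      by (rule sbm_upper_tail[where \<beta> = "\<lambda>_. \<beta>", OF model[OF n] model_facts[OF n] less_imp_le[OF \<beta>(1)]])+
    show "\<forall>\<^sub>F n in sequentially. {\<omega> \<in> space M. \<exists>i. lvl w n i < act n i \<omega>} \<in> sets M"
      using ev_large by eventually_elim (rule tail)
    show "\<forall>\<^sub>F n in sequentially. measure M {\<omega> \<in> space M. \<exists>i. lvl w n i < act n i \<omega>} \<le>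
        (\<Sum>i\<in>UNIV. exp (- (- l i / 2) * g n i))"
      using ev_large bound
      by eventually_elim (rule order_trans[OF tail(1)], auto intro!: sum_mono)
    show "summable (\<lambda>n. \<Sum>i\<in>UNIV. exp (- (- l i / 2) * g n i))"
      using \<beta>(2) by (intro summable_sum summable_exp_scale) (simp add: l_def)
  qed
  then show ?thesis
    by (simp add: not_less)
qed

text \<open>The alternative \<open>y (Suc h) $ i = 0\<close> is for components that the chain has
  not reached yet: there \<open>sys.F (y h) $ i\<close> may be \<open>0\<close>, which leaves no
  room below it.\<close>

lemma AE_act_ge:
  assumes y0: "y 0 = 0" and y: "\<And>h i. 0 \<le> y h $ i"
    and sub: "\<And>h i. y (Suc h) $ i = 0 \<or> y (Suc h) $ i < sys.F (y h) $ i"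
  shows "AE \<omega> in M. \<forall>\<^sub>F n in sequentially. \<forall>i. lvl (y m) n i \<le> act n i \<omega>"
proof -
  \<comment> \<open>Only these pairs can carry a term in \<open>sbm_lower_tail\<close>; at all
    others the level is \<open>0\<close> and the term vanishes.\<close>
  define I where "I = {(h, i) \<in> {..<m} \<times> (UNIV :: 'k set). y (Suc h) $ i \<noteq> 0}"
  have I: "finite I"
    unfolding I_def by (rule finite_subset[of _ "{..<m} \<times> UNIV"]) auto
  have "\<forall>\<^sub>F \<beta> in at_right 0. \<forall>(h, i)\<in>I. \<beta> * y (Suc h) $ i - (1 - exp (- \<beta>)) * sys.F (y h) $ i < 0"
    unfolding case_prod_unfold
  proof (intro eventually_ball_finite[OF I] ballI small_exponent_lower)
    fix x assume "x \<in> I"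
    then show "y (Suc (fst x)) $ snd x < sys.F (y (fst x)) $ snd x"
      using sub[of "fst x" "snd x"] by (auto simp: I_def)
  qed
  from eventually_at_right_0_ex[OF this] obtain \<beta> where \<beta>0: "0 < \<beta>"
    "\<forall>(h, i)\<in>I. \<beta> * y (Suc h) $ i - (1 - exp (- \<beta>)) * sys.F (y h) $ i < 0"
    by (elim exE conjE)
  have \<beta>: "0 < \<beta>"
    "\<And>h i. (h, i) \<in> I \<Longrightarrow> \<beta> * y (Suc h) $ i - (1 - exp (- \<beta>)) * sys.F (y h) $ i < 0"
    using \<beta>0 by auto
  define l where "l h i = \<beta> * y (Suc h) $ i - (1 - exp (- \<beta>)) * sys.F (y h) $ i" for h i
  define e where "e n h i = \<beta> * (real (lvl (y (Suc h)) n i) - 1) - (1 - exp (- \<beta>)) *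
      (real (a n i) + (real (N n i) - real (a n i)) * hit_prob (q n) (lvl (y h) n) i r)" for n h i
  have e_lim: "(\<lambda>n. e n h i / g n i) \<longlonglongrightarrow> l h i" for h i
  proof -
    let ?h = "\<lambda>n. hit_prob (q n) (lvl (y h) n) i r"
    \<comment> \<open>Pulling out \<open>1 - a / N\<close> reduces the factor \<open>N - a\<close>
      to the limit of \<open>hit_tendsto\<close>; the correction disappears by
      \<open>a_over_N\<close>.\<close>
    have "(\<lambda>n. \<beta> * (real (lvl (y (Suc h)) n i) / g n i - 1 / g n i) -
        (1 - exp (- \<beta>)) * (real (a n i) / g n i +
          (1 - real (a n i) / real (N n i)) * (real (N n i) * ?h n / g n i))) \<longlonglongrightarrow>
      \<beta> * (y (Suc h) $ i - 0) - (1 - exp (- \<beta>)) *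
        (\<alpha> i + (1 - 0) * (coef r * (\<Sum>j\<in>UNIV. X $ i $ j * y h $ j) ^ r))"
      using y alpha by (intro tendsto_intros lvl_tendsto inverse_g hit_tendsto a_over_N) auto
    then have "(\<lambda>n. \<beta> * (real (lvl (y (Suc h)) n i) / g n i - 1 / g n i) -
        (1 - exp (- \<beta>)) * (real (a n i) / g n i +
          (1 - real (a n i) / real (N n i)) * (real (N n i) * ?h n / g n i))) \<longlonglongrightarrow> l h i"
      by (simp add: l_def sys.F_nth)
    then show ?thesis
    proof (rule Lim_transform_eventually)
      show "\<forall>\<^sub>F n in sequentially. \<beta> * (real (lvl (y (Suc h)) n i) / g n i - 1 / g n i) -
        (1 - exp (- \<beta>)) * (real (a n i) / g n i +
          (1 - real (a n i) / real (N n i)) * (real (N n i) * ?h n / g n i)) = e n h i / g n i"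
        using N_pos[of i] g_pos[of i]
      proof eventually_elim
        case (elim n)
        have hit: "(1 - real (a n i) / real (N n i)) * (real (N n i) * ?h n / g n i) =
            (real (N n i) - real (a n i)) * ?h n / g n i"
          using elim by (simp add: field_simps)
        show ?case
          unfolding e_def hit by (simp add: algebra_simps add_divide_distrib diff_divide_distrib)
      qed
    qed
  qed
  have "\<forall>\<^sub>F n in sequentially. \<forall>x\<in>I. exp (e n (fst x) (snd x)) \<le> exp (- (- l (fst x) (snd x) / 2) * g n (snd x))"
    using \<beta>(2) by (intro eventually_ball_finite[OF I] ballI exp_le_scale[OF e_lim]) (simp add: l_def)
  then have bound: "\<forall>\<^sub>F n in sequentially. \<forall>(h, i)\<in>I. exp (e n h i) \<le> exp (- (- l h i / 2) * g n i)"
    by (simp add: case_prod_unfold)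
  have "AE \<omega> in M. \<forall>\<^sub>F n in sequentially. \<not> (\<exists>i. act n i \<omega> < lvl (y m) n i)"
  proof (rule AE_eventually_not)
    have tail: "measure M {\<omega> \<in> space M. \<exists>i. act n i \<omega> < lvl (y m) n i} \<le>
        (\<Sum>(h, i)\<in>{..<m} \<times> UNIV. if lvl (y (Suc h)) n i = 0 then 0 else exp (e n h i))"
      "{\<omega> \<in> space M. \<exists>i. act n i \<omega> < lvl (y m) n i} \<in> sets M" if n: "n \<ge> CARD('k)" for n
    proof -
      have "lvl (y 0) n = (\<lambda>_. 0)"
        by (auto simp: y0 lvl_def)
      then show "measure M {\<omega> \<in> space M. \<exists>i. act n i \<omega> < lvl (y m) n i} \<le>
          (\<Sum>(h, i)\<in>{..<m} \<times> UNIV. if lvl (y (Suc h)) n i = 0 then 0 else exp (e n h i))"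
        "{\<omega> \<in> space M. \<exists>i. act n i \<omega> < lvl (y m) n i} \<in> sets M"
        unfolding act_def e_def
        by (rule sbm_lower_tail[where \<beta> = "\<lambda>_. \<beta>" and T = "\<lambda>h. lvl (y h) n",
            OF model[OF n] model_facts[OF n] less_imp_le[OF \<beta>(1)]])+
    qed
    show "\<forall>\<^sub>F n in sequentially. {\<omega> \<in> space M. \<exists>i. act n i \<omega> < lvl (y m) n i} \<in> sets M"
      using ev_large by eventually_elim (rule tail)
    show "\<forall>\<^sub>F n in sequentially. measure M {\<omega> \<in> space M. \<exists>i. act n i \<omega> < lvl (y m) n i} \<le>
        (\<Sum>(h, i)\<in>I. exp (- (- l h i / 2) * g n i))"
      using ev_large bound
    proof eventually_elim
      case (elim n)
      have "lvl (y (Suc h)) n i = 0" if "(h, i) \<notin> I" "h < m" for h i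
        using that by (auto simp: I_def lvl_def)
      then have "(\<Sum>(h, i)\<in>{..<m} \<times> UNIV. if lvl (y (Suc h)) n i = 0 then 0 else exp (e n h i)) =
          (\<Sum>(h, i)\<in>I. if lvl (y (Suc h)) n i = 0 then 0 else exp (e n h i))"
        by (intro sum.mono_neutral_right) (auto simp: I_def)
      also have "\<dots> \<le> (\<Sum>(h, i)\<in>I. exp (- (- l h i / 2) * g n i))"
        using elim(2) by (intro sum_mono) (auto intro: order_trans[OF _ less_imp_le[OF exp_gt_zero]])
      finally show ?case
        using tail(1)[OF elim(1)] by linarith
    qed
    have "summable (\<lambda>n. \<Sum>x\<in>I. exp (- (- l (fst x) (snd x) / 2) * g n (snd x)))"
      using \<beta>(2) by (intro summable_sum summable_exp_scale) (simp add: l_def)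
    then show "summable (\<lambda>n. \<Sum>(h, i)\<in>I. exp (- (- l h i / 2) * g n i))"
      by (simp add: case_prod_unfold)
  qed
  then show ?thesis
    by (simp add: not_less)
qed

text \<open>\<open>S n \<omega>\<close> is known to lie in \<open>{..<n}\<close> only almost surely,
  and \<open>card\<close> is \<open>0\<close> on infinite sets; splitting the count by communities
  requires finiteness.\<close>

lemma AE_finite_final: "AE \<omega> in M. \<forall>\<^sub>F n in sequentially. finite (final_active r n (E n \<omega>) (S n \<omega>))"
proof -
  have "AE \<omega> in M. \<forall>\<^sub>F n in sequentially. \<not> infinite (final_active r n (E n \<omega>) (S n \<omega>))"
  proof (rule AE_eventually_not)
    have ev: "{\<omega> \<in> space M. infinite (final_active r n (E n \<omega>) (S n \<omega>))} \<in> sets M"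
      "measure M {\<omega> \<in> space M. infinite (final_active r n (E n \<omega>) (S n \<omega>))} \<le> 0" if n: "n \<ge> CARD('k)" for n
    proof -
      have a: "a n i \<le> card (community n (c n) i)" for i
        using sizes[OF n] a_range[OF n] by simp
      have "measure_pmf.prob (edges_pmf (q n) (c n) (inner_pairs {..<n}))
        {f. infinite (act_hull {..<n} (Collect f) (\<lambda>v. if v \<in> s then 0 else r))} \<le> 0" for s
        by (simp add: finite_act_hull)
      from sbm_event_le[where R = infinite, OF model[OF n] a this]
      show "{\<omega> \<in> space M. infinite (final_active r n (E n \<omega>) (S n \<omega>))} \<in> sets M"
        "measure M {\<omega> \<in> space M. infinite (final_active r n (E n \<omega>) (S n \<omega>))} \<le> 0"
        by auto
    qed
    show "\<forall>\<^sub>F n in sequentially. {\<omega> \<in> space M. infinite (final_active r n (E n \<omega>) (S n \<omega>))} \<in> sets M"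
      "\<forall>\<^sub>F n in sequentially. measure M {\<omega> \<in> space M. infinite (final_active r n (E n \<omega>) (S n \<omega>))} \<le> 0"
      using ev by (auto intro: eventually_mono[OF ev_large])
  qed simp
  then show ?thesis
    by simp
qed


subsection \<open>Convergence\<close>

text \<open>The factor \<open>1 - s\<close> leaves room for the deviation allowed in each step of the chain.\<close>

primrec damped :: "real \<Rightarrow> nat \<Rightarrow> 'k rvec" where
  "damped s 0 = 0"
| "damped s (Suc m) = (1 - s) *\<^sub>R sys.F (damped s m)"

lemma damped_nonneg: "s \<le> 1 \<Longrightarrow> 0 \<le> damped s m"
proof (induction m)
  case (Suc m)
  then have "0 \<le> sys.F (damped s m)"
    by (intro sys.F_nonneg)
  then show ?case
    using Suc.prems by (simp add: less_eq_vec_def)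
qed simp

lemma damped_tendsto:
  assumes "s \<longlonglongrightarrow> 0"
  shows "(\<lambda>k. damped (s k) m) \<longlonglongrightarrow> sys.iter m"
proof (induction m)
  case (Suc m)
  have "(\<lambda>k. sys.F (damped (s k) m)) \<longlonglongrightarrow> sys.F (sys.iter m)"
  proof (rule vec_tendstoI)
    fix i
    have "isCont (\<lambda>x. sys.F x $ i) (sys.iter m)"
      using sys.continuous_F[of UNIV i] by (simp add: continuous_on_eq_continuous_at)
    then show "(\<lambda>k. sys.F (damped (s k) m) $ i) \<longlonglongrightarrow> sys.F (sys.iter m) $ i"
      using Suc by (rule isCont_tendsto_compose)
  qed
  then have "(\<lambda>k. (1 - s k) *\<^sub>R sys.F (damped (s k) m)) \<longlonglongrightarrow> (1 - 0) *\<^sub>R sys.F (sys.iter m)"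
    using assms by (intro tendsto_intros)
  then show ?case
    by simp
qed simp

text \<open>A sequence, so that the almost sure bounds for all \<open>k\<close> hold outside one
  null set.\<close>

definition sc :: "nat \<Rightarrow> real" where
  "sc k = 1 / real (Suc k)"

lemma sc: "0 < sc k" "sc k \<le> 1"
  by (auto simp: sc_def)

lemma sc_tendsto: "sc \<longlonglongrightarrow> 0"
  unfolding sc_def[abs_def] by (rule LIMSEQ_Suc[OF lim_1_over_n])

text \<open>All the countably many bounds hold off one null set. From below \<open>m\<close> is
  chosen first, with \<open>sys.iter m\<close> close to \<open>sys.L\<close>, and then
  \<open>k\<close>, because \<open>damped_tendsto\<close> is for fixed \<open>m\<close>; from above
  \<open>sys.super (sc k)\<close> tends to \<open>sys.L\<close>.\<close>

lemma AE_act_tendsto: "AE \<omega> in M. \<forall>i. (\<lambda>n. real (act n i \<omega>) / g n i) \<longlonglongrightarrow> sys.L $ i"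
proof -
  have "AE \<omega> in M. \<forall>k. \<forall>\<^sub>F n in sequentially. \<forall>i. act n i \<omega> \<le> lvl (sys.super (sc k)) n i"
  proof (subst AE_all_countable, rule allI, rule AE_act_le)
    fix k i
    show "0 \<le> sys.super (sc k) $ i"
      using sys.L_pos[of i] sys.super_bounds(1)[OF sc, of i k] by simp
    show "sys.F (sys.super (sc k)) $ i < sys.super (sc k) $ i"
      by (rule sys.F_super_less[OF sc])
  qed
  moreover have "AE \<omega> in M. \<forall>m k. \<forall>\<^sub>F n in sequentially. \<forall>i. lvl (damped (sc k) m) n i \<le> act n i \<omega>"
  proof (subst AE_all_countable, rule allI, subst AE_all_countable, rule allI, rule AE_act_ge)
    fix k h i
    have nonneg: "0 \<le> damped (sc k) h" for h
      by (rule damped_nonneg[OF sc(2)])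
    then show "0 \<le> damped (sc k) h $ i"
      by (simp add: less_eq_vec_def)
    \<comment> \<open>A vanishing component stays \<open>0\<close> after damping; a positive one is
      strictly reduced by the factor \<open>1 - sc k\<close>.\<close>
    have "0 \<le> sys.F (damped (sc k) h) $ i"
      using sys.F_nonneg[OF nonneg] by (simp add: less_eq_vec_def)
    then show "damped (sc k) (Suc h) $ i = 0 \<or> damped (sc k) (Suc h) $ i < sys.F (damped (sc k) h) $ i"
      using sc[of k] by (auto simp: less_le)
  qed simp
  ultimately show ?thesis
  proof eventually_elim
    case (elim \<omega>)
    show ?case
    proof (intro allI order_tendstoI)
      fix i b assume "b < sys.L $ i"
      then have "\<forall>\<^sub>F m in sequentially. b < sys.iter m $ i"
        by (rule order_tendstoD(1)[OF sys.iter_tendsto])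
      then obtain m where "b < sys.iter m $ i"
        using eventually_happens by force
      then have "\<forall>\<^sub>F k in sequentially. b < damped (sc k) m $ i"
        by (rule order_tendstoD(1)[OF tendsto_vec_nth[OF damped_tendsto[OF sc_tendsto]]])
      then obtain k where k: "b < damped (sc k) m $ i"
        using eventually_happens by force
      have "(\<lambda>n. real (lvl (damped (sc k) m) n i) / g n i) \<longlonglongrightarrow> damped (sc k) m $ i"
        using damped_nonneg[OF sc(2), of k m] by (intro lvl_tendsto) (simp add: less_eq_vec_def)
      then have "\<forall>\<^sub>F n in sequentially. b < real (lvl (damped (sc k) m) n i) / g n i"
        using k by (rule order_tendstoD)
      with elim(2)[rule_format, of k m] g_pos[of i]
      show "\<forall>\<^sub>F n in sequentially. b < real (act n i \<omega>) / g n i"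
      proof eventually_elim
        case (elim n)
        then have "real (lvl (damped (sc k) m) n i) / g n i \<le> real (act n i \<omega>) / g n i"
          by (intro divide_right_mono) auto
        then show ?case
          using elim(3) by linarith
      qed
    next
      fix i b assume b: "sys.L $ i < b"
      have "(\<lambda>k. sys.super (sc k) $ i) \<longlonglongrightarrow> (sys.L + 0 *\<^sub>R (sys.upper_pt - sys.L)) $ i"
        unfolding sys.super_def by (intro tendsto_intros sc_tendsto)
      then have "\<forall>\<^sub>F k in sequentially. sys.super (sc k) $ i < b"
        using b by (intro order_tendstoD) auto
      then obtain k where k: "sys.super (sc k) $ i < b"
        using eventually_happens by force
      have "(\<lambda>n. real (lvl (sys.super (sc k)) n i) / g n i) \<longlonglongrightarrow> sys.super (sc k) $ i"
        using sys.L_pos[of i] sys.super_bounds(1)[OF sc, of i k] by (intro lvl_tendsto) simp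
      then have "\<forall>\<^sub>F n in sequentially. real (lvl (sys.super (sc k)) n i) / g n i < b"
        using k by (rule order_tendstoD)
      with elim(1)[rule_format, of k] g_pos[of i]
      show "\<forall>\<^sub>F n in sequentially. real (act n i \<omega>) / g n i < b"
      proof eventually_elim
        case (elim n)
        then have "real (act n i \<omega>) / g n i \<le> real (lvl (sys.super (sc k)) n i) / g n i"
          by (intro divide_right_mono) auto
        then show ?case
          using elim(3) by linarith
      qed
    qed
  qed
qed

text \<open>The community counts converge on different scales; \<open>g_ratio\<close> converts each
  to the scale of \<open>fst_idx\<close> and so produces the weights of
  \<open>x_star\<close>.\<close>

lemma AE_final_tendsto:
  "AE \<omega> in M. (\<lambda>n. real (card (final_active r n (E n \<omega>) (S n \<omega>))) / g n fst_idx) \<longlonglongrightarrow>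
     (\<Sum>i\<in>UNIV. sys.L $ i * ratio fst_idx i)"
  using AE_act_tendsto AE_finite_final
proof eventually_elim
  case (elim \<omega>)
  have "(\<lambda>n. \<Sum>i\<in>UNIV. real (act n i \<omega>) / g n i * (g n i / g n fst_idx)) \<longlonglongrightarrow>
      (\<Sum>i\<in>UNIV. sys.L $ i * ratio fst_idx i)"
    using elim(1) by (intro tendsto_sum tendsto_mult g_ratio) auto
  then show ?case
  proof (rule Lim_transform_eventually)
    show "\<forall>\<^sub>F n in sequentially. (\<Sum>i\<in>UNIV. real (act n i \<omega>) / g n i * (g n i / g n fst_idx)) =
        real (card (final_active r n (E n \<omega>) (S n \<omega>))) / g n fst_idx"
      using elim(2) g_pos_all
    proof eventually_elim
      case (elim n)
      let ?A = "final_active r n (E n \<omega>) (S n \<omega>)"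
      have "card ?A = card (\<Union>i. {v \<in> ?A. c n v = i})"
        by (rule arg_cong[of _ _ card]) auto
      also have "\<dots> = (\<Sum>i\<in>UNIV. act n i \<omega>)"
        unfolding act_def using elim(1) by (intro card_UN_disjoint) auto
      finally have card: "real (card ?A) = (\<Sum>i\<in>UNIV. real (act n i \<omega>))"
        by simp
      have "real (act n i \<omega>) / g n i * (g n i / g n fst_idx) = real (act n i \<omega>) / g n fst_idx" for i
        using elim(2)[rule_format, of i] by simp
      then show ?case
        unfolding card sum_divide_distrib by (intro sum.cong refl)
    qed
  qed
qed

lemma limit_pos: "0 < (\<Sum>i\<in>UNIV. sys.L $ i * ratio fst_idx i)"
  using sys.L_pos ratio_pos by (intro sum_pos) auto

end

theorem corollary3p4:
  fixes M :: "'w measure"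
    and r :: nat and r' y0 :: real
    and c :: "nat \<Rightarrow> nat \<Rightarrow> 'k::{finite,linorder}"
    and N a :: "nat \<Rightarrow> 'k \<Rightarrow> nat"
    and q :: "nat \<Rightarrow> 'k \<Rightarrow> 'k \<Rightarrow> real"
    and E :: "nat \<Rightarrow> 'w \<Rightarrow> (nat \<times> nat) set"
    and S :: "nat \<Rightarrow> 'w \<Rightarrow> nat set"
    and \<nu> \<mu> \<gamma> :: "'k \<Rightarrow> 'k \<Rightarrow> real"
    and \<alpha> :: "'k \<Rightarrow> real"
  assumes "prob_space M" and "r \<ge> 2"
    and sizes: "\<And>n i. n \<ge> CARD('k) \<Longrightarrow> card (community n (c n) i) = N n i \<and> N n i \<ge> 1"
    and q_range: "\<And>n i j. n \<ge> CARD('k) \<Longrightarrow> 0 \<le> q n i j \<and> q n i j < 1 \<and> q n i j = q n j i"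
    and a_range: "\<And>n i. n \<ge> CARD('k) \<Longrightarrow> a n i \<le> N n i"
    and model: "\<And>n. n \<ge> CARD('k) \<Longrightarrow> sbm_with_seeds M n (c n) (q n) (a n) (E n) (S n)"
    and nu: "\<And>i j. 0 < \<nu> i j \<and> (\<lambda>n. real (N n i) / real (N n j)) \<longlonglongrightarrow> \<nu> i j"
    and r': "1 < r'" "r' < real r"
    and p_lower: "\<And>i. much_less (\<lambda>n. 1 / real (N n i)) (\<lambda>n. q n i i)"
    and p_upper: "\<And>i. less_sim (\<lambda>n. q n i i) (\<lambda>n. real (N n i) powr (- 1 / r'))"
    and q_le: "\<And>n i j. n \<ge> CARD('k) \<Longrightarrow> q n i j \<le> min (q n i i) (q n j j)"
    and gamma: "\<And>i j. 0 \<le> \<gamma> i j \<and> \<gamma> i j \<le> 1 \<and> (\<lambda>n. q n i j / q n i i) \<longlonglongrightarrow> \<gamma> i j"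
    and mu: "\<And>i j. 0 < \<mu> i j \<and> (\<lambda>n. q n i i / q n j j) \<longlonglongrightarrow> \<mu> i j"
    and alpha: "\<And>i. 0 \<le> \<alpha> i \<and> (\<lambda>n. real (a n i) / crit_scale r N q n i) \<longlonglongrightarrow> \<alpha> i"
    and irred: "irreducible_mat (chi_mat r N q)"
    and alpha_mono: "antimono \<alpha>" and alpha_pos: "0 < \<alpha> fst_idx"
    and subcrit: "subcritical r \<alpha> (chi_mat r N q)"
  defines "x_star \<equiv> \<Sum>i\<in>UNIV. x_exit r \<alpha> (chi_mat r N q) y0 $ i *
                      (\<nu> fst_idx i * (\<mu> fst_idx i) ^ r) powr (1 / (real r - 1))"
  shows "0 < x_star \<and>
    (AE \<omega> in M. (\<lambda>n. real (card (final_active r n (E n \<omega>) (S n \<omega>))) / crit_scale r N q n fst_idx)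
        \<longlonglongrightarrow> x_star)"
proof -
  interpret prob_space M
    by fact
  interpret sbm_subcritical M r r' c N a q \<nu> \<mu> \<gamma> \<alpha> E S
    by unfold_locales (fact assms)+
  show ?thesis
    unfolding x_star_def sys.x_exit_eq
    using limit_pos AE_final_tendsto by (simp add: ratio_def)
qed

end
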